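(* Let the hyperbolic system $\bm u_t+\bm f_1(\bm u)_x+\bm f_2(\bm u)_y=\bm 0$ be rotation-invariant (RI), and let $\mathcal F_\tau^{\rm RI}$ be the rotation-invariant oscillation-eliminating (RIOE) procedure. Then $\mathcal F^{\rm RI}_\tau$ preserves rotational invariance: whenever $\hat{\bm u}_h(\hat{\bm x})=T_{\bm\xi}\bm u_h(\bm x)$ with $\hat{\bm x}=M_{\bm\xi}\bm x$, $$(\mathcal F_\tau^{\rm RI}\hat{\bm u}_h)(\hat{\bm x})=T_{\bm\xi}(\mathcal F_\tau^{\rm RI}\bm u_h)(\bm x).$$ Therefore, the OEDG method with the RIOE procedure is RI, provided both the system and the numerical flux $\hat{\bm F}(\cdot,\cdot,\cdot)$ are RI; that is, the numerical solutions it produces on $(\Omega,\mathcal T_h)$ with initial condition $\bm u_0(\bm x)$ and on the rotated pair $(\hat\Omega,\hat{\mathcal T}_h)$ with initial condition $\hat{\bm u}_0(\hat{\bm x})=T_{\bm\xi}\bm u_0(\bm x)$ are related by the same transformation $T_{\bm\xi}$.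
   Context: **System.** $\bm u\in\mathbb R^d$, $d\ge2$, $\bm F=(\bm f_1,\bm f_2)$. $R(\bm u,\mathbf n)$ is the spectral radius of $n^1\partial\bm f_1/\partial\bm u+n^2\partial\bm f_2/\partial\bm u$ for $\mathbf n=(n^1,n^2)^\top$. **RI system.** The system is RI if for every unit vector $\bm\xi=(\cos\phi,\sin\phi)^\top$ there is an orthogonal matrix $T_{\bm\xi}$ with $T_{\bm\xi}^{-1}\bm f_1(T_{\bm\xi}\bm u)=\cos\phi\,\bm f_1(\bm u)+\sin\phi\,\bm f_2(\bm u)$ and $T_{\bm\xi}^{-1}\bm f_2(T_{\bm\xi}\bm u)=-\sin\phi\,\bm f_1(\bm u)+\cos\phi\,\bm f_2(\bm u)$. Put $M_{\bm\xi}=\begin{pmatrix}\cos\phi&\sin\phi\\-\sin\phi&\cos\phi\end{pmatrix}$. The model case is the 2D compressible Euler system, $\bm u=(\rho,m_1,m_2,E)^\top$, $\bm f_1=(m_1,m_1v_1+p,m_2v_1,(E+p)v_1)^\top$, $\bm f_2=(m_2,m_1v_2,m_2v_2+p,(E+p)v_2)^\top$, $\bm m=(m_1,m_2)^\top=\rho\bm v$, $E=\frac12\rho|\bm v|^2+\frac p{\gamma-1}$, with $T_{\bm\xi}=\mathrm{diag}\{1,M_{\bm\xi},1\}$. More generally the components of $\bm u$ are divided into scalar quantities (unchanged by $T_{\bm\xi}$) and 2-vector quantities analogous to the momentum $\bm m$ (transformed by $M_{\bm\xi}$). **RI flux.** $\hat{\bm F}$ is RI if $\hat{\bm F}(T_{\bm\xi}\bm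 u^{\rm int},T_{\bm\xi}\bm u^{\rm ext},M_{\bm\xi}\mathbf n)=T_{\bm\xi}\hat{\bm F}(\bm u^{\rm int},\bm u^{\rm ext},\mathbf n)$. **Mesh and rotation.** $\mathcal T_h$ is a triangulation of $\Omega\subset\mathbb R^2$. For $K\in\mathcal T_h$, $e_K^{(i)}$ ($i=1,2,3$) are the edges, $l_K^{(i)}$ their lengths, $\mathbf n_K^{(i)}=(n_K^{(i),1},n_K^{(i),2})^\top$ the outward unit normals, $h_K^{(i)}=\sup_{\bm x\in K}\mathrm{dist}(\bm x,e_K^{(i)})$. $\hat\Omega$ is $\Omega$ rotated clockwise by $\phi$ about the origin, $\hat{\bm x}=M_{\bm\xi}\bm x$; $\hat{\mathcal T}_h$ consists of the rotated cells (same vertex/edge numbering); boundary data are transformed accordingly. **RIOE procedure.** $[\mathbb V_h^k]^d$ ($k\ge1$): piecewise polynomials of degree $\le k$. $\mathcal P^m$: cellwise $L^2$ projection onto polynomials of degree $\le m$. $\Delta t$: time step. On each $K$ $$\mathcal F^{\rm RI}_\tau\bm u_h=\mathcal P^0\bm u_h+\sum_{m=1}^k\exp\Big\{-\Delta t\sum_{j=0}^m\bm\sigma_K^j(\bm u_h)\Big\}\circ(\mathcal P^m-\mathcal P^{m-1})\bm u_h$$ (componentwise exponential and product), with $\bm\sigma_K^j(\bm u_h)=\sum_{i=1}^3\frac{\beta_K^{(i)}}{h_K^{(i)}}\hat{\bm\delta}_K^{(i),j}(\bm u_h)$, where $\beta_K^{(i)}$ is the maximum of $R(\cdot,\mathbf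 n_K^{(i)})$ over the two one-sided values of $\bm u_h$ at the two endpoints of $e_K^{(i)}$. For Euler, $$\hat{\bm\delta}_K^{(i),j}(\bm u_h)=\big(\delta_K^{(i),j}(\rho_h),\hat\delta_K^{(i),j}(\bm m_h),\hat\delta_K^{(i),j}(\bm m_h),\delta_K^{(i),j}(E_h)\big)^\top;$$ in general, each scalar quantity uses $\delta_K^{(i),j}$ and both components of each 2-vector quantity use $\hat\delta_K^{(i),j}$. For a scalar $w_h$ with mean $\bar w_h^\Omega$ over $\Omega$: $\delta_K^{(i),j}(w_h)=0$ if $w_h\equiv\bar w_h^\Omega$, otherwise $$\delta_K^{(i),j}(w_h)=A^{k,j}\frac{(h_K^{(i)})^j}{\|w_h-\bar w_h^\Omega\|_{L^\infty(\Omega)}}\sqrt{\frac1{l_K^{(i)}}\int_{e_K^{(i)}}\sum_{|\bm\alpha|=j}C_j^{\alpha_1}[\![\partial^{\bm\alpha}w_h]\!]^2ds},\quad A^{k,j}=\frac{2j+1}{(2k-1)j!},\ C_j^{\alpha_1}=\frac{j!}{\alpha_1!(j-\alpha_1)!},$$ where $[\![\cdot]\!]$ is the jump across $e_K^{(i)}$. For a 2-vector $\bm m_h$ with mean $\bar{\bm m}_h^\Omega$ over $\Omega$, set $m_{n,h}^{(i)}=\bm m_h\cdot\mathbf n_K^{(i)}$, $m_{t,h}^{(i)}=-m_{1,h}n_K^{(i),2}+m_{2,h}n_K^{(i),1}$, and $\hat\delta_K^{(i),j}(\bm m_h)=\max\{\hat\delta_K^{(i),j}(m_{n,h}^{(i)}),\hat\delta_K^{(i),j}(m_{t,h}^{(i)})\}$,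 where for $*\in\{n,t\}$, $\hat\delta_K^{(i),j}(m_{*,h}^{(i)})=0$ if $\bm m_h\equiv\bar{\bm m}_h^\Omega$, otherwise $$\hat\delta_K^{(i),j}(m_{*,h}^{(i)})=A^{k,j}\frac{(h_K^{(i)})^j}{\big\|\,\|\bm m_h-\bar{\bm m}_h^\Omega\|\,\big\|_{L^\infty(\Omega)}}\sqrt{\frac1{l_K^{(i)}}\int_{e_K^{(i)}}\sum_{|\bm\alpha|=j}C_j^{\alpha_1}[\![\partial^{\bm\alpha}m_{*,h}^{(i)}]\!]^2ds}$$ with $\|\cdot\|$ the Euclidean norm. On the rotated mesh the same formulas are used with the rotated cells and $\hat\Omega$, and the same $\Delta t$. **OEDG method.** The semi-discrete DG scheme: for all $\bm v_h\in[\mathbb V_h^k]^d$ and cells $K$, $$\int_K\partial_t\bm u_h\circ\bm v_h\,d\bm x=\int_K\big(\bm f_1(\bm u_h)\circ\partial_x\bm v_h+\bm f_2(\bm u_h)\circ\partial_y\bm v_h\big)d\bm x-\sum_{i=1}^3\int_{e_K^{(i)}}\hat{\bm F}(\bm u_h^{\rm int},\bm u_h^{\rm ext},\mathbf n_K^{(i)})\circ\bm v_h\,ds$$ (int/ext: traces from inside/outside $K$; integrals possibly replaced by quadratures with fixed barycentric nodes), initialized by the $L^2$ projection of the initial condition, is advanced by an explicit strong-stability-preserving Runge–Kutta method (convex combinations of forward Euler steps), with time steps determined from the cell geometry and the spectral radii $R(\bm u,\mathbf n_K^{(i)})$ of the numerical solution, and with $\mathcal F_\tau^{\rm RI}$ applied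 after each Runge–Kutta stage. *)

theory Defs
  imports "HOL-Analysis.Analysis" "HOL-Probability.Essential_Supremum"
begin

definition rot :: "real \<Rightarrow> real^2^2" where
  "rot \<phi> = vector [vector [cos \<phi>, sin \<phi>], vector [- sin \<phi>, cos \<phi>]]"

text \<open>The components of the state vector are split into scalar quantities and 2-vector quantities.
  A set \<open>V\<close> of pairs of component indices records the vector quantities: \<open>(i, j) \<in> V\<close> means that
  components \<open>i\<close> and \<open>j\<close> are, in this order, the first and second component of one of them.
  Indices occurring in no pair are scalar quantities.
  For the two-dimensional Euler equations with state (rho, m1, m2, E), \<open>V = {(2, 3)}\<close>.\<close>

definition vector_pairs :: "('d \<times> 'd) set \<Rightarrow> bool" where
  "vector_pairs V \<longleftrightarrow> inj_on fst V \<and> inj_on snd V \<and> fst ` V \<inter> snd ` V = {}"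

definition is_scalar :: "('d \<times> 'd) set \<Rightarrow> 'd \<Rightarrow> bool" where
  "is_scalar V i \<longleftrightarrow> i \<notin> fst ` V \<union> snd ` V"

definition pair_of :: "('d \<times> 'd) set \<Rightarrow> 'd \<Rightarrow> 'd \<times> 'd" where
  "pair_of V i = (THE p. p \<in> V \<and> (i = fst p \<or> i = snd p))"

text \<open>The matrix \<open>T\<close> belonging to the direction \<open>(cos \<phi>, sin \<phi>)\<close>:
  identity on scalars, \<open>rot \<phi>\<close> on each vector quantity.\<close>

definition comp_rot :: "('d \<times> 'd) set \<Rightarrow> real \<Rightarrow> real^'d^'d" where
  "comp_rot V \<phi> = (\<chi> i j.
     if is_scalar V i then (if i = j then 1 else 0)
     else if i = j then cos \<phi>
     else if (i, j) \<in> V then sin \<phi>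
     else if (j, i) \<in> V then - sin \<phi>
     else 0)"

definition rotate_field :: "('d::finite \<times> 'd) set \<Rightarrow> real \<Rightarrow> (real^2 \<Rightarrow> real^'d) \<Rightarrow> real^2 \<Rightarrow> real^'d" where
  "rotate_field V \<phi> w = (\<lambda>x. comp_rot V \<phi> *v w (rot (- \<phi>) *v x))"

text \<open>\<open>states\<close> is the set of admissible states on which the fluxes are given, for instance those with
  positive density and pressure for the Euler equations, or \<open>UNIV\<close>.
  The values of the fluxes elsewhere are irrelevant.\<close>

record 'd system =
  states :: "(real^'d) set"
  flux1 :: "real^'d \<Rightarrow> real^'d"
  flux2 :: "real^'d \<Rightarrow> real^'d"
  vecs :: "('d \<times> 'd) set"

definition normal_jacobian :: "('d::finite) system \<Rightarrow> real^'d \<Rightarrow> real^2 \<Rightarrow> real^'d^'d" where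
  "normal_jacobian S u n =
     (n $ 1) *\<^sub>R jacobian (flux1 S) (at u) + (n $ 2) *\<^sub>R jacobian (flux2 S) (at u)"

definition hyperbolic :: "('d::finite) system \<Rightarrow> bool" where
  "hyperbolic S \<longleftrightarrow> open (states S) \<and>
     (\<forall>u\<in>states S. flux1 S differentiable (at u) \<and> flux2 S differentiable (at u) \<and>
        (\<forall>n::real^2. \<exists>(P::real^'d^'d) (D::real^'d^'d). invertible P \<and> (\<forall>i j. i \<noteq> j \<longrightarrow> D $ i $ j = 0) \<and>
           normal_jacobian S u n ** P = P ** D))"

definition rotation_invariant_system :: "('d::finite) system \<Rightarrow> bool" where
  "rotation_invariant_system S \<longleftrightarrow> (\<forall>\<phi>. let T = comp_rot (vecs S) \<phi> in
     orthogonal_matrix T \<and>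
     (\<forall>u\<in>states S. T *v u \<in> states S \<and>
        matrix_inv T *v flux1 S (T *v u) = cos \<phi> *\<^sub>R flux1 S u + sin \<phi> *\<^sub>R flux2 S u \<and>
        matrix_inv T *v flux2 S (T *v u) = - sin \<phi> *\<^sub>R flux1 S u + cos \<phi> *\<^sub>R flux2 S u))"

definition rotation_invariant_flux ::
  "('d::finite) system \<Rightarrow> (real^'d \<Rightarrow> real^'d \<Rightarrow> real^2 \<Rightarrow> real^'d) \<Rightarrow> bool" where
  "rotation_invariant_flux S F \<longleftrightarrow> (\<forall>\<phi>. let T = comp_rot (vecs S) \<phi> in
     \<forall>ui\<in>states S. \<forall>ue\<in>states S. \<forall>n. norm n = 1 \<longrightarrow>
       F (T *v ui) (T *v ue) (rot \<phi> *v n) = T *v F ui ue n)"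

definition spectral_radius :: "real^'n^'n \<Rightarrow> real" where
  "spectral_radius A =
     Max (cmod ` {l. \<exists>z::complex^'n. z \<noteq> 0 \<and> map_matrix complex_of_real A *v z = l *s z})"

text \<open>The Jacobians only exist on \<open>states S\<close>; elsewhere \<open>wave_speed\<close> is 0 by convention.\<close>

definition wave_speed :: "('d::finite) system \<Rightarrow> real^'d \<Rightarrow> real^2 \<Rightarrow> real" where
  "wave_speed S u n = (if u \<in> states S then spectral_radius (normal_jacobian S u n) else 0)"

text \<open>A mesh is a numbering of the cells by a finite type together with the three vertices of each
  cell. Edge \<open>i\<close> is opposite to vertex \<open>i\<close>; arithmetic in the index type \<open>3\<close> is modulo 3.\<close>

type_synonym 'c mesh = "'c \<Rightarrow> 3 \<Rightarrow> real^2"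

definition cell :: "'c mesh \<Rightarrow> 'c \<Rightarrow> (real^2) set" where
  "cell v c = convex hull (range (v c))"

definition edge :: "'c mesh \<Rightarrow> 'c \<Rightarrow> 3 \<Rightarrow> (real^2) set" where
  "edge v c i = closed_segment (v c (i + 1)) (v c (i + 2))"

definition edge_length :: "'c mesh \<Rightarrow> 'c \<Rightarrow> 3 \<Rightarrow> real" where
  "edge_length v c i = dist (v c (i + 1)) (v c (i + 2))"

definition edge_height :: "'c mesh \<Rightarrow> 'c \<Rightarrow> 3 \<Rightarrow> real" where
  "edge_height v c i = (SUP x\<in>cell v c. infdist x (edge v c i))"

definition outward_normal :: "'c mesh \<Rightarrow> 'c \<Rightarrow> 3 \<Rightarrow> real^2" where
  "outward_normal v c i = (THE n. norm n = 1 \<and>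
     n \<bullet> (v c (i + 2) - v c (i + 1)) = 0 \<and> n \<bullet> (v c i - v c (i + 1)) < 0)"

definition triangulates :: "'c::finite mesh \<Rightarrow> (real^2) set \<Rightarrow> bool" where
  "triangulates v \<Omega> \<longleftrightarrow>
     (\<forall>c. inj (v c) \<and> \<not> affine_dependent (range (v c))) \<and>
     inj (cell v) \<and> triangulation (range (cell v)) \<and>
     (\<Union>c. interior (cell v c)) \<subseteq> \<Omega> \<and> \<Omega> \<subseteq> (\<Union>c. cell v c)"

definition rotate_mesh :: "real \<Rightarrow> 'c mesh \<Rightarrow> 'c mesh" where
  "rotate_mesh \<phi> v = (\<lambda>c i. rot \<phi> *v v c i)"

definition neighbour :: "'c mesh \<Rightarrow> 'c \<Rightarrow> 3 \<Rightarrow> 'c \<Rightarrow> bool" where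
  "neighbour v c i c' \<longleftrightarrow> c' \<noteq> c \<and> (\<exists>i'. edge v c' i' = edge v c i)"

definition poly2 :: "nat \<Rightarrow> (real^2 \<Rightarrow> real) set" where
  "poly2 m = {p. \<exists>a::nat \<Rightarrow> nat \<Rightarrow> real. p = (\<lambda>x. \<Sum>r\<le>m. \<Sum>s\<le>m - r. a r s * (x $ 1) ^ r * (x $ 2) ^ s)}"

text \<open>A broken polynomial is a family of polynomials indexed by the cells. Only the values of the
  \<open>c\<close>-th member on \<open>cell v c\<close> matter (they determine it); its values and derivatives on an edge of the
  cell are the one-sided ones. \<open>broken v w\<close> is the corresponding function on the domain, with an
  arbitrary value on the negligible union of the edges.\<close>

definition dg_space :: "nat \<Rightarrow> ('c \<Rightarrow> real^2 \<Rightarrow> real^'d) set" where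
  "dg_space k = {u. \<forall>c i. (\<lambda>x. u c x $ i) \<in> poly2 k}"

definition broken :: "'c mesh \<Rightarrow> ('c \<Rightarrow> real^2 \<Rightarrow> 'b::zero) \<Rightarrow> real^2 \<Rightarrow> 'b" where
  "broken v w x = (if \<exists>c. x \<in> interior (cell v c) then w (THE c. x \<in> interior (cell v c)) x else 0)"

definition domain_mean :: "(real^2) set \<Rightarrow> 'c mesh \<Rightarrow> ('c \<Rightarrow> real^2 \<Rightarrow> 'b) \<Rightarrow>
    'b::{banach, second_countable_topology}" where
  "domain_mean \<Omega> v w = (1 / measure lebesgue \<Omega>) *\<^sub>R (LINT x|lebesgue_on \<Omega>. broken v w x)"

definition linf_norm :: "(real^2) set \<Rightarrow> 'c mesh \<Rightarrow> ('c \<Rightarrow> real^2 \<Rightarrow> 'b::real_normed_vector) \<Rightarrow> real" where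
  "linf_norm \<Omega> v w = real_of_ereal (esssup (lebesgue_on \<Omega>) (\<lambda>x. ereal (norm (broken v w x))))"

definition l2_proj :: "nat \<Rightarrow> (real^2) set \<Rightarrow> (real^2 \<Rightarrow> real) \<Rightarrow> real^2 \<Rightarrow> real" where
  "l2_proj m K w = (THE p. p \<in> poly2 m \<and>
     (\<forall>q\<in>poly2 m. (LINT x|lebesgue_on K. p x * q x) = (LINT x|lebesgue_on K. w x * q x)))"

definition l2_proj_vec :: "nat \<Rightarrow> (real^2) set \<Rightarrow> (real^2 \<Rightarrow> real^'d) \<Rightarrow> real^2 \<Rightarrow> real^'d" where
  "l2_proj_vec m K w x = (\<chi> i. l2_proj m K (\<lambda>y. w y $ i) x)"

definition partial :: "2 \<Rightarrow> (real^2 \<Rightarrow> 'b::real_normed_vector) \<Rightarrow> real^2 \<Rightarrow> 'b" where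
  "partial i w x = frechet_derivative w (at x) (axis i 1)"

fun smooth :: "nat \<Rightarrow> (real^2 \<Rightarrow> 'b::real_normed_vector) \<Rightarrow> bool" where
  "smooth 0 w = continuous_on UNIV w"
| "smooth (Suc n) w = ((\<forall>x. w differentiable (at x)) \<and> (\<forall>i. smooth n (partial i w)))"

text \<open>A rule is either exact integration or a list of nodes and weights normalised to total measure 1.
  Nodes are barycentric coordinates in a cell, respectively the affine parameter in \<open>[0, 1]\<close> on an edge.\<close>

datatype 'a rule = Exact | Nodes "('a \<times> real) list"

definition cell_point :: "'c mesh \<Rightarrow> 'c \<Rightarrow> real^3 \<Rightarrow> real^2" where
  "cell_point v c b = (\<Sum>i\<in>UNIV. (b $ i) *\<^sub>R v c i)"

definition edge_point :: "'c mesh \<Rightarrow> 'c \<Rightarrow> 3 \<Rightarrow> real \<Rightarrow> real^2" where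
  "edge_point v c i s = (1 - s) *\<^sub>R v c (i + 1) + s *\<^sub>R v c (i + 2)"

fun cell_rule_ok :: "(real^3) rule \<Rightarrow> bool" where
  "cell_rule_ok Exact = True"
| "cell_rule_ok (Nodes qs) = (\<forall>(b, w)\<in>set qs. (\<forall>i. 0 \<le> b $ i) \<and> (\<Sum>i\<in>UNIV. b $ i) = 1)"

fun edge_rule_ok :: "real rule \<Rightarrow> bool" where
  "edge_rule_ok Exact = True"
| "edge_rule_ok (Nodes qs) = (\<forall>(s, w)\<in>set qs. 0 \<le> s \<and> s \<le> 1)"

fun cell_nodes :: "(real^3) rule \<Rightarrow> 'c mesh \<Rightarrow> 'c \<Rightarrow> (real^2) set" where
  "cell_nodes Exact v c = cell v c"
| "cell_nodes (Nodes qs) v c = (\<lambda>(b, w). cell_point v c b) ` set qs"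

fun edge_nodes :: "real rule \<Rightarrow> 'c mesh \<Rightarrow> 'c \<Rightarrow> 3 \<Rightarrow> (real^2) set" where
  "edge_nodes Exact v c i = edge v c i"
| "edge_nodes (Nodes qs) v c i = (\<lambda>(s, w). edge_point v c i s) ` set qs"

fun cell_integral :: "(real^3) rule \<Rightarrow> 'c mesh \<Rightarrow> 'c \<Rightarrow> (real^2 \<Rightarrow> 'b) \<Rightarrow>
    'b::{banach, second_countable_topology}" where
  "cell_integral Exact v c g = (LINT x|lebesgue_on (cell v c). g x)"
| "cell_integral (Nodes qs) v c g =
     measure lebesgue (cell v c) *\<^sub>R (\<Sum>(b, w)\<leftarrow>qs. w *\<^sub>R g (cell_point v c b))"

fun edge_integral :: "real rule \<Rightarrow> 'c mesh \<Rightarrow> 'c \<Rightarrow> 3 \<Rightarrow> (real^2 \<Rightarrow> 'b) \<Rightarrow>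
    'b::{banach, second_countable_topology}" where
  "edge_integral Exact v c i g =
     edge_length v c i *\<^sub>R (LINT s|lebesgue_on {0..1}. g (edge_point v c i s))"
| "edge_integral (Nodes qs) v c i g =
     edge_length v c i *\<^sub>R (\<Sum>(s, w)\<leftarrow>qs. w *\<^sub>R g (edge_point v c i s))"

fun cell_integrable :: "(real^3) rule \<Rightarrow> 'c mesh \<Rightarrow> 'c \<Rightarrow> (real^2 \<Rightarrow> 'b::{banach, second_countable_topology}) \<Rightarrow> bool" where
  "cell_integrable Exact v c g = integrable (lebesgue_on (cell v c)) g"
| "cell_integrable (Nodes qs) v c g = True"

fun edge_integrable :: "real rule \<Rightarrow> 'c mesh \<Rightarrow> 'c \<Rightarrow> 3 \<Rightarrow> (real^2 \<Rightarrow> 'b::{banach, second_countable_topology}) \<Rightarrow> bool" where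
  "edge_integrable Exact v c i g = integrable (lebesgue_on {0..1}) (\<lambda>s. g (edge_point v c i s))"
| "edge_integrable (Nodes qs) v c i g = True"

text \<open>On a boundary edge \<open>i\<close> of cell \<open>c\<close> the exterior of the domain carries the function \<open>B u c i\<close>,
  where the boundary data \<open>B\<close> may depend on the current numerical solution \<open>u\<close> (inflow, outflow,
  reflecting, periodic conditions). Interior edges take the polynomial of the neighbouring cell.\<close>

type_synonym ('c, 'd) bdata = "('c \<Rightarrow> real^2 \<Rightarrow> real^'d) \<Rightarrow> 'c \<Rightarrow> 3 \<Rightarrow> real^2 \<Rightarrow> real^'d"

definition exterior_fun :: "'c mesh \<Rightarrow> ('c, 'd) bdata \<Rightarrow> ('c \<Rightarrow> real^2 \<Rightarrow> real^'d) \<Rightarrow>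
    'c \<Rightarrow> 3 \<Rightarrow> real^2 \<Rightarrow> real^'d" where
  "exterior_fun v B u c i =
     (if \<exists>c'. neighbour v c i c' then u (THE c'. neighbour v c i c') else B u c i)"

definition smooth_bdata :: "nat \<Rightarrow> ('c, 'd::finite) bdata \<Rightarrow> bool" where
  "smooth_bdata k B \<longleftrightarrow> (\<forall>u\<in>dg_space k. \<forall>c i. smooth k (B u c i))"

definition rotate_bdata :: "('d::finite \<times> 'd) set \<Rightarrow> real \<Rightarrow> ('c, 'd) bdata \<Rightarrow> ('c, 'd) bdata" where
  "rotate_bdata V \<phi> B = (\<lambda>u c i. rotate_field V \<phi> (B (\<lambda>c'. rotate_field V (- \<phi>) (u c')) c i))"

definition jump_size :: "'c mesh \<Rightarrow> 'c \<Rightarrow> 3 \<Rightarrow> nat \<Rightarrow> (real^2 \<Rightarrow> real) \<Rightarrow> (real^2 \<Rightarrow> real) \<Rightarrow> real" where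
  "jump_size v c i j wi we = sqrt (1 / edge_length v c i * edge_integral Exact v c i
     (\<lambda>x. \<Sum>a\<le>j. real (j choose a) *
        ((partial 1 ^^ a) ((partial 2 ^^ (j - a)) wi) x
         - (partial 1 ^^ a) ((partial 2 ^^ (j - a)) we) x)\<^sup>2))"

definition A_coeff :: "nat \<Rightarrow> nat \<Rightarrow> real" where
  "A_coeff k j = (2 * real j + 1) / ((2 * real k - 1) * fact j)"

text \<open>\<open>w\<close> is the broken polynomial whose mean and deviation enter the scaling, \<open>wi\<close> and \<open>we\<close> are the
  interior and exterior functions at the edge whose jump is measured. For scalar quantities \<open>wi = w c\<close>;
  for vector quantities \<open>wi\<close> and \<open>we\<close> are the normal or the tangential component.\<close>

definition delta :: "nat \<Rightarrow> (real^2) set \<Rightarrow> 'c mesh \<Rightarrow> 'c \<Rightarrow> 3 \<Rightarrow> nat \<Rightarrow>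
    ('c \<Rightarrow> real^2 \<Rightarrow> 'b::{banach, second_countable_topology}) \<Rightarrow>
    (real^2 \<Rightarrow> real) \<Rightarrow> (real^2 \<Rightarrow> real) \<Rightarrow> real" where
  "delta k \<Omega> v c i j w wi we =
     (if \<forall>c'. \<forall>x\<in>cell v c'. w c' x = domain_mean \<Omega> v w then 0
      else A_coeff k j * edge_height v c i ^ j
           / linf_norm \<Omega> v (\<lambda>c' x. w c' x - domain_mean \<Omega> v w)
           * jump_size v c i j wi we)"

definition vec_part :: "'d \<times> 'd \<Rightarrow> (real^2 \<Rightarrow> real^'d) \<Rightarrow> real^2 \<Rightarrow> real^2" where
  "vec_part p w x = vector [w x $ fst p, w x $ snd p]"

definition delta_vec :: "nat \<Rightarrow> (real^2) set \<Rightarrow> 'c mesh \<Rightarrow> 'c \<Rightarrow> 3 \<Rightarrow> nat \<Rightarrow>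
    ('c \<Rightarrow> real^2 \<Rightarrow> real^2) \<Rightarrow> (real^2 \<Rightarrow> real^2) \<Rightarrow> real" where
  "delta_vec k \<Omega> v c i j m me =
     (let n = outward_normal v c i;
          nc = (\<lambda>w x. w x \<bullet> n);
          tc = (\<lambda>w x. - (w x $ 1) * (n $ 2) + (w x $ 2) * (n $ 1))
      in max (delta k \<Omega> v c i j m (nc (m c)) (nc me)) (delta k \<Omega> v c i j m (tc (m c)) (tc me)))"

definition delta_comp :: "('d::finite) system \<Rightarrow> nat \<Rightarrow> (real^2) set \<Rightarrow> 'c mesh \<Rightarrow> ('c, 'd) bdata \<Rightarrow>
    ('c \<Rightarrow> real^2 \<Rightarrow> real^'d) \<Rightarrow> 'c \<Rightarrow> 3 \<Rightarrow> nat \<Rightarrow> real^'d" where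
  "delta_comp S k \<Omega> v B u c i j = (\<chi> r.
     if is_scalar (vecs S) r
     then delta k \<Omega> v c i j (\<lambda>c' x. u c' x $ r) (\<lambda>x. u c x $ r) (\<lambda>x. exterior_fun v B u c i x $ r)
     else let p = pair_of (vecs S) r
          in delta_vec k \<Omega> v c i j (\<lambda>c'. vec_part p (u c')) (vec_part p (exterior_fun v B u c i)))"

definition beta :: "('d::finite) system \<Rightarrow> 'c mesh \<Rightarrow> ('c, 'd) bdata \<Rightarrow>
    ('c \<Rightarrow> real^2 \<Rightarrow> real^'d) \<Rightarrow> 'c \<Rightarrow> 3 \<Rightarrow> real" where
  "beta S v B u c i = Max {wave_speed S (w x) (outward_normal v c i) |w x.
     w \<in> {u c, exterior_fun v B u c i} \<and> x \<in> {v c (i + 1), v c (i + 2)}}"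

definition sigma :: "('d::finite) system \<Rightarrow> nat \<Rightarrow> (real^2) set \<Rightarrow> 'c mesh \<Rightarrow> ('c, 'd) bdata \<Rightarrow>
    ('c \<Rightarrow> real^2 \<Rightarrow> real^'d) \<Rightarrow> 'c \<Rightarrow> nat \<Rightarrow> real^'d" where
  "sigma S k \<Omega> v B u c j =
     (\<Sum>i\<in>UNIV. (beta S v B u c i / edge_height v c i) *\<^sub>R delta_comp S k \<Omega> v B u c i j)"

definition rioe :: "('d::finite) system \<Rightarrow> nat \<Rightarrow> (real^2) set \<Rightarrow> 'c mesh \<Rightarrow> ('c, 'd) bdata \<Rightarrow> real \<Rightarrow>
    ('c \<Rightarrow> real^2 \<Rightarrow> real^'d) \<Rightarrow> 'c \<Rightarrow> real^2 \<Rightarrow> real^'d" where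
  "rioe S k \<Omega> v B dt u c x = l2_proj_vec 0 (cell v c) (u c) x +
     (\<Sum>m = 1..k. (\<chi> r. exp (- dt * (\<Sum>j\<le>m. sigma S k \<Omega> v B u c j) $ r)) *
        (l2_proj_vec m (cell v c) (u c) x - l2_proj_vec (m - 1) (cell v c) (u c) x))"

text \<open>Stage \<open>l + 1\<close> of the Runge--Kutta method is the convex combination, with coefficients
  \<open>weight l r\<close> for \<open>r \<le> l\<close>, of forward Euler steps of size \<open>fe_step l r * dt\<close> from stage \<open>r\<close>;
  \<open>abscissa r\<close> is the relative time of stage \<open>r\<close>, needed for time-dependent boundary data.
  The time-step rule receives the step number, the current time, the edge lengths and heights of all
  cells, and the spectral radii of the numerical solution as a function of cell, edge normal and
  barycentric coordinates.\<close>

record ('c, 'd) oedg_method =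
  deg :: nat
  numflux :: "real^'d \<Rightarrow> real^'d \<Rightarrow> real^2 \<Rightarrow> real^'d"
  mass_rule :: "(real^3) rule"
  volume_rule :: "(real^3) rule"
  edge_rule :: "real rule"
  stages :: nat
  weight :: "nat \<Rightarrow> nat \<Rightarrow> real"
  fe_step :: "nat \<Rightarrow> nat \<Rightarrow> real"
  abscissa :: "nat \<Rightarrow> real"
  dt_rule :: "nat \<Rightarrow> real \<Rightarrow> ('c \<Rightarrow> 3 \<Rightarrow> real) \<Rightarrow> ('c \<Rightarrow> 3 \<Rightarrow> real) \<Rightarrow> ('c \<Rightarrow> 3 \<Rightarrow> real^3 \<Rightarrow> real) \<Rightarrow> real"

text \<open>The last condition makes the (possibly quadrature-based) mass matrix positive definite, so that
  the scheme determines the time derivative; it is automatic for exact integration.\<close>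

definition oedg_method_ok :: "('c, 'd::finite) oedg_method \<Rightarrow> 'c mesh \<Rightarrow> bool" where
  "oedg_method_ok M v \<longleftrightarrow> 1 \<le> deg M \<and> 1 \<le> stages M \<and>
     (\<forall>l<stages M. (\<forall>r\<le>l. 0 \<le> weight M l r \<and> 0 \<le> fe_step M l r) \<and> (\<Sum>r\<le>l. weight M l r) = 1) \<and>
     cell_rule_ok (mass_rule M) \<and> cell_rule_ok (volume_rule M) \<and> edge_rule_ok (edge_rule M) \<and>
     (\<forall>c. \<forall>p\<in>poly2 (deg M). p \<noteq> (\<lambda>_. 0) \<longrightarrow> cell_integral (mass_rule M) v c (\<lambda>x. (p x)\<^sup>2) > 0)"

text \<open>\<open>r\<close> is the time derivative assigned to \<open>u\<close> by the semi-discrete scheme. This presupposes that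
  the scheme is meaningful for \<open>u\<close>: the states entering the fluxes are admissible and the integrals
  exist. The product of vectors is componentwise.\<close>

definition dg_derivative :: "('d::finite) system \<Rightarrow> ('c, 'd) oedg_method \<Rightarrow> 'c mesh \<Rightarrow> ('c, 'd) bdata \<Rightarrow>
    ('c \<Rightarrow> real^2 \<Rightarrow> real^'d) \<Rightarrow> ('c \<Rightarrow> real^2 \<Rightarrow> real^'d) \<Rightarrow> bool" where
  "dg_derivative S M v B u r \<longleftrightarrow> r \<in> dg_space (deg M) \<and>
     (\<forall>c. (\<forall>x\<in>cell_nodes (volume_rule M) v c. u c x \<in> states S) \<and>
        cell_integrable (volume_rule M) v c (\<lambda>x. flux1 S (u c x)) \<and>
        cell_integrable (volume_rule M) v c (\<lambda>x. flux2 S (u c x))) \<and>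
     (\<forall>c i. (\<forall>x\<in>edge_nodes (edge_rule M) v c i.
          u c x \<in> states S \<and> exterior_fun v B u c i x \<in> states S) \<and>
        edge_integrable (edge_rule M) v c i
          (\<lambda>x. numflux M (u c x) (exterior_fun v B u c i x) (outward_normal v c i))) \<and>
     (\<forall>q\<in>dg_space (deg M). \<forall>c.
        cell_integral (mass_rule M) v c (\<lambda>x. r c x * q c x) =
        cell_integral (volume_rule M) v c
          (\<lambda>x. flux1 S (u c x) * partial 1 (q c) x + flux2 S (u c x) * partial 2 (q c) x)
        - (\<Sum>i\<in>UNIV. edge_integral (edge_rule M) v c i
             (\<lambda>x. numflux M (u c x) (exterior_fun v B u c i x) (outward_normal v c i) * q c x)))"

definition oedg_step :: "('d::finite) system \<Rightarrow> ('c, 'd) oedg_method \<Rightarrow> (real^2) set \<Rightarrow> 'c mesh \<Rightarrow>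
    (real \<Rightarrow> ('c, 'd) bdata) \<Rightarrow> real \<Rightarrow> real \<Rightarrow>
    ('c \<Rightarrow> real^2 \<Rightarrow> real^'d) \<Rightarrow> ('c \<Rightarrow> real^2 \<Rightarrow> real^'d) \<Rightarrow> bool" where
  "oedg_step S M \<Omega> v B t dt u u' \<longleftrightarrow> (\<exists>y d. y 0 = u \<and> u' = y (stages M) \<and>
     (\<forall>l<stages M. dg_derivative S M v (B (t + abscissa M l * dt)) (y l) (d l) \<and>
        y (Suc l) = rioe S (deg M) \<Omega> v (B (t + abscissa M (Suc l) * dt)) dt
          (\<lambda>c x. \<Sum>r\<le>l. weight M l r *\<^sub>R (y r c x + (fe_step M l r * dt) *\<^sub>R d r c x))))"

text \<open>\<open>u n\<close>, for \<open>n \<le> N\<close>, are the numerical solutions at the times \<open>t n\<close> produced by \<open>N\<close> steps.\<close>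

definition oedg_solution :: "('d::finite) system \<Rightarrow> ('c, 'd) oedg_method \<Rightarrow> (real^2) set \<Rightarrow> 'c mesh \<Rightarrow>
    (real \<Rightarrow> ('c, 'd) bdata) \<Rightarrow> (real^2 \<Rightarrow> real^'d) \<Rightarrow> nat \<Rightarrow> (nat \<Rightarrow> real) \<Rightarrow>
    (nat \<Rightarrow> 'c \<Rightarrow> real^2 \<Rightarrow> real^'d) \<Rightarrow> bool" where
  "oedg_solution S M \<Omega> v B u0 N t u \<longleftrightarrow> t 0 = 0 \<and>
     (\<forall>c. u 0 c = l2_proj_vec (deg M) (cell v c) u0) \<and>
     (\<forall>n<N. let dt = dt_rule M n (t n) (edge_length v) (edge_height v)
                  (\<lambda>c i b. wave_speed S (u n c (cell_point v c b)) (outward_normal v c i))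
             in 0 < dt \<and> t (Suc n) = t n + dt \<and> oedg_step S M \<Omega> v B (t n) dt (u n) (u (Suc n)))"

definition square_integrable_on :: "(real^2) set \<Rightarrow> (real^2 \<Rightarrow> real^'d) \<Rightarrow> bool" where
  "square_integrable_on \<Omega> w \<longleftrightarrow> (\<forall>i. (\<lambda>x. w x $ i) \<in> borel_measurable (lebesgue_on \<Omega>) \<and>
     integrable (lebesgue_on \<Omega>) (\<lambda>x. (w x $ i)\<^sup>2))"

definition rotation_related :: "('d::finite \<times> 'd) set \<Rightarrow> real \<Rightarrow> 'c mesh \<Rightarrow>
    ('c \<Rightarrow> real^2 \<Rightarrow> real^'d) \<Rightarrow> ('c \<Rightarrow> real^2 \<Rightarrow> real^'d) \<Rightarrow> bool" where
  "rotation_related V \<phi> v u u' \<longleftrightarrow> (\<forall>c. \<forall>x\<in>cell v c. u' c (rot \<phi> *v x) = comp_rot V \<phi> *v u c x)"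

end

theory Submission
  imports Defs
begin

text \<open>Let \<open>R = rot \<phi>\<close> and \<open>T = comp_rot V \<phi>\<close>. Every ingredient of the method is equivariant under the
  operation \<open>rotate_field V \<phi>\<close>, which sends a field \<open>w\<close> to \<open>T w (R\<^sup>-\<^sup>1 x)\<close>; the theorem collects these
  equivariances and one uniqueness statement.

  The damping procedure combines \<open>L\<^sup>2\<close> projections, which are linear and invariant under the measure
  preserving map \<open>R\<close> and therefore commute with the rotation of a field (\<open>l2_proj_vec_rotate_field\<close>),
  with the componentwise factors \<open>exp (- dt * (\<Sum>j\<le>m. sigma j))\<close>. Such factors commute with \<open>T\<close> as soon as
  they agree on the two components of each vector quantity, and the procedure is rotation invariant
  if, moreover, they do not change under rotation (\<open>rioe_rotate\<close>). Three facts give the latter.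
  The Jacobians of the rotated fluxes are conjugate under \<open>T\<close> to those of the given ones, so the wave
  speeds agree (\<open>wave_speed_comp_rot\<close>). Normal and tangential components of a vector quantity are scalar
  fields that do not see the rotation. Finally, the binomially weighted sum of squared derivatives of
  order \<open>j\<close> is the squared Frobenius norm of the tensor of \<open>j\<close>-th derivatives, hence rotation invariant
  (\<open>jump_size_rotate\<close>); the weights count the indices that coincide by the symmetry of mixed derivatives.

  In the semi-discrete scheme, test functions may be taken scalar, and then rotating the gradient of
  the test function cancels against the rotation of the pair of fluxes (\<open>dg_derivative_rotate\<close>).
  Composing Runge--Kutta stages, a numerical solution is rotated into a numerical solution for the
  rotated data (\<open>oedg_solution_rotate\<close>); rotating back by \<open>-\<phi>\<close> gives the converse. As the mass form is
  positive definite, the scheme determines its time derivatives and thus the whole numerical solution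
  (\<open>oedg_solution_unique\<close>), so an arbitrary solution of the rotated problem is the rotated one.\<close>

section \<open>Rotations of the plane and of the state space\<close>

lemma rot_mult_nth [simp]:
  "(rot \<phi> *v x) $ 1 = cos \<phi> * x $ 1 + sin \<phi> * x $ 2"
  "(rot \<phi> *v x) $ 2 = - sin \<phi> * x $ 1 + cos \<phi> * x $ 2"
  by (simp_all add: rot_def matrix_vector_mult_def sum_2)

lemma vec2_eq_iff: "(x::'a^2) = y \<longleftrightarrow> x $ 1 = y $ 1 \<and> x $ 2 = y $ 2"
  by (simp add: vec_eq_iff forall_2)

lemma cos_sin_cancel:
  fixes \<phi> a :: real
  shows "cos \<phi> * (cos \<phi> * a) + sin \<phi> * (sin \<phi> * a) = a"
  using sin_cos_squared_add[of \<phi>] by algebra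

lemma rot_minus_cancel [simp]:
  "rot (- \<phi>) *v (rot \<phi> *v x) = x" "rot \<phi> *v (rot (- \<phi>) *v x) = x"
  by (simp_all add: vec2_eq_iff algebra_simps cos_sin_cancel)

lemma inner_rot [simp]: "(rot \<phi> *v x) \<bullet> (rot \<phi> *v y) = x \<bullet> y"
proof -
  have "(c * a + s * b) * (c * d + s * e) + (- s * a + c * b) * (- s * d + c * e) = a * d + b * e"
    if "s\<^sup>2 + c\<^sup>2 = 1" for a b c d e s :: real
    using that by algebra
  then show ?thesis
    using sin_cos_squared_add[of \<phi>] by (simp add: inner_vec_def sum_2)
qed

lemma norm_rot [simp]: "norm (rot \<phi> *v x) = norm x"
  by (simp add: norm_eq_sqrt_inner)

lemma dist_rot [simp]: "dist (rot \<phi> *v x) (rot \<phi> *v y) = dist x y"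
  by (simp add: dist_norm flip: matrix_vector_mult_diff_distrib)

lemma linear_rot: "linear ((*v) (rot \<phi>))"
  by (simp add: matrix_vector_mul_linear)

lemma inj_rot: "inj ((*v) (rot \<phi>))"
  by (metis injI rot_minus_cancel(1))

lemma rot_eq_iff [simp]: "rot \<phi> *v x = rot \<phi> *v y \<longleftrightarrow> x = y"
  by (metis rot_minus_cancel(1))

lemma rot_image_iff: "x \<in> (*v) (rot \<phi>) ` A \<longleftrightarrow> rot (- \<phi>) *v x \<in> A"
  by (metis (no_types, lifting) imageE imageI rot_minus_cancel)

lemma rot_vimage: "(*v) (rot \<phi>) -` A = (*v) (rot (- \<phi>)) ` A"
  by (auto simp: rot_image_iff)

lemma rot_image_cancel [simp]:
  "(*v) (rot (- \<phi>)) ` (*v) (rot \<phi>) ` A = A" "(*v) (rot \<phi>) ` (*v) (rot (- \<phi>)) ` A = A"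
  by (simp_all add: image_image)

lemma comp_rot_mult_scalar:
  assumes "is_scalar V i"
  shows "(comp_rot V \<phi> *v w) $ i = w $ i"
proof -
  have "(comp_rot V \<phi> *v w) $ i = (\<Sum>j\<in>UNIV. if j = i then w $ j else 0)"
    unfolding matrix_vector_mult_def comp_rot_def vec_lambda_beta using assms by (intro sum.cong) auto
  then show ?thesis by simp
qed

lemma comp_rot_mult_fst:
  fixes w :: "real^'d::finite"
  assumes V: "vector_pairs V" and ij: "(i, j) \<in> V"
  shows "(comp_rot V \<phi> *v w) $ i = cos \<phi> * w $ i + sin \<phi> * w $ j"
proof -
  have "\<not> is_scalar V i" "i \<noteq> j"
    using V ij by (force simp: is_scalar_def vector_pairs_def)+
  moreover have "(i, l) \<in> V \<longleftrightarrow> l = j" "(l, i) \<notin> V" for l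
    using V ij by (force simp: vector_pairs_def inj_on_def)+
  ultimately have "(comp_rot V \<phi> *v w) $ i =
      (\<Sum>l\<in>UNIV. (if l = i then cos \<phi> * w $ l else 0) + (if l = j then sin \<phi> * w $ l else 0))"
    unfolding matrix_vector_mult_def comp_rot_def by (auto intro!: sum.cong)
  then show ?thesis by (simp add: sum.distrib)
qed

lemma comp_rot_mult_snd:
  fixes w :: "real^'d::finite"
  assumes V: "vector_pairs V" and ij: "(i, j) \<in> V"
  shows "(comp_rot V \<phi> *v w) $ j = - sin \<phi> * w $ i + cos \<phi> * w $ j"
proof -
  have "\<not> is_scalar V j" "i \<noteq> j"
    using V ij by (force simp: is_scalar_def vector_pairs_def)+
  moreover have "(l, j) \<in> V \<longleftrightarrow> l = i" "(j, l) \<notin> V" for l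
    using V ij by (force simp: vector_pairs_def inj_on_def)+
  ultimately have "(comp_rot V \<phi> *v w) $ j =
      (\<Sum>l\<in>UNIV. (if l = j then cos \<phi> * w $ l else 0) + (if l = i then - sin \<phi> * w $ l else 0))"
    unfolding matrix_vector_mult_def comp_rot_def by (auto intro!: sum.cong)
  then show ?thesis by (simp add: sum.distrib)
qed

lemma vector_pairs_cases:
  obtains (scalar) "is_scalar V i" | (first) j where "(i, j) \<in> V" | (second) j where "(j, i) \<in> V"
  unfolding is_scalar_def by (metis Un_iff imageE prod.collapse)

lemma pair_of_eq:
  assumes V: "vector_pairs V" and ij: "(i, j) \<in> V"
  shows "pair_of V i = (i, j)" "pair_of V j = (i, j)"
proof -
  have inj: "inj_on fst V" "inj_on snd V" and "fst ` V \<inter> snd ` V = {}"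
    using V by (auto simp: vector_pairs_def)
  then have disj: "fst p \<noteq> snd q" if "p \<in> V" "q \<in> V" for p q
    using imageI[OF that(1), of fst] imageI[OF that(2), of snd] by (metis disjoint_iff)
  have u1: "p = (i, j)" if "p \<in> V" "i = fst p \<or> i = snd p" for p
  proof -
    have "fst p = fst (i, j)" using disj[OF ij that(1)] that(2) by simp
    then show ?thesis using inj_onD[OF inj(1)] that(1) ij by blast
  qed
  show "pair_of V i = (i, j)"
    unfolding pair_of_def by (rule the_equality, simp add: ij, use u1 in blast)
  have u2: "p = (i, j)" if "p \<in> V" "j = fst p \<or> j = snd p" for p
  proof -
    have "snd p = snd (i, j)" using disj[OF that(1) ij] that(2) by simp
    then show ?thesis using inj_onD[OF inj(2)] that(1) ij by blast
  qed
  show "pair_of V j = (i, j)"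
    unfolding pair_of_def by (rule the_equality, simp add: ij, use u2 in blast)
qed

lemma vec_part_comp_rot:
  assumes "vector_pairs V" "p \<in> V"
  shows "vec_part p (\<lambda>x. comp_rot V \<phi> *v f x) y = rot \<phi> *v vec_part p f y"
  using assms comp_rot_mult_fst[of V "fst p" "snd p"] comp_rot_mult_snd[of V "fst p" "snd p"]
  by (simp add: vec2_eq_iff vec_part_def)

lemma comp_rot_minus_cancel:
  assumes V: "vector_pairs V"
  shows "comp_rot V (- \<phi>) *v (comp_rot V \<phi> *v w) = w"
proof -
  have "(comp_rot V (- \<phi>) *v (comp_rot V \<phi> *v w)) $ i = w $ i" for i
  proof (cases V i rule: vector_pairs_cases)
    case scalar
    then show ?thesis by (simp add: comp_rot_mult_scalar)
  next
    case (first j)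
    show ?thesis
      using V first
      by (simp add: comp_rot_mult_fst[of V i j] comp_rot_mult_snd[of V i j] algebra_simps cos_sin_cancel)
  next
    case (second j)
    show ?thesis
      using V second
      by (simp add: comp_rot_mult_fst[of V j i] comp_rot_mult_snd[of V j i] algebra_simps cos_sin_cancel)
  qed
  then show ?thesis by (simp add: vec_eq_iff)
qed

lemma comp_rot_minus_cancel':
  "vector_pairs V \<Longrightarrow> comp_rot V \<phi> *v (comp_rot V (- \<phi>) *v w) = w"
  using comp_rot_minus_cancel[of V "- \<phi>" w] by simp

lemma matrix_inv_comp_rot:
  assumes V: "vector_pairs V"
  shows "matrix_inv (comp_rot V \<phi>) = comp_rot V (- \<phi>)"
proof -
  have "comp_rot V (- \<phi>) ** comp_rot V \<phi> = mat 1" "comp_rot V \<phi> ** comp_rot V (- \<phi>) = mat 1"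
    using comp_rot_minus_cancel[OF V] comp_rot_minus_cancel'[OF V]
    by (simp_all add: matrix_eq flip: matrix_vector_mul_assoc)
  then have inv: "invertible (comp_rot V \<phi>)"
    unfolding invertible_def by blast
  have "matrix_inv (comp_rot V \<phi>) ** (comp_rot V \<phi> ** comp_rot V (- \<phi>)) = comp_rot V (- \<phi>)"
    using someI_ex[OF inv[unfolded invertible_def]] unfolding matrix_inv_def
    by (simp add: matrix_mul_assoc)
  then show ?thesis
    using \<open>comp_rot V \<phi> ** comp_rot V (- \<phi>) = mat 1\<close> by simp
qed

lemma rotate_field_minus_cancel [simp]:
  assumes "vector_pairs V"
  shows "rotate_field V (- \<phi>) (rotate_field V \<phi> w) = w" "rotate_field V \<phi> (rotate_field V (- \<phi>) w) = w"
  using assms by (simp_all add: rotate_field_def comp_rot_minus_cancel comp_rot_minus_cancel')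

lemma rotate_field_rot [simp]: "rotate_field V \<phi> w (rot \<phi> *v x) = comp_rot V \<phi> *v w x"
  by (simp add: rotate_field_def)

lemma rotate_bdata_rotate_field:
  "vector_pairs V \<Longrightarrow>
    rotate_bdata V \<phi> B (\<lambda>c. rotate_field V \<phi> (u c)) c i = rotate_field V \<phi> (B u c i)"
  by (simp add: rotate_bdata_def)

lemma rotate_bdata_minus_cancel:
  "vector_pairs V \<Longrightarrow> rotate_bdata V (- \<phi>) (rotate_bdata V \<phi> B) = B"
  by (simp add: rotate_bdata_def)

lemma rotate_mesh_minus_cancel: "rotate_mesh (- \<phi>) (rotate_mesh \<phi> v) = v"
  by (simp add: rotate_mesh_def)

section \<open>Change of variables\<close>

lemma rot_image_sets_lebesgue [simp]:
  "(*v) (rot \<phi>) ` A \<in> sets lebesgue \<longleftrightarrow> A \<in> sets lebesgue"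
proof -
  have "(*v) (rot \<phi>) ` A \<in> sets lebesgue" if "A \<in> sets lebesgue" for \<phi> A
    using that linear_rot by (intro differentiable_image_in_sets_lebesgue) (auto intro: linear_imp_differentiable_on)
  from this[of A \<phi>] this[of "(*v) (rot \<phi>) ` A" "- \<phi>"] show ?thesis
    unfolding rot_image_cancel by (rule iffI[rotated])
qed

lemma measurable_rot: "(*v) (rot \<phi>) \<in> lebesgue \<rightarrow>\<^sub>M lebesgue"
  by (rule measurableI) (auto simp: rot_vimage)

lemma orthogonal_transformation_rot: "orthogonal_transformation ((*v) (rot \<phi>))"
  by (simp add: orthogonal_transformation_def linear_rot)

lemma emeasure_rot_image:
  assumes A: "A \<in> sets lebesgue"
  shows "emeasure lebesgue ((*v) (rot \<phi>) ` A) = emeasure lebesgue A"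
proof -
  have L: "emeasure lebesgue ((*v) (rot \<phi>) ` A) = emeasure lebesgue A" if "A \<in> lmeasurable" for A \<phi>
    using that measure_orthogonal_image[OF orthogonal_transformation_rot that]
    by (simp add: emeasure_eq_measure2 measurable_orthogonal_image orthogonal_transformation_rot)
  have fin: "(*v) (rot \<phi>) ` A \<in> lmeasurable \<Longrightarrow> A \<in> lmeasurable"
    using measurable_orthogonal_image[OF orthogonal_transformation_rot, of "(*v) (rot \<phi>) ` A" "- \<phi>"]
    by simp
  show ?thesis
  proof (cases "A \<in> lmeasurable")
    case False
    then have "\<not> emeasure lebesgue A < \<infinity>" "\<not> emeasure lebesgue ((*v) (rot \<phi>) ` A) < \<infinity>"
      using A fin rot_image_sets_lebesgue unfolding fmeasurable_def by blast+
    then show ?thesis by (simp only: infinity_ennreal_def not_less top_unique)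
  qed (use L in blast)
qed

lemma measure_rot_image:
  "A \<in> sets lebesgue \<Longrightarrow> measure lebesgue ((*v) (rot \<phi>) ` A) = measure lebesgue A"
  by (simp only: measure_def emeasure_rot_image)

lemma measurable_rot_on:
  "(*v) (rot \<phi>) \<in> lebesgue_on A \<rightarrow>\<^sub>M lebesgue_on ((*v) (rot \<phi>) ` A)"
  by (rule measurable_restrict_space3[OF measurable_rot]) blast

text \<open>Since the inverse of \<open>rot \<phi>\<close> is measurable too, the change of variables below holds for arbitrary
  functions: if \<open>f\<close> is not measurable then neither is the composition, and the integrals of both have
  the default value.\<close>

lemma borel_measurable_rot_iff:
  "f \<in> borel_measurable (lebesgue_on ((*v) (rot \<phi>) ` A)) \<longleftrightarrow>
    (\<lambda>x. f (rot \<phi> *v x)) \<in> borel_measurable (lebesgue_on A)"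
proof
  assume f: "(\<lambda>x. f (rot \<phi> *v x)) \<in> borel_measurable (lebesgue_on A)"
  have "(*v) (rot (- \<phi>)) \<in> lebesgue_on ((*v) (rot \<phi>) ` A) \<rightarrow>\<^sub>M lebesgue_on A"
    using measurable_rot_on[of "- \<phi>" "(*v) (rot \<phi>) ` A"] unfolding rot_image_cancel .
  from measurable_compose[OF this f] show "f \<in> borel_measurable (lebesgue_on ((*v) (rot \<phi>) ` A))"
    by (simp only: rot_minus_cancel)
qed (use measurable_compose[OF measurable_rot_on] in blast)

lemma distr_rot_on:
  assumes A: "A \<in> sets lebesgue"
  shows "distr (lebesgue_on A) (lebesgue_on ((*v) (rot \<phi>) ` A)) ((*v) (rot \<phi>)) = lebesgue_on ((*v) (rot \<phi>) ` A)"
proof (rule measure_eqI)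
  fix X assume "X \<in> sets (distr (lebesgue_on A) (lebesgue_on ((*v) (rot \<phi>) ` A)) ((*v) (rot \<phi>)))"
  then have X: "X \<in> sets lebesgue" "X \<subseteq> (*v) (rot \<phi>) ` A" 
    using A by (auto simp: sets_restrict_space_iff)
  have eq: "(*v) (rot \<phi>) -` X \<inter> A = (*v) (rot (- \<phi>)) ` X"
    using X(2) by (auto simp: rot_vimage rot_image_iff)
  have "(*v) (rot (- \<phi>)) ` X \<subseteq> A" using X(2) by (auto simp: rot_image_iff subset_iff)
  then show "emeasure (distr (lebesgue_on A) (lebesgue_on ((*v) (rot \<phi>) ` A)) ((*v) (rot \<phi>))) X
    = emeasure (lebesgue_on ((*v) (rot \<phi>) ` A)) X"
    using X A by (subst emeasure_distr)
      (auto simp: measurable_rot_on eq emeasure_restrict_space sets_restrict_space_iff emeasure_rot_image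
        simp del: emeasure_completion)
qed simp

lemma integrable_rot:
  fixes f :: "real^2 \<Rightarrow> 'b::{banach, second_countable_topology}"
  assumes A: "A \<in> sets lebesgue"
  shows "integrable (lebesgue_on ((*v) (rot \<phi>) ` A)) f \<longleftrightarrow> integrable (lebesgue_on A) (\<lambda>x. f (rot \<phi> *v x))"
proof (cases "f \<in> borel_measurable (lebesgue_on ((*v) (rot \<phi>) ` A))")
  case True
  show ?thesis
    using integrable_distr_eq[OF measurable_rot_on True] distr_rot_on[OF A] by simp
next
  case False
  then show ?thesis
    using borel_measurable_rot_iff borel_measurable_integrable by blast
qed

lemma integral_rot:
  fixes f :: "real^2 \<Rightarrow> 'b::{banach, second_countable_topology}"
  assumes A: "A \<in> sets lebesgue"
  shows "(LINT x|lebesgue_on ((*v) (rot \<phi>) ` A). f x) = (LINT x|lebesgue_on A. f (rot \<phi> *v x))"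
proof (cases "f \<in> borel_measurable (lebesgue_on ((*v) (rot \<phi>) ` A))")
  case True
  show ?thesis
    using integral_distr[OF measurable_rot_on True] distr_rot_on[OF A] by simp
next
  case False
  then have "\<not> integrable (lebesgue_on ((*v) (rot \<phi>) ` A)) f"
    using borel_measurable_integrable by blast
  then show ?thesis
    using integrable_rot[OF A, of \<phi> f] by (simp add: not_integrable_integral_eq)
qed

lemma esssup_rot:
  fixes f :: "real^2 \<Rightarrow> ereal"
  assumes A: "A \<in> sets lebesgue"
  shows "esssup (lebesgue_on ((*v) (rot \<phi>) ` A)) f = esssup (lebesgue_on A) (\<lambda>x. f (rot \<phi> *v x))"
proof (cases "f \<in> borel_measurable (lebesgue_on ((*v) (rot \<phi>) ` A))")
  case True
  note True[measurable]
  have m: "(\<lambda>x. f (rot \<phi> *v x)) \<in> borel_measurable (lebesgue_on A)"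
    using True borel_measurable_rot_iff by blast
  have "(AE x in lebesgue_on ((*v) (rot \<phi>) ` A). f x \<le> z) \<longleftrightarrow> (AE x in lebesgue_on A. f (rot \<phi> *v x) \<le> z)" for z
  proof -
    have "{x \<in> space (lebesgue_on ((*v) (rot \<phi>) ` A)). f x \<le> z} \<in> sets (lebesgue_on ((*v) (rot \<phi>) ` A))"
      by measurable
    from AE_distr_iff[OF measurable_rot_on this] show ?thesis
      unfolding distr_rot_on[OF A] .
  qed
  then show ?thesis using True m by (simp add: esssup_eq_AE)
next
  case False
  then show ?thesis by (simp add: esssup_non_measurable borel_measurable_rot_iff)
qed

section \<open>Polynomials in two variables\<close>

lemma poly2_monomials:
  "p \<in> poly2 m \<longleftrightarrow> (\<exists>a. p = (\<lambda>x. \<Sum>(r, s)\<in>(SIGMA r:{..m}. {..m - r}). a r s * ((x $ 1) ^ r * (x $ 2) ^ s)))"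
  by (simp add: poly2_def sum.Sigma mult.assoc)

lemma poly2_monomial:
  assumes "r + s \<le> m"
  shows "(\<lambda>x. (x $ 1) ^ r * (x $ 2) ^ s) \<in> poly2 m"
proof -
  have "(\<lambda>x::real^2. (x $ 1) ^ r * (x $ 2) ^ s) =
    (\<lambda>x. \<Sum>(r', s')\<in>(SIGMA r:{..m}. {..m - r}). (if (r', s') = (r, s) then 1 else 0) * ((x $ 1) ^ r' * (x $ 2) ^ s') :: real)"
  proof
    fix x :: "real^2"
    have "(\<Sum>(r', s')\<in>(SIGMA r:{..m}. {..m - r}). (if (r', s') = (r, s) then 1 else 0) * ((x $ 1) ^ r' * (x $ 2) ^ s')) =
      (\<Sum>z\<in>(SIGMA r:{..m}. {..m - r}). if z = (r, s) then (x $ 1) ^ fst z * (x $ 2) ^ snd z else 0)"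
      by (intro sum.cong) (auto split: if_splits)
    then show "(x $ 1) ^ r * (x $ 2) ^ s =
      (\<Sum>(r', s')\<in>(SIGMA r:{..m}. {..m - r}). (if (r', s') = (r, s) then 1 else 0) * ((x $ 1) ^ r' * (x $ 2) ^ s'))"
      using assms by simp
  qed
  then show ?thesis
    unfolding poly2_monomials by (intro exI[of _ "\<lambda>r' s'. if (r', s') = (r, s) then 1 else 0"])
qed

lemma poly2_add:
  assumes "p \<in> poly2 m" "q \<in> poly2 m"
  shows "(\<lambda>x. p x + q x) \<in> poly2 m"
proof -
  obtain a b where "p = (\<lambda>x. \<Sum>(r, s)\<in>(SIGMA r:{..m}. {..m - r}). a r s * ((x $ 1) ^ r * (x $ 2) ^ s))"
    "q = (\<lambda>x. \<Sum>(r, s)\<in>(SIGMA r:{..m}. {..m - r}). b r s * ((x $ 1) ^ r * (x $ 2) ^ s))"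
    using assms unfolding poly2_monomials by blast
  then show ?thesis
    unfolding poly2_monomials
    by (intro exI[of _ "\<lambda>r s. a r s + b r s"]) (auto simp: algebra_simps case_prod_unfold simp flip: sum.distrib)
qed

lemma poly2_cmult:
  assumes "p \<in> poly2 m"
  shows "(\<lambda>x. c * p x) \<in> poly2 m"
proof -
  obtain a where "p = (\<lambda>x. \<Sum>(r, s)\<in>(SIGMA r:{..m}. {..m - r}). a r s * ((x $ 1) ^ r * (x $ 2) ^ s))"
    using assms unfolding poly2_monomials by blast
  then show ?thesis
    unfolding poly2_monomials
    by (intro exI[of _ "\<lambda>r s. c * a r s"]) (auto simp: sum_distrib_left mult.assoc case_prod_unfold)
qed

lemma poly2_zero: "(\<lambda>x. 0) \<in> poly2 m"
  unfolding poly2_monomials by (intro exI[of _ "\<lambda>r s. 0"]) simp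

lemma poly2_sum:
  "(\<And>i. i \<in> I \<Longrightarrow> p i \<in> poly2 m) \<Longrightarrow> (\<lambda>x. \<Sum>i\<in>I. p i x) \<in> poly2 m"
  by (induction I rule: infinite_finite_induct) (auto intro: poly2_zero poly2_add)

lemma poly2_diff:
  assumes "p \<in> poly2 m" "q \<in> poly2 m"
  shows "(\<lambda>x. p x - q x) \<in> poly2 m"
  using poly2_add[OF assms(1) poly2_cmult[OF assms(2), of "-1"]] by simp

lemma poly2_induct [consumes 1, case_names monomial zero add cmult]:
  assumes p: "p \<in> poly2 m"
    and "\<And>r s. r + s \<le> m \<Longrightarrow> P (\<lambda>x. (x $ 1) ^ r * (x $ 2) ^ s)"
    and "P (\<lambda>x. 0)"
    and "\<And>p q. P p \<Longrightarrow> P q \<Longrightarrow> P (\<lambda>x. p x + q x)"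
    and "\<And>c p. P p \<Longrightarrow> P (\<lambda>x. c * p x)"
  shows "P p"
proof -
  obtain a where p: "p = (\<lambda>x. \<Sum>z\<in>(SIGMA r:{..m}. {..m - r}). a (fst z) (snd z) * ((x $ 1) ^ fst z * (x $ 2) ^ snd z))"
    using p unfolding poly2_monomials case_prod_unfold by blast
  have "P (\<lambda>x. \<Sum>z\<in>Z. a (fst z) (snd z) * ((x $ 1) ^ fst z * (x $ 2) ^ snd z))"
    if "finite Z" "Z \<subseteq> (SIGMA r:{..m}. {..m - r})" for Z
    using that by (induction Z rule: finite_induct) (auto intro!: assms(2-5))
  then show ?thesis using p by simp
qed

lemma poly2_mono:
  assumes "p \<in> poly2 m" "m \<le> n"
  shows "p \<in> poly2 n"
  using assms(1) by (induction rule: poly2_induct)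
    (auto intro: poly2_zero poly2_add poly2_cmult poly2_monomial le_trans[OF _ assms(2)])

lemma poly2_mult_linear:
  assumes "p \<in> poly2 m"
  shows "(\<lambda>x. (a * x $ 1 + b * x $ 2) * p x) \<in> poly2 (Suc m)"
  using assms
proof (induction rule: poly2_induct)
  case (monomial r s)
  have "(\<lambda>x. a * ((x $ 1) ^ Suc r * (x $ 2) ^ s) + b * ((x $ 1) ^ r * (x $ 2) ^ Suc s)) \<in> poly2 (Suc m)"
    using monomial by (intro poly2_add poly2_cmult poly2_monomial) auto
  then show ?case by (simp add: algebra_simps)
next
  case (add p q)
  then show ?case using poly2_add[OF add] by (simp add: algebra_simps)
next
  case (cmult c p)
  then show ?case using poly2_cmult[OF cmult, of c] by (simp add: algebra_simps)
qed (simp add: poly2_zero)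

lemma poly2_rot:
  assumes "p \<in> poly2 m"
  shows "(\<lambda>x. p (rot \<phi> *v x)) \<in> poly2 m"
  using assms
proof (induction rule: poly2_induct)
  case (monomial r s)
  have one: "(\<lambda>x. 1) \<in> poly2 0"
    using poly2_monomial[of 0 0 0] by simp
  have s: "(\<lambda>x. (c * x $ 1 + d * x $ 2) ^ s) \<in> poly2 s" for c d s
    using one by (induction s) (auto dest: poly2_mult_linear)
  have "(\<lambda>x. (a * x $ 1 + b * x $ 2) ^ r * (c * x $ 1 + d * x $ 2) ^ s) \<in> poly2 (r + s)" for a b c d
    by (induction r) (auto simp: s mult.assoc dest: poly2_mult_linear[of _ _ a b])
  from poly2_mono[OF this[of "cos \<phi>" "sin \<phi>" "- sin \<phi>" "cos \<phi>"] monomial] show ?case by simp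
qed (auto intro: poly2_zero poly2_add poly2_cmult)

lemma poly2_real_polynomial_function: "p \<in> poly2 m \<Longrightarrow> real_polynomial_function p"
proof (induction rule: poly2_induct)
  case (monomial r s)
  show ?case
    by (intro real_polynomial_function.intros(4) real_polynomial_function_power
        real_polynomial_function.intros(1) bounded_linear_vec_nth)
qed (auto intro: real_polynomial_function.intros)

lemma poly2_continuous_on: "p \<in> poly2 m \<Longrightarrow> continuous_on A p"
  by (meson continuous_at_imp_continuous_on continuous_real_polymonial_function poly2_real_polynomial_function)

text \<open>On every line through an interior point of the set, \<open>p\<close> is a polynomial of one variable with
  infinitely many zeros.\<close>

lemma real_polynomial_function_eq_0:
  assumes p: "real_polynomial_function p" and z: "\<And>x. x \<in> A \<Longrightarrow> p x = 0" and "interior A \<noteq> {}"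
  shows "p x = 0"
proof -
  obtain x0 e where e: "e > 0" "ball x0 e \<subseteq> A"
    using assms(3) by (metis all_not_in_conv mem_interior)
  define d where "d = x - x0"
  have "\<exists>q. \<forall>t::real. p (x0 + t *\<^sub>R d) = poly q t"
    using p
  proof induction
    case (linear f)
    then show ?case
      by (intro exI[of _ "[:f x0, f d:]"])
        (simp add: linear_add linear_scale bounded_linear.linear)
  next
    case (const c)
    then show ?case by (intro exI[of _ "[:c:]"]) simp
  next
    case (add f g)
    then show ?case by (metis poly_add)
  next
    case (mult f g)
    then show ?case by (metis poly_mult)
  qed
  then obtain q where q: "\<And>t. p (x0 + t *\<^sub>R d) = poly q t" by blast
  define h where "h = e / (1 + norm d)"
  have "h > 0" using e by (simp add: h_def add_pos_nonneg)
  have "poly q t = 0" if "t \<in> {0<..<h}" for t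
  proof -
    have "t * norm d < e"
    proof -
      have "t * norm d \<le> t * (1 + norm d)" using that by (simp add: mult_left_mono)
      also have "\<dots> < h * (1 + norm d)" using that by (intro mult_strict_right_mono) (auto simp: add_pos_nonneg)
      also have "\<dots> = e" by (simp add: h_def add_nonneg_eq_0_iff)
      finally show ?thesis .
    qed
    then have "x0 + t *\<^sub>R d \<in> ball x0 e" using that by (simp add: dist_norm)
    then show ?thesis using z e(2) q by (metis subsetD)
  qed
  then have "infinite {t. poly q t = 0}"
    using infinite_Ioo[OF \<open>h > 0\<close>] finite_subset[of "{0<..<h}" "{t. poly q t = 0}"] by blast
  then have "q = 0" using poly_roots_finite by blast
  then show ?thesis using q[of 1] by (simp add: d_def)
qed

lemma poly2_eqI:
  assumes "p \<in> poly2 m" "q \<in> poly2 m" and "\<And>x. x \<in> A \<Longrightarrow> p x = q x" and "interior A \<noteq> {}"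
  shows "p = q"
proof
  fix x
  show "p x = q x"
    using real_polynomial_function_eq_0[OF poly2_real_polynomial_function[OF poly2_diff[OF assms(1,2)]], of A x] assms(3,4)
    by simp
qed

section \<open>Smooth functions and their partial derivatives\<close>

lemma partialI: "(f has_derivative D) (at x) \<Longrightarrow> partial i f x = D (axis i 1)"
  unfolding partial_def by (metis frechet_derivative_at)

lemma differentiable_has_derivative:
  "f differentiable (at x) \<Longrightarrow> (f has_derivative frechet_derivative f (at x)) (at x)"
  by (simp flip: frechet_derivative_works)

lemma smooth_Suc_imp: "smooth (Suc n) f \<Longrightarrow> smooth n f"
proof (induction n arbitrary: f)
  case 0
  then show ?case
    by (auto simp: continuous_at_imp_continuous_on differentiable_imp_continuous_within)
next
  case (Suc n)
  show ?case
  proof (unfold smooth.simps(2)[of n], intro conjI allI)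
    show "f differentiable (at x)" for x using Suc.prems by simp
    show "smooth n (partial i f)" for i using Suc.prems Suc.IH by simp
  qed
qed

lemma smooth_mono: "smooth n f \<Longrightarrow> m \<le> n \<Longrightarrow> smooth m f"
  by (induction n) (auto simp: le_Suc_eq simp del: smooth.simps dest: smooth_Suc_imp)

lemma smooth_funpow_partial: "smooth (n + m) f \<Longrightarrow> smooth n ((partial i ^^ m) f)"
  by (induction m arbitrary: f) (auto simp: funpow_swap1)

lemma real_polynomial_function_has_derivative:
  assumes "real_polynomial_function p"
  shows "\<exists>p'. (\<forall>x. (p has_derivative p' x) (at x)) \<and> (\<forall>h. real_polynomial_function (\<lambda>x. p' x h))"
  using assms
proof induction
  case (linear f)
  then show ?case
    by (intro exI[of _ "\<lambda>x. f"]) (auto intro: bounded_linear_imp_has_derivative real_polynomial_function.intros)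
next
  case (const c)
  show ?case by (intro exI[of _ "\<lambda>x h. 0"]) (auto intro: real_polynomial_function.intros)
next
  case (add f g)
  then obtain f' g' where "\<forall>x. (f has_derivative f' x) (at x)" "\<forall>x. (g has_derivative g' x) (at x)"
    "\<forall>h. real_polynomial_function (\<lambda>x. f' x h)" "\<forall>h. real_polynomial_function (\<lambda>x. g' x h)" by blast
  then show ?case
    by (intro exI[of _ "\<lambda>x h. f' x h + g' x h"]) (auto intro!: has_derivative_add real_polynomial_function.intros(3))
next
  case (mult f g)
  then obtain f' g' where "\<forall>x. (f has_derivative f' x) (at x)" "\<forall>x. (g has_derivative g' x) (at x)"
    "\<forall>h. real_polynomial_function (\<lambda>x. f' x h)" "\<forall>h. real_polynomial_function (\<lambda>x. g' x h)" by blast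
  then show ?case
    using mult by (intro exI[of _ "\<lambda>x h. f x * g' x h + f' x h * g x"])
      (auto intro!: has_derivative_mult real_polynomial_function.intros(3,4))
qed

lemma real_polynomial_function_partial:
  assumes "real_polynomial_function p"
  shows "p differentiable (at x)" "real_polynomial_function (partial i p)"
proof -
  obtain p' where p': "\<And>x. (p has_derivative p' x) (at x)" "\<And>h. real_polynomial_function (\<lambda>x. p' x h)"
    using real_polynomial_function_has_derivative[OF assms] by blast
  then show "p differentiable (at x)" by (blast intro: differentiableI)
  have "partial i p = (\<lambda>x. p' x (axis i 1))" using partialI[OF p'(1)] by blast
  then show "real_polynomial_function (partial i p)" using p'(2) by simp
qed

lemma smooth_real_polynomial_function: "real_polynomial_function p \<Longrightarrow> smooth n p"
  by (induction n arbitrary: p)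
    (auto intro: real_polynomial_function_partial continuous_at_imp_continuous_on continuous_real_polymonial_function)

lemma partial_bounded_linear:
  assumes "bounded_linear L" "f differentiable (at x)"
  shows "partial i (\<lambda>x. L (f x)) x = L (partial i f x)"
  using partialI[OF bounded_linear.has_derivative[OF assms(1) differentiable_has_derivative[OF assms(2)]]]
  by (simp add: partial_def)

lemma smooth_bounded_linear:
  assumes L: "bounded_linear L"
  shows "smooth n f \<Longrightarrow> smooth n (\<lambda>x. L (f x))"
proof (induction n arbitrary: f)
  case 0
  then show ?case using bounded_linear.continuous_on[OF L] by simp
next
  case (Suc n)
  then have d: "f differentiable (at x)" for x by simp
  then have "(\<lambda>x. L (f x)) differentiable (at x)" for x
    using bounded_linear.has_derivative[OF L] unfolding differentiable_def by blast
  moreover have "partial i (\<lambda>x. L (f x)) = (\<lambda>x. L (partial i f x))" for i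
    using partial_bounded_linear[OF L d] by blast
  ultimately show ?case using Suc by simp
qed

lemma partial_add:
  assumes "f differentiable (at x)" "g differentiable (at x)"
  shows "partial i (\<lambda>x. f x + g x) x = partial i f x + partial i g x"
  using partialI[OF has_derivative_add[OF assms[THEN differentiable_has_derivative]]] by (simp add: partial_def)

lemma smooth_add:
  "smooth n f \<Longrightarrow> smooth n g \<Longrightarrow> smooth n (\<lambda>x. f x + g x)"
proof (induction n arbitrary: f g)
  case 0
  then show ?case by (simp add: continuous_on_add)
next
  case (Suc n)
  then have d: "f differentiable (at x)" "g differentiable (at x)" for x by simp_all
  then have "partial i (\<lambda>x. f x + g x) = (\<lambda>x. partial i f x + partial i g x)" for i
    using partial_add by blast
  then show ?case using Suc d by simp
qed

lemma smooth_lincomb: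
  fixes f g :: "real^2 \<Rightarrow> real"
  assumes "smooth n f" "smooth n g"
  shows "smooth n (\<lambda>x. a * f x + b * g x)"
  using assms by (intro smooth_add smooth_bounded_linear[OF bounded_linear_mult_right])

lemma partial_lincomb:
  fixes f g :: "real^2 \<Rightarrow> real"
  assumes "smooth (Suc n) f" "smooth (Suc n) g"
  shows "partial i (\<lambda>x. a * f x + b * g x) = (\<lambda>x. a * partial i f x + b * partial i g x)"
proof
  fix x
  have d: "f differentiable (at x)" "g differentiable (at x)" using assms by simp_all
  then have "((\<lambda>x. a * f x + b * g x) has_derivative
      (\<lambda>h. a * frechet_derivative f (at x) h + b * frechet_derivative g (at x) h)) (at x)"
    by (auto intro!: derivative_eq_intros differentiable_has_derivative)
  from partialI[OF this] show "partial i (\<lambda>x. a * f x + b * g x) x = a * partial i f x + b * partial i g x"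
    by (simp add: partial_def)
qed

lemma rot_axis:
  "rot \<phi> *v axis 1 1 = cos \<phi> *\<^sub>R axis 1 1 - sin \<phi> *\<^sub>R axis 2 1"
  "rot \<phi> *v axis 2 1 = sin \<phi> *\<^sub>R axis 1 1 + cos \<phi> *\<^sub>R axis 2 1"
  by (simp_all add: vec2_eq_iff axis_def)

lemma has_derivative_rot:
  assumes "f differentiable (at (rot \<phi> *v x))"
  shows "((\<lambda>x. f (rot \<phi> *v x)) has_derivative
    (\<lambda>h. frechet_derivative f (at (rot \<phi> *v x)) (rot \<phi> *v h))) (at x)"
  using diff_chain_at[OF bounded_linear_imp_has_derivative[OF matrix_vector_mul_bounded_linear]
      differentiable_has_derivative[OF assms]]
  by (simp add: o_def)

lemma partial_rot:
  assumes d: "f differentiable (at (rot \<phi> *v x))"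
  shows "partial 1 (\<lambda>x. f (rot \<phi> *v x)) x =
      cos \<phi> *\<^sub>R partial 1 f (rot \<phi> *v x) - sin \<phi> *\<^sub>R partial 2 f (rot \<phi> *v x)"
    and "partial 2 (\<lambda>x. f (rot \<phi> *v x)) x =
      sin \<phi> *\<^sub>R partial 1 f (rot \<phi> *v x) + cos \<phi> *\<^sub>R partial 2 f (rot \<phi> *v x)"
proof -
  interpret linear "frechet_derivative f (at (rot \<phi> *v x))"
    using d linear_frechet_derivative by blast
  show "partial 1 (\<lambda>x. f (rot \<phi> *v x)) x =
      cos \<phi> *\<^sub>R partial 1 f (rot \<phi> *v x) - sin \<phi> *\<^sub>R partial 2 f (rot \<phi> *v x)"
    "partial 2 (\<lambda>x. f (rot \<phi> *v x)) x =
      sin \<phi> *\<^sub>R partial 1 f (rot \<phi> *v x) + cos \<phi> *\<^sub>R partial 2 f (rot \<phi> *v x)"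
    unfolding partialI[OF has_derivative_rot[OF d]] rot_axis
    by (simp_all add: partial_def diff add scale)
qed

lemma smooth_rot: "smooth n f \<Longrightarrow> smooth n (\<lambda>x. f (rot \<phi> *v x))"
proof (induction n arbitrary: f)
  case 0
  then show ?case
    by (auto intro!: continuous_on_compose2[of UNIV f] matrix_vector_mult_linear_continuous_on)
next
  case (Suc n)
  then have d: "f differentiable (at x)" for x by simp
  have s: "smooth n (\<lambda>x. partial i f (rot \<phi> *v x))" for i using Suc by simp
  have bl: "bounded_linear (\<lambda>x::'a. c *\<^sub>R x)" for c by (rule bounded_linear_scaleR_right)
  have "smooth n (partial i (\<lambda>x. f (rot \<phi> *v x)))" for i
  proof (cases "i = 1")
    case True
    have "partial i (\<lambda>x. f (rot \<phi> *v x)) =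
      (\<lambda>x. cos \<phi> *\<^sub>R partial 1 f (rot \<phi> *v x) + (- sin \<phi>) *\<^sub>R partial 2 f (rot \<phi> *v x))"
      using partial_rot(1)[OF d] True by auto
    then show ?thesis using s by (simp only:) (intro smooth_add smooth_bounded_linear[OF bl])
  next
    case False
    then have "i = 2" using exhaust_2 by blast
    then have "partial i (\<lambda>x. f (rot \<phi> *v x)) =
      (\<lambda>x. sin \<phi> *\<^sub>R partial 1 f (rot \<phi> *v x) + cos \<phi> *\<^sub>R partial 2 f (rot \<phi> *v x))"
      using partial_rot(2)[OF d] by auto
    then show ?thesis using s by (simp only:) (intro smooth_add smooth_bounded_linear[OF bl])
  qed
  moreover have "(\<lambda>x. f (rot \<phi> *v x)) differentiable (at x)" for x
    using has_derivative_rot[OF d] differentiableI by blast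
  ultimately show ?case by simp
qed

lemma partial_mean_value:
  fixes f :: "real^2 \<Rightarrow> real"
  assumes d: "\<And>x. f differentiable (at x)" and h: "0 < h"
  obtains t where "0 < t" "t < h" "f (x + h *\<^sub>R axis i 1) - f x = h * partial i f (x + t *\<^sub>R axis i 1)"
proof -
  have "((\<lambda>t. f (x + t *\<^sub>R axis i 1)) has_derivative
      (\<lambda>k. frechet_derivative f (at (x + t *\<^sub>R axis i 1)) (k *\<^sub>R axis i 1))) (at t)" for t
  proof -
    have "((\<lambda>t. x + t *\<^sub>R axis i 1) has_derivative (\<lambda>k. k *\<^sub>R axis i 1)) (at t)"
      by (auto intro!: derivative_eq_intros)
    from diff_chain_at[OF this differentiable_has_derivative[OF d]] show ?thesis
      by (simp add: o_def)
  qed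
  moreover have "frechet_derivative f (at y) (k *\<^sub>R axis i 1) = k * partial i f y" for y k
    using linear_scale[OF linear_frechet_derivative[OF d]] by (simp add: partial_def)
  ultimately have "((\<lambda>t. f (x + t *\<^sub>R axis i 1)) has_derivative (\<lambda>k. k * partial i f (x + t *\<^sub>R axis i 1))) (at t)" for t
    by simp
  then have "\<exists>t\<in>{0<..<h}. f (x + h *\<^sub>R axis i 1) - f (x + 0 *\<^sub>R axis i 1) = (h - 0) * partial i f (x + t *\<^sub>R axis i 1)"
    using h by (intro mvt_simple) (auto intro: has_derivative_at_withinI)
  then show ?thesis using that by auto
qed

lemma second_difference_mean_value:
  fixes f :: "real^2 \<Rightarrow> real"
  assumes f: "smooth 2 f" and h: "0 < h"
  obtains s t where "0 < s" "s < h" "0 < t" "t < h"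
    "f (x + h *\<^sub>R axis i 1 + h *\<^sub>R axis j 1) - f (x + h *\<^sub>R axis i 1) - f (x + h *\<^sub>R axis j 1) + f x
      = h * (h * partial j (partial i f) (x + s *\<^sub>R axis i 1 + t *\<^sub>R axis j 1))"
proof -
  have f': "smooth (Suc (Suc 0)) f" using f by (simp only: numeral_2_eq_2)
  then have d: "f differentiable (at x)" "partial i f differentiable (at x)" for x i by simp_all
  define g where "g y = f (y + h *\<^sub>R axis j 1) - f y" for y
  have "(g has_derivative (\<lambda>k. frechet_derivative f (at (y + h *\<^sub>R axis j 1)) k - frechet_derivative f (at y) k)) (at y)" for y
  proof -
    have "((\<lambda>y. y + h *\<^sub>R axis j 1) has_derivative (\<lambda>k. k)) (at y)"
      by (auto intro!: derivative_eq_intros)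
    from has_derivative_diff[OF diff_chain_at[OF this differentiable_has_derivative[OF d(1)]] differentiable_has_derivative[OF d(1)]]
    show ?thesis by (simp add: o_def g_def[abs_def])
  qed
  then have dg: "g differentiable (at y)" "partial i g y = partial i f (y + h *\<^sub>R axis j 1) - partial i f y" for y
    using partialI[of g] by (auto intro: differentiableI simp: partial_def[of i f])
  obtain s where s: "0 < s" "s < h" "g (x + h *\<^sub>R axis i 1) - g x = h * partial i g (x + s *\<^sub>R axis i 1)"
    using partial_mean_value[of g, OF dg(1) h] by blast
  obtain t where t: "0 < t" "t < h"
    "partial i f (x + s *\<^sub>R axis i 1 + h *\<^sub>R axis j 1) - partial i f (x + s *\<^sub>R axis i 1) =
      h * partial j (partial i f) (x + s *\<^sub>R axis i 1 + t *\<^sub>R axis j 1)"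
    using partial_mean_value[of "partial i f", OF d(2) h] by blast
  show ?thesis
    using that[OF s(1,2) t(1,2)] s(3) t(3) dg(2)[of "x + s *\<^sub>R axis i 1"] by (simp add: g_def algebra_simps)
qed

text \<open>Both mixed derivatives are limits of the same second difference quotient.\<close>

lemma partial_commute:
  fixes f :: "real^2 \<Rightarrow> real"
  assumes f: "smooth 2 f"
  shows "partial i (partial j f) = partial j (partial i f)"
proof
  fix x
  let ?D = "partial j (partial i f)" and ?E = "partial i (partial j f)"
  have f': "smooth (Suc (Suc 0)) f" using f by (simp only: numeral_2_eq_2)
  then have cont: "continuous_on UNIV ?D" "continuous_on UNIV ?E" by simp_all
  show "?E x = ?D x"
  proof (rule ccontr)
    assume "?E x \<noteq> ?D x"
    define e where "e = \<bar>?E x - ?D x\<bar> / 2"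
    have "e > 0" using \<open>?E x \<noteq> ?D x\<close> by (simp add: e_def)
    then obtain a b where ab: "a > 0" "b > 0"
      and a: "\<And>y. dist y x < a \<Longrightarrow> dist (?D y) (?D x) < e"
      and b: "\<And>y. dist y x < b \<Longrightarrow> dist (?E y) (?E x) < e"
      using cont unfolding continuous_on_iff by (metis UNIV_I)
    \<comment> \<open>the intermediate points have distance at most \<open>2 * h\<close> from \<open>x\<close>\<close>
    define h where "h = min a b / 2"
    have h: "h > 0" "2 * h \<le> a" "2 * h \<le> b" using ab by (auto simp: h_def)
    have near: "dist (x + s *\<^sub>R axis k 1 + t *\<^sub>R axis l 1) x < 2 * h"
      if "0 < s" "s < h" "0 < t" "t < h" for s t and k l :: 2
    proof -
      have "norm (s *\<^sub>R axis k 1 + t *\<^sub>R axis l (1::real)) \<le> s + t"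
        using norm_triangle_ineq[of "s *\<^sub>R axis k (1::real)" "t *\<^sub>R axis l 1"] that by (simp add: norm_axis_1)
      then show ?thesis using that by (simp add: dist_norm add.assoc)
    qed
    obtain s t where st: "0 < s" "s < h" "0 < t" "t < h" and
      1: "f (x + h *\<^sub>R axis i 1 + h *\<^sub>R axis j 1) - f (x + h *\<^sub>R axis i 1) - f (x + h *\<^sub>R axis j 1) + f x
        = h * (h * ?D (x + s *\<^sub>R axis i 1 + t *\<^sub>R axis j 1))"
      using second_difference_mean_value[OF f h(1)] by blast
    obtain s' t' where st': "0 < s'" "s' < h" "0 < t'" "t' < h" and
      2: "f (x + h *\<^sub>R axis j 1 + h *\<^sub>R axis i 1) - f (x + h *\<^sub>R axis j 1) - f (x + h *\<^sub>R axis i 1) + f x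
        = h * (h * ?E (x + s' *\<^sub>R axis j 1 + t' *\<^sub>R axis i 1))"
      using second_difference_mean_value[OF f h(1)] by blast
    have "h * (h * ?D (x + s *\<^sub>R axis i 1 + t *\<^sub>R axis j 1)) = h * (h * ?E (x + s' *\<^sub>R axis j 1 + t' *\<^sub>R axis i 1))"
      using 1 2 by (simp add: algebra_simps)
    then have "?D (x + s *\<^sub>R axis i 1 + t *\<^sub>R axis j 1) = ?E (x + s' *\<^sub>R axis j 1 + t' *\<^sub>R axis i 1)"
      using h by simp
    moreover have "dist (?D (x + s *\<^sub>R axis i 1 + t *\<^sub>R axis j 1)) (?D x) < e"
      using near[OF st] h by (intro a) (meson less_le_trans)
    moreover have "dist (?E (x + s' *\<^sub>R axis j 1 + t' *\<^sub>R axis i 1)) (?E x) < e"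
      using near[OF st'] h by (intro b) (meson less_le_trans)
    ultimately have "dist (?D x) (?E x) < e + e"
      by (metis dist_commute dist_triangle_less_add)
    then show False
      by (simp add: dist_real_def e_def)
  qed
qed

section \<open>Rotation invariance of the jump terms\<close>

text \<open>The squared Frobenius norm of the tensor of all \<open>j\<close>-th derivatives, by recursion on the first
  index of the tensor.\<close>

primrec deriv_sq :: "nat \<Rightarrow> (real^2 \<Rightarrow> real) \<Rightarrow> real^2 \<Rightarrow> real" where
  "deriv_sq 0 f x = (f x)\<^sup>2"
| "deriv_sq (Suc j) f x = deriv_sq j (partial 1 f) x + deriv_sq j (partial 2 f) x"

text \<open>Being a quadratic form in \<open>f\<close>, it has the same sum over a pair of functions and over the rotated
  pair. Rotating the argument of a function turns its two partial derivatives into such a rotated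
  pair, so this is the step in the induction on the order of differentiation.\<close>

lemma deriv_sq_rotate_pair:
  assumes cs: "c\<^sup>2 + s\<^sup>2 = (1::real)"
  shows "smooth j f \<Longrightarrow> smooth j g \<Longrightarrow>
    deriv_sq j (\<lambda>x. c * f x + (- s) * g x) x + deriv_sq j (\<lambda>x. s * f x + c * g x) x = deriv_sq j f x + deriv_sq j g x"
proof (induction j arbitrary: f g)
  case 0
  have "(c * a - s * b)\<^sup>2 + (s * a + c * b)\<^sup>2 = a\<^sup>2 + b\<^sup>2" for a b
    using cs by algebra
  then show ?case by simp
next
  case (Suc j)
  have "smooth j (partial i f)" "smooth j (partial i g)" for i
    using Suc.prems by simp_all
  from Suc.IH[OF this[of 1]] Suc.IH[OF this[of 2]] show ?case
    unfolding deriv_sq.simps partial_lincomb[OF Suc.prems] by linarith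
qed

lemma deriv_sq_rot:
  "smooth j f \<Longrightarrow> deriv_sq j (\<lambda>x. f (rot \<phi> *v x)) x = deriv_sq j f (rot \<phi> *v x)"
proof (induction j arbitrary: f)
  case 0
  then show ?case by simp
next
  case (Suc j)
  then have d: "f differentiable (at x)" and s: "smooth j (partial i f)" for x i by simp_all
  let ?f1 = "\<lambda>y. cos \<phi> * partial 1 f y + (- sin \<phi>) * partial 2 f y"
  let ?f2 = "\<lambda>y. sin \<phi> * partial 1 f y + cos \<phi> * partial 2 f y"
  have "partial 1 (\<lambda>x. f (rot \<phi> *v x)) = (\<lambda>x. ?f1 (rot \<phi> *v x))"
    "partial 2 (\<lambda>x. f (rot \<phi> *v x)) = (\<lambda>x. ?f2 (rot \<phi> *v x))"
    using partial_rot[OF d] by (auto simp: fun_eq_iff)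
  then have "deriv_sq (Suc j) (\<lambda>x. f (rot \<phi> *v x)) x =
      deriv_sq j (\<lambda>x. ?f1 (rot \<phi> *v x)) x + deriv_sq j (\<lambda>x. ?f2 (rot \<phi> *v x)) x"
    by simp
  also have "\<dots> = deriv_sq j ?f1 (rot \<phi> *v x) + deriv_sq j ?f2 (rot \<phi> *v x)"
    by (simp only: Suc.IH[OF smooth_lincomb[OF s s]])
  also have "\<dots> = deriv_sq (Suc j) f (rot \<phi> *v x)"
    using deriv_sq_rotate_pair[OF sin_cos_squared_add2 s s] by simp
  finally show ?case .
qed

lemma sum_choose_Suc:
  fixes g :: "nat \<Rightarrow> real"
  shows "(\<Sum>a\<le>Suc j. real (Suc j choose a) * g a) = (\<Sum>a\<le>j. real (j choose a) * (g (Suc a) + g a))"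
proof -
  have "(\<Sum>a\<le>Suc j. real (Suc j choose a) * g a) = g 0 + (\<Sum>a\<le>j. real (Suc j choose Suc a) * g (Suc a))"
    by (subst sum.atMost_Suc_shift) simp
  also have "\<dots> = g 0 + (\<Sum>a\<le>j. real (j choose Suc a) * g (Suc a)) + (\<Sum>a\<le>j. real (j choose a) * g (Suc a))"
    by (simp add: algebra_simps sum.distrib)
  also have "g 0 + (\<Sum>a\<le>j. real (j choose Suc a) * g (Suc a)) = (\<Sum>a\<le>Suc j. real (j choose a) * g a)"
    by (subst sum.atMost_Suc_shift) simp
  finally show ?thesis by (simp add: algebra_simps sum.distrib)
qed

lemma partial_funpow_commute:
  fixes f :: "real^2 \<Rightarrow> real"
  shows "smooth (Suc n) f \<Longrightarrow> (partial j ^^ n) (partial i f) = partial i ((partial j ^^ n) f)"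
proof (induction n)
  case 0
  then show ?case by simp
next
  case (Suc n)
  have "smooth 2 ((partial j ^^ n) f)"
    using Suc.prems by (intro smooth_funpow_partial) simp
  then have "partial j (partial i ((partial j ^^ n) f)) = partial i (partial j ((partial j ^^ n) f))"
    by (rule partial_commute)
  then show ?case
    using Suc.IH[OF smooth_Suc_imp[OF Suc.prems]] by simp
qed

text \<open>Mixed derivatives commute, so the derivative with \<open>a\<close> indices equal to 1 occurs
  \<open>j choose a\<close> times in the tensor; in the recursion this is Pascal's rule.\<close>

lemma deriv_sq_eq_binomial_sum:
  "smooth j f \<Longrightarrow> deriv_sq j f x = (\<Sum>a\<le>j. real (j choose a) * ((partial 1 ^^ a) ((partial 2 ^^ (j - a)) f) x)\<^sup>2)"
proof (induction j arbitrary: f)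
  case 0
  then show ?case by simp
next
  case (Suc j)
  have s: "smooth j (partial i f)" for i
    using Suc.prems by simp
  define g where "g a = ((partial 1 ^^ a) ((partial 2 ^^ (Suc j - a)) f) x)\<^sup>2" for a
  have 1: "((partial 1 ^^ a) ((partial 2 ^^ (j - a)) (partial 1 f)) x)\<^sup>2 = g (Suc a)" if "a \<le> j" for a
  proof -
    have "(partial 2 ^^ (j - a)) (partial 1 f) = partial 1 ((partial 2 ^^ (j - a)) f)"
      by (rule partial_funpow_commute[OF smooth_mono[OF Suc.prems]]) simp
    then show ?thesis by (simp add: g_def funpow_swap1)
  qed
  have 2: "((partial 1 ^^ a) ((partial 2 ^^ (j - a)) (partial 2 f)) x)\<^sup>2 = g a" if "a \<le> j" for a
    using that by (simp add: g_def Suc_diff_le funpow_swap1)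
  have "deriv_sq (Suc j) f x = (\<Sum>a\<le>j. real (j choose a) * (g (Suc a) + g a))"
    unfolding deriv_sq.simps Suc.IH[OF s] distrib_left sum.distrib
    by (intro arg_cong2[where f="(+)"] sum.cong) (use 1 2 in auto)
  also have "\<dots> = (\<Sum>a\<le>Suc j. real (Suc j choose a) * g a)"
    by (rule sum_choose_Suc[symmetric])
  finally show ?case by (simp only: g_def)
qed

lemma partial_funpow_diff:
  fixes f g :: "real^2 \<Rightarrow> real"
  shows "smooth n f \<Longrightarrow> smooth n g \<Longrightarrow>
    (partial i ^^ n) (\<lambda>x. f x - g x) = (\<lambda>x. (partial i ^^ n) f x - (partial i ^^ n) g x)"
proof (induction n arbitrary: f g)
  case (Suc n)
  have "partial i (\<lambda>x. f x - g x) = (\<lambda>x. partial i f x - partial i g x)"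
    using partial_lincomb[OF Suc.prems, of i 1 "-1"] by simp
  then show ?case using Suc by (simp add: funpow_swap1)
qed simp

lemma edge_point_rotate_mesh [simp]:
  "edge_point (rotate_mesh \<phi> v) c i s = rot \<phi> *v edge_point v c i s"
  by (simp add: edge_point_def rotate_mesh_def matrix_vector_right_distrib matrix_vector_mult_scaleR)

lemma edge_length_rotate_mesh [simp]: "edge_length (rotate_mesh \<phi> v) c i = edge_length v c i"
  by (simp add: edge_length_def rotate_mesh_def)

lemma edge_integral_rotate_mesh:
  "edge_integral Q (rotate_mesh \<phi> v) c i g = edge_integral Q v c i (\<lambda>x. g (rot \<phi> *v x))"
  by (cases Q) simp_all

lemma jump_size_eq:
  assumes "smooth j wi" "smooth j we"
  shows "jump_size v c i j wi we =
    sqrt (1 / edge_length v c i * edge_integral Exact v c i (deriv_sq j (\<lambda>x. wi x - we x)))"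
proof -
  have s: "smooth j (\<lambda>x. wi x - we x)"
    using smooth_lincomb[OF assms, of 1 "-1"] by simp
  have "(partial 1 ^^ a) ((partial 2 ^^ (j - a)) wi) x - (partial 1 ^^ a) ((partial 2 ^^ (j - a)) we) x =
      (partial 1 ^^ a) ((partial 2 ^^ (j - a)) (\<lambda>x. wi x - we x)) x" if "a \<le> j" for a x
  proof -
    have "smooth a ((partial 2 ^^ (j - a)) wi)" "smooth a ((partial 2 ^^ (j - a)) we)"
      using assms that by (auto intro!: smooth_funpow_partial)
    then show ?thesis
      using assms by (subst partial_funpow_diff[OF smooth_mono smooth_mono]) (auto simp: partial_funpow_diff)
  qed
  then have "deriv_sq j (\<lambda>x. wi x - we x) = (\<lambda>x. \<Sum>a\<le>j. real (j choose a) *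
        ((partial 1 ^^ a) ((partial 2 ^^ (j - a)) wi) x
         - (partial 1 ^^ a) ((partial 2 ^^ (j - a)) we) x)\<^sup>2)"
    by (simp add: fun_eq_iff deriv_sq_eq_binomial_sum[OF s])
  then show ?thesis by (simp only: jump_size_def)
qed

lemma jump_size_rotate:
  assumes "smooth j wi" "smooth j we"
  shows "jump_size (rotate_mesh \<phi> v) c i j (\<lambda>x. wi (rot (- \<phi>) *v x)) (\<lambda>x. we (rot (- \<phi>) *v x)) =
    jump_size v c i j wi we"
proof -
  have s: "smooth j (\<lambda>x. wi x - we x)"
    using smooth_lincomb[OF assms, of 1 "-1"] by simp
  show ?thesis
    using assms deriv_sq_rot[OF s, of "- \<phi>"]
    by (simp add: jump_size_eq smooth_rot edge_integral_rotate_mesh del: edge_integral.simps)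
qed

section \<open>The \<open>L\<^sup>2\<close> projection\<close>

lemma integrable_compact_continuous:
  fixes f :: "'a::euclidean_space \<Rightarrow> 'b::euclidean_space"
  assumes "compact K" "continuous_on UNIV f"
  shows "integrable (lebesgue_on K) f"
proof -
  have K: "K \<in> sets lebesgue" "K \<in> lmeasurable"
    using assms(1) lmeasurable_compact fmeasurableD by blast+
  have "continuous_on K f" using assms(2) continuous_on_subset by blast
  then have "bounded (f ` K)" using assms(1) compact_continuous_image compact_imp_bounded by blast
  then obtain B where B: "\<And>x. x \<in> K \<Longrightarrow> norm (f x) \<le> B" unfolding bounded_iff by blast
  have "f \<in> borel_measurable (lebesgue_on K)"
    using continuous_imp_measurable_on_sets_lebesgue[OF \<open>continuous_on K f\<close> K(1)] .
  moreover have "integrable (lebesgue_on K) (\<lambda>x. B)"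
    using K(2) by (simp add: integrable_restrict_space fmeasurable_def integrable_indicator_iff
        del: emeasure_completion)
  ultimately show ?thesis
    using measurable_bounded_by_integrable_imp_lebesgue_integrable B K(1) by blast
qed

lemma integrable_continuous_scaleR:
  fixes f :: "'a::euclidean_space \<Rightarrow> 'b::euclidean_space"
  assumes f: "integrable (lebesgue_on K) f" and K: "compact K" and p: "continuous_on UNIV p"
  shows "integrable (lebesgue_on K) (\<lambda>x. p x *\<^sub>R f x)"
proof -
  have Km: "K \<in> sets lebesgue" using K lmeasurable_compact fmeasurableD by blast
  have cont: "continuous_on K p" using p continuous_on_subset by blast
  then have "bounded (p ` K)" using K compact_continuous_image compact_imp_bounded by blast
  then obtain B where B: "\<And>x. x \<in> K \<Longrightarrow> norm (p x) \<le> B" unfolding bounded_iff by blast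
  have "p \<in> borel_measurable (lebesgue_on K)"
    using continuous_imp_measurable_on_sets_lebesgue[OF cont Km] .
  then have "(\<lambda>x. p x *\<^sub>R f x) \<in> borel_measurable (lebesgue_on K)"
    using borel_measurable_integrable[OF f] by (rule borel_measurable_scaleR)
  moreover have "integrable (lebesgue_on K) (\<lambda>x. B * norm (f x))"
    using f by simp
  moreover have "norm (p x *\<^sub>R f x) \<le> B * norm (f x)" if "x \<in> K" for x
    using B[OF that] by (simp add: mult_right_mono)
  ultimately show ?thesis
    using measurable_bounded_by_integrable_imp_lebesgue_integrable Km by blast
qed

text \<open>Elimination of the last unknown leaves a \<open>1 \<times> 1\<close> system whose coefficient is the value of the
  quadratic form at a nonzero vector.\<close>

lemma positive_definite_system_solvable:
  fixes G :: "'i \<Rightarrow> 'i \<Rightarrow> real"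
  assumes "finite I"
    and "\<And>y. \<exists>i\<in>I. y i \<noteq> 0 \<Longrightarrow> 0 < (\<Sum>i\<in>I. y i * (\<Sum>j\<in>I. G i j * y j))"
  shows "\<exists>a. \<forall>i\<in>I. (\<Sum>j\<in>I. G i j * a j) = b i"
  using assms
proof (induction I arbitrary: b rule: finite_induct)
  case empty
  then show ?case by simp
next
  case (insert k I)
  have pos: "0 < (\<Sum>i\<in>I. y i * (\<Sum>j\<in>I. G i j * y j))" if "\<exists>i\<in>I. y i \<noteq> 0" for y
  proof -
    define z where "z = y(k := 0)"
    have eq: "z i = y i" if "i \<in> I" for i using insert.hyps that by (auto simp: z_def)
    have "\<exists>i\<in>insert k I. z i \<noteq> 0" using that eq by (metis insertCI)
    from insert.prems[OF this] have "0 < (\<Sum>i\<in>insert k I. z i * (\<Sum>j\<in>insert k I. G i j * z j))" .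
    also have "z k = 0" by (simp add: z_def)
    then have "(\<Sum>i\<in>insert k I. z i * (\<Sum>j\<in>insert k I. G i j * z j)) = (\<Sum>i\<in>I. z i * (\<Sum>j\<in>I. G i j * z j))"
      using insert.hyps by simp
    also have "\<dots> = (\<Sum>i\<in>I. y i * (\<Sum>j\<in>I. G i j * y j))"
      using eq by (intro sum.cong arg_cong2[where f = "(*)"] refl) simp_all
    finally show ?thesis .
  qed
  obtain c where c: "\<And>i. i \<in> I \<Longrightarrow> (\<Sum>j\<in>I. G i j * c j) = G i k"
    using insert.IH[OF pos, of "\<lambda>i. G i k"] by blast
  obtain a where a: "\<And>i. i \<in> I \<Longrightarrow> (\<Sum>j\<in>I. G i j * a j) = b i"
    using insert.IH[OF pos, of b] by blast
  have ext: "(\<Sum>j\<in>insert k I. G i j * (if j = k then t else f j)) = G i k * t + (\<Sum>j\<in>I. G i j * f j)" for i t f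
  proof -
    have "(\<Sum>j\<in>I. G i j * (if j = k then t else f j)) = (\<Sum>j\<in>I. G i j * f j)"
      using insert.hyps by (intro sum.cong) auto
    then show ?thesis using insert.hyps by simp
  qed
  define d where "d = G k k - (\<Sum>j\<in>I. G k j * c j)"
  have "0 < d"
  proof -
    define y where "y i = (if i = k then 1 else - c i)" for i
    have row: "(\<Sum>j\<in>insert k I. G i j * y j) = G i k - (\<Sum>j\<in>I. G i j * c j)" for i
      using ext[of i 1 "\<lambda>i. - c i"] by (simp add: y_def sum_negf)
    have "0 < (\<Sum>i\<in>insert k I. y i * (\<Sum>j\<in>insert k I. G i j * y j))"
      by (rule insert.prems) (simp add: y_def)
    also have "\<dots> = y k * d + (\<Sum>i\<in>I. y i * (G i k - (\<Sum>j\<in>I. G i j * c j)))"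
      unfolding row using insert.hyps by (simp add: d_def)
    also have "(\<Sum>i\<in>I. y i * (G i k - (\<Sum>j\<in>I. G i j * c j))) = 0"
      using c by (intro sum.neutral) simp
    finally show ?thesis by (simp add: y_def)
  qed
  \<comment> \<open>a solution of the rows in \<open>I\<close> stays one along \<open>a - t * c\<close>; row \<open>k\<close> fixes \<open>t\<close>\<close>
  define t where "t = (b k - (\<Sum>j\<in>I. G k j * a j)) / d"
  have row: "(\<Sum>j\<in>insert k I. G i j * (if j = k then t else a j - t * c j)) =
      t * (G i k - (\<Sum>j\<in>I. G i j * c j)) + (\<Sum>j\<in>I. G i j * a j)" for i
    unfolding ext by (simp add: algebra_simps sum_subtractf sum_distrib_left)
  have "(\<Sum>j\<in>insert k I. G i j * (if j = k then t else a j - t * c j)) = b i" if "i \<in> insert k I" for i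
  proof (cases "i = k")
    case True
    then show ?thesis unfolding row using \<open>0 < d\<close> by (simp add: t_def flip: d_def)
  next
    case False
    then show ?thesis unfolding row using a c that by simp
  qed
  then show ?case
    by (intro exI[of _ "\<lambda>j. if j = k then t else a j - t * c j"]) blast
qed

lemma poly2_coefficients_zero:
  assumes "\<And>x::real^2. (\<Sum>(r, s)\<in>(SIGMA r:{..m}. {..m - r}). a r s * ((x $ 1) ^ r * (x $ 2) ^ s)) = 0"
    and "(r, s) \<in> (SIGMA r:{..m}. {..m - r})"
  shows "a r s = (0::real)"
proof -
  have "(\<Sum>r\<le>m. (\<Sum>s\<le>m - r. a r s * z ^ s) * y ^ r) = 0" for y z
  proof -
    have "(\<Sum>r\<le>m. \<Sum>s\<le>m - r. a r s * (y ^ r * z ^ s)) = 0"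
      using assms(1)[of "vector [y, z]"] by (simp add: sum.Sigma)
    then show ?thesis by (simp add: sum_distrib_left sum_distrib_right algebra_simps)
  qed
  then have "(\<Sum>s\<le>m - r. a r s * z ^ s) = 0" for z
    using polyfun_eq_0[of "\<lambda>r. \<Sum>s\<le>m - r. a r s * z ^ s" m] assms(2) by auto
  then show ?thesis
    using polyfun_eq_0[of "a r" "m - r"] assms(2) by auto
qed

lemma poly2_integrable:
  assumes "compact K" "p \<in> poly2 m" "q \<in> poly2 n"
  shows "integrable (lebesgue_on K) (\<lambda>x. p x * q x)"
  using assms by (intro integrable_compact_continuous continuous_on_mult poly2_continuous_on)

lemma poly2_integral_square_pos:
  assumes K: "compact K" and int: "interior K \<noteq> {}" and p: "p \<in> poly2 m" "p \<noteq> (\<lambda>x. 0)"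
  shows "0 < (LINT x|lebesgue_on K. p x * p x)"
proof -
  have "(LINT x|lebesgue_on K. p x * p x) \<noteq> 0"
  proof
    assume "(LINT x|lebesgue_on K. p x * p x) = 0"
    then have "AE x in lebesgue_on K. p x * p x = 0"
      using integral_nonneg_eq_0_iff_AE[OF poly2_integrable[OF K p(1) p(1)]] by simp
    then have "AE x in lebesgue. x \<in> K \<longrightarrow> p x = 0"
      using K by (simp add: AE_restrict_space_iff fmeasurableD lmeasurable_compact)
    then have "{x. \<not> (x \<in> K \<longrightarrow> p x = 0)} \<in> null_sets lebesgue"
      by (simp add: AE_iff_null_sets completion.AE_iff_null_sets)
    then have "negligible {x. x \<in> K \<and> p x \<noteq> 0}"
      by (simp add: negligible_iff_null_sets)
    then have "negligible (interior K \<inter> p -` (- {0}))"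
      by (rule negligible_subset) (use interior_subset in auto)
    moreover have "open (interior K \<inter> p -` (- {0}))"
      using poly2_continuous_on[OF p(1)] by (intro continuous_open_preimage) auto
    ultimately have "interior K \<inter> p -` (- {0}) = {}"
      using open_not_negligible by blast
    then have "p = (\<lambda>x. 0)"
      using int by (intro poly2_eqI[OF p(1) poly2_zero, where A = "interior K"]) auto
    then show False using p(2) by simp
  qed
  moreover have "0 \<le> (LINT x|lebesgue_on K. p x * p x)"
    by (intro Bochner_Integration.integral_nonneg) simp
  ultimately show ?thesis by linarith
qed

text \<open>On a cell, both the numerical solution and square integrable initial data have this property; it is
  what the existence of the projection requires.\<close>

definition poly_integrable :: "(real^2) set \<Rightarrow> (real^2 \<Rightarrow> real) \<Rightarrow> bool" where
  "poly_integrable K w \<longleftrightarrow> (\<forall>m. \<forall>q\<in>poly2 m. integrable (lebesgue_on K) (\<lambda>x. w x * q x))"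

lemma poly_integrable_poly2: "compact K \<Longrightarrow> w \<in> poly2 n \<Longrightarrow> poly_integrable K w"
  unfolding poly_integrable_def using poly2_integrable by blast

lemma poly_integrable_lincomb:
  assumes "poly_integrable K w" "poly_integrable K w'"
  shows "poly_integrable K (\<lambda>x. a * w x + b * w' x)"
proof -
  have "(\<lambda>x. (a * w x + b * w' x) * q x) = (\<lambda>x. a * (w x * q x) + b * (w' x * q x))" for q
    by (simp add: algebra_simps)
  then show ?thesis
    using assms by (simp add: poly_integrable_def)
qed

lemma l2_proj_ex:
  assumes K: "compact K" and int: "interior K \<noteq> {}" and w: "poly_integrable K w"
  shows "\<exists>p\<in>poly2 m. \<forall>q\<in>poly2 m. (LINT x|lebesgue_on K. p x * q x) = (LINT x|lebesgue_on K. w x * q x)"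
proof -
  define I where "I = (SIGMA r:{..m}. {..m - r})"
  define e :: "nat \<times> nat \<Rightarrow> real^2 \<Rightarrow> real" where "e i x = (x $ 1) ^ fst i * (x $ 2) ^ snd i" for i x
  have "finite I" by (simp add: I_def)
  have poly: "p \<in> poly2 m \<longleftrightarrow> (\<exists>a. p = (\<lambda>x. \<Sum>i\<in>I. a i * e i x))" for p
  proof
    assume "p \<in> poly2 m"
    then obtain a where "p = (\<lambda>x. \<Sum>(r, s)\<in>I. a r s * ((x $ 1) ^ r * (x $ 2) ^ s))"
      unfolding poly2_monomials I_def by blast
    then have "p = (\<lambda>x. \<Sum>i\<in>I. a (fst i) (snd i) * e i x)"
      by (simp add: e_def case_prod_unfold)
    then show "\<exists>a. p = (\<lambda>x. \<Sum>i\<in>I. a i * e i x)"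
      by (intro exI[of _ "\<lambda>i. a (fst i) (snd i)"])
  next
    assume "\<exists>a. p = (\<lambda>x. \<Sum>i\<in>I. a i * e i x)"
    then obtain a where "p = (\<lambda>x. \<Sum>i\<in>I. a i * e i x)" by blast
    then show "p \<in> poly2 m"
      unfolding poly2_monomials I_def e_def
      by (intro exI[of _ "\<lambda>r s. a (r, s)"]) (simp add: case_prod_unfold)
  qed
  have e: "e i \<in> poly2 m" if "i \<in> I" for i
    using that unfolding e_def I_def by (intro poly2_monomial) auto
  have ee: "integrable (lebesgue_on K) (\<lambda>x. e i x * e j x)" if "i \<in> I" "j \<in> I" for i j
    using that e K by (intro poly2_integrable)
  define G where "G i j = (LINT x|lebesgue_on K. e i x * e j x)" for i j
  have G: "(\<Sum>j\<in>I. G i j * a j) = (LINT x|lebesgue_on K. e i x * (\<Sum>j\<in>I. a j * e j x))" if "i \<in> I" for a i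
  proof -
    have "(LINT x|lebesgue_on K. e i x * (\<Sum>j\<in>I. a j * e j x)) = (LINT x|lebesgue_on K. (\<Sum>j\<in>I. a j * (e i x * e j x)))"
      by (simp add: sum_distrib_left algebra_simps)
    also have "\<dots> = (\<Sum>j\<in>I. a j * G i j)"
      using ee[OF that] by (simp add: Bochner_Integration.integral_sum G_def)
    finally show ?thesis by (simp add: mult.commute)
  qed
  have "0 < (\<Sum>i\<in>I. y i * (\<Sum>j\<in>I. G i j * y j))" if "\<exists>i\<in>I. y i \<noteq> 0" for y
  proof -
    define p where "p = (\<lambda>x. \<Sum>i\<in>I. y i * e i x)"
    have p: "p \<in> poly2 m" using poly p_def by blast
    have "p \<noteq> (\<lambda>x. 0)"
    proof
      assume "p = (\<lambda>x. 0)"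
      then have "(\<Sum>(r, s)\<in>(SIGMA r:{..m}. {..m - r}). y (r, s) * ((x $ 1) ^ r * (x $ 2) ^ s)) = 0" for x :: "real^2"
        by (simp add: p_def fun_eq_iff e_def I_def case_prod_unfold)
      then show False
        using poly2_coefficients_zero[where m = m and a = "\<lambda>r s. y (r, s)"] that by (force simp: I_def)
    qed
    then have "0 < (LINT x|lebesgue_on K. p x * p x)"
      using poly2_integral_square_pos[OF K int p] by simp
    also have "(LINT x|lebesgue_on K. p x * p x) = (LINT x|lebesgue_on K. (\<Sum>i\<in>I. y i * (e i x * p x)))"
      by (simp add: p_def sum_distrib_right algebra_simps)
    also have "\<dots> = (\<Sum>i\<in>I. y i * (LINT x|lebesgue_on K. e i x * p x))"
      using poly2_integrable[OF K e p] by (simp add: Bochner_Integration.integral_sum)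
    also have "\<dots> = (\<Sum>i\<in>I. y i * (\<Sum>j\<in>I. G i j * y j))"
      using G by (simp add: p_def)
    finally show ?thesis .
  qed
  then have "\<exists>a. \<forall>i\<in>I. (\<Sum>j\<in>I. G i j * a j) = (LINT x|lebesgue_on K. w x * e i x)"
    by (rule positive_definite_system_solvable[OF \<open>finite I\<close>])
  then obtain a where a: "\<And>i. i \<in> I \<Longrightarrow> (\<Sum>j\<in>I. G i j * a j) = (LINT x|lebesgue_on K. w x * e i x)"
    by blast
  define p where "p = (\<lambda>x. \<Sum>i\<in>I. a i * e i x)"
  have p: "p \<in> poly2 m" using poly p_def by blast
  have pe: "(LINT x|lebesgue_on K. p x * e i x) = (LINT x|lebesgue_on K. w x * e i x)" if "i \<in> I" for i
    using a[OF that] G[OF that, of a] by (simp add: p_def mult.commute)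
  have "(LINT x|lebesgue_on K. p x * q x) = (LINT x|lebesgue_on K. w x * q x)" if "q \<in> poly2 m" for q
  proof -
    from iffD1[OF poly that] obtain b where b: "q = (\<lambda>x. \<Sum>i\<in>I. b i * e i x)" by blast
    have *: "(LINT x|lebesgue_on K. g x * q x) = (\<Sum>i\<in>I. b i * (LINT x|lebesgue_on K. g x * e i x))"
      if "poly_integrable K g" for g
    proof -
      have "(LINT x|lebesgue_on K. g x * q x) = (LINT x|lebesgue_on K. (\<Sum>i\<in>I. b i * (g x * e i x)))"
        by (simp add: b sum_distrib_left algebra_simps)
      moreover have "integrable (lebesgue_on K) (\<lambda>x. g x * e i x)" if "i \<in> I" for i
        using \<open>poly_integrable K g\<close> e[OF that] unfolding poly_integrable_def by simp
      ultimately show ?thesis by (simp add: Bochner_Integration.integral_sum)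
    qed
    show ?thesis
      using pe by (simp add: *[OF w] *[OF poly_integrable_poly2[OF K p]])
  qed
  with p show ?thesis by blast
qed

lemma l2_proj_eqI:
  assumes K: "compact K" and int: "interior K \<noteq> {}" and p: "p \<in> poly2 m"
    and eq: "\<And>q. q \<in> poly2 m \<Longrightarrow> (LINT x|lebesgue_on K. p x * q x) = (LINT x|lebesgue_on K. w x * q x)"
  shows "l2_proj m K w = p"
  unfolding l2_proj_def
proof (rule the_equality)
  fix p' assume "p' \<in> poly2 m \<and> (\<forall>q\<in>poly2 m. (LINT x|lebesgue_on K. p' x * q x) = (LINT x|lebesgue_on K. w x * q x))"
  then have p': "p' \<in> poly2 m"
    and eq': "\<And>q. q \<in> poly2 m \<Longrightarrow> (LINT x|lebesgue_on K. p' x * q x) = (LINT x|lebesgue_on K. p x * q x)"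
    using eq by auto
  define d where "d x = p' x - p x" for x
  have d: "d \<in> poly2 m" unfolding d_def using p' p by (rule poly2_diff)
  have "(LINT x|lebesgue_on K. d x * d x) = (LINT x|lebesgue_on K. p' x * d x - p x * d x)"
    by (simp add: d_def algebra_simps)
  also have "\<dots> = 0"
    using eq'[OF d] poly2_integrable[OF K p' d] poly2_integrable[OF K p d] by simp
  finally have "d = (\<lambda>x. 0)"
    using poly2_integral_square_pos[OF K int d] by fastforce
  then show "p' = p" by (simp add: d_def fun_eq_iff)
qed (use p eq in blast)

lemma l2_proj_spec:
  assumes "compact K" "interior K \<noteq> {}" "poly_integrable K w"
  shows "l2_proj m K w \<in> poly2 m"
    and "q \<in> poly2 m \<Longrightarrow> (LINT x|lebesgue_on K. l2_proj m K w x * q x) = (LINT x|lebesgue_on K. w x * q x)"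
proof -
  obtain p where p: "p \<in> poly2 m"
    "\<And>q. q \<in> poly2 m \<Longrightarrow> (LINT x|lebesgue_on K. p x * q x) = (LINT x|lebesgue_on K. w x * q x)"
    using l2_proj_ex[OF assms] by blast
  then have "l2_proj m K w = p" using l2_proj_eqI assms by blast
  then show "l2_proj m K w \<in> poly2 m"
    "q \<in> poly2 m \<Longrightarrow> (LINT x|lebesgue_on K. l2_proj m K w x * q x) = (LINT x|lebesgue_on K. w x * q x)"
    using p by simp_all
qed

lemma l2_proj_lincomb:
  assumes K: "compact K" "interior K \<noteq> {}" and w: "poly_integrable K w" "poly_integrable K w'"
  shows "l2_proj m K (\<lambda>x. a * w x + b * w' x) = (\<lambda>x. a * l2_proj m K w x + b * l2_proj m K w' x)"
proof (rule l2_proj_eqI[OF K])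
  note p = l2_proj_spec[where m = m, OF K w(1)] and p' = l2_proj_spec[where m = m, OF K w(2)]
  show "(\<lambda>x. a * l2_proj m K w x + b * l2_proj m K w' x) \<in> poly2 m"
    using p(1) p'(1) by (intro poly2_add poly2_cmult)
  fix q assume q: "q \<in> poly2 m"
  have lin: "(LINT x|lebesgue_on K. (a * f x + b * g x) * q x) =
      a * (LINT x|lebesgue_on K. f x * q x) + b * (LINT x|lebesgue_on K. g x * q x)"
    if "poly_integrable K f" "poly_integrable K g" for f g
  proof -
    have "(LINT x|lebesgue_on K. (a * f x + b * g x) * q x) =
        (LINT x|lebesgue_on K. a * (f x * q x) + b * (g x * q x))"
      by (simp add: algebra_simps)
    then show ?thesis using that q by (simp add: poly_integrable_def)
  qed
  show "(LINT x|lebesgue_on K. (a * l2_proj m K w x + b * l2_proj m K w' x) * q x) =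
      (LINT x|lebesgue_on K. (a * w x + b * w' x) * q x)"
    unfolding lin[OF w] using lin[OF poly_integrable_poly2[OF K(1) p(1)] poly_integrable_poly2[OF K(1) p'(1)]] p(2)[OF q] p'(2)[OF q]
    by simp
qed

lemma poly_integrable_rot:
  assumes "compact K" "poly_integrable K w"
  shows "poly_integrable ((*v) (rot \<phi>) ` K) (\<lambda>x. w (rot (- \<phi>) *v x))"
proof -
  have "integrable (lebesgue_on K) (\<lambda>x. w x * q (rot \<phi> *v x))" if "q \<in> poly2 m" for q m
    using assms(2) poly2_rot[OF that, of \<phi>] unfolding poly_integrable_def by simp
  then show ?thesis
    using assms(1) by (simp add: poly_integrable_def integrable_rot fmeasurableD lmeasurable_compact)
qed

lemma compact_rot: "compact K \<Longrightarrow> compact ((*v) (rot \<phi>) ` K)"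
  by (intro compact_continuous_image matrix_vector_mult_linear_continuous_on)

lemma interior_rot: "interior ((*v) (rot \<phi>) ` K) = (*v) (rot \<phi>) ` interior K"
  by (intro interior_injective_linear_image linear_rot inj_rot)

lemma l2_proj_rot:
  assumes K: "compact K" "interior K \<noteq> {}" and w: "poly_integrable K w"
  shows "l2_proj m ((*v) (rot \<phi>) ` K) (\<lambda>x. w (rot (- \<phi>) *v x)) = (\<lambda>x. l2_proj m K w (rot (- \<phi>) *v x))"
proof (rule l2_proj_eqI)
  show "compact ((*v) (rot \<phi>) ` K)" "interior ((*v) (rot \<phi>) ` K) \<noteq> {}"
    using K by (auto simp: compact_rot interior_rot)
  show "(\<lambda>x. l2_proj m K w (rot (- \<phi>) *v x)) \<in> poly2 m"
    using l2_proj_spec(1)[OF K w] by (rule poly2_rot)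
  fix q assume "q \<in> poly2 m"
  then have "(\<lambda>x. q (rot \<phi> *v x)) \<in> poly2 m" by (rule poly2_rot)
  moreover have "K \<in> sets lebesgue" using K(1) by (simp add: fmeasurableD lmeasurable_compact)
  ultimately show "(LINT x|lebesgue_on ((*v) (rot \<phi>) ` K). l2_proj m K w (rot (- \<phi>) *v x) * q x) =
      (LINT x|lebesgue_on ((*v) (rot \<phi>) ` K). w (rot (- \<phi>) *v x) * q x)"
    using l2_proj_spec(2)[OF K w] by (simp add: integral_rot)
qed

lemma rotate_field_component:
  assumes V: "vector_pairs V"
  obtains (scalar) "is_scalar V i" "\<And>w x. rotate_field V \<phi> w x $ i = w (rot (- \<phi>) *v x) $ i"
  | (pair) j a b where "\<And>w x. rotate_field V \<phi> w x $ i =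
      a * w (rot (- \<phi>) *v x) $ i + b * w (rot (- \<phi>) *v x) $ j"
proof (cases V i rule: vector_pairs_cases)
  case scalar
  then show ?thesis using that(1) by (simp add: rotate_field_def comp_rot_mult_scalar)
next
  case (first j)
  show ?thesis
    by (rule that(2)[of "cos \<phi>" "sin \<phi>" j]) (simp add: rotate_field_def comp_rot_mult_fst[OF V first])
next
  case (second j)
  show ?thesis
    by (rule that(2)[of "cos \<phi>" "- sin \<phi>" j]) (simp add: rotate_field_def comp_rot_mult_snd[OF V second])
qed

lemma poly_integrable_rotate_field:
  assumes V: "vector_pairs V" and K: "compact K" and w: "\<And>i. poly_integrable K (\<lambda>x. w x $ i)"
  shows "poly_integrable ((*v) (rot \<phi>) ` K) (\<lambda>x. rotate_field V \<phi> w x $ i)"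
proof (rule rotate_field_component[OF V, of i \<phi>])
  assume "is_scalar V i" "\<And>w x. rotate_field V \<phi> w x $ i = w (rot (- \<phi>) *v x) $ i"
  then show ?thesis using poly_integrable_rot[OF K w] by simp
next
  fix j a b
  assume "\<And>w x. rotate_field V \<phi> w x $ i = a * w (rot (- \<phi>) *v x) $ i + b * w (rot (- \<phi>) *v x) $ j"
  then show ?thesis
    using poly_integrable_rot[OF K poly_integrable_lincomb[OF w w]] by simp
qed

text \<open>A rotated component is a combination of two components of the original field, so
  equivariance of the vector projection needs linearity of the scalar one in addition to the change
  of variables.\<close>

lemma l2_proj_vec_rotate_field:
  assumes V: "vector_pairs V" and K: "compact K" "interior K \<noteq> {}" and w: "\<And>i. poly_integrable K (\<lambda>x. w x $ i)"
  shows "l2_proj_vec m ((*v) (rot \<phi>) ` K) (rotate_field V \<phi> w) = rotate_field V \<phi> (l2_proj_vec m K w)"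
proof -
  have "l2_proj_vec m ((*v) (rot \<phi>) ` K) (rotate_field V \<phi> w) x $ i = rotate_field V \<phi> (l2_proj_vec m K w) x $ i" for x i
  proof (rule rotate_field_component[OF V, of i \<phi>])
    assume "is_scalar V i" "\<And>w x. rotate_field V \<phi> w x $ i = w (rot (- \<phi>) *v x) $ i"
    then show ?thesis using l2_proj_rot[OF K w] by (simp add: l2_proj_vec_def)
  next
    fix j a b
    assume eq: "\<And>w x. rotate_field V \<phi> w x $ i = a * w (rot (- \<phi>) *v x) $ i + b * w (rot (- \<phi>) *v x) $ j"
    have "l2_proj m ((*v) (rot \<phi>) ` K) (\<lambda>y. a * w (rot (- \<phi>) *v y) $ i + b * w (rot (- \<phi>) *v y) $ j) x =
        a * l2_proj m K (\<lambda>y. w y $ i) (rot (- \<phi>) *v x) + b * l2_proj m K (\<lambda>y. w y $ j) (rot (- \<phi>) *v x)"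
      using l2_proj_rot[OF K poly_integrable_lincomb[OF w w], of m \<phi> a i b j]
      by (simp add: l2_proj_lincomb[OF K w w])
    then show ?thesis by (simp add: l2_proj_vec_def eq)
  qed
  then show ?thesis by (simp add: fun_eq_iff vec_eq_iff)
qed

lemma l2_proj_vec_component:
  assumes "compact K" "interior K \<noteq> {}" "poly_integrable K (\<lambda>x. w x $ i)"
  shows "(\<lambda>x. l2_proj_vec m K w x $ i) \<in> poly2 m"
  using l2_proj_spec(1)[OF assms] by (simp add: l2_proj_vec_def)

section \<open>Rotated meshes\<close>

text \<open>The mesh hypotheses in a form that is immediately preserved by rotations: nondegenerate cells
  that fill the domain up to a null set.\<close>

definition mesh_on :: "'c::finite mesh \<Rightarrow> (real^2) set \<Rightarrow> bool" where
  "mesh_on v \<Omega> \<longleftrightarrow> (\<forall>c. inj (v c) \<and> \<not> affine_dependent (range (v c))) \<and>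
     (\<Union>c. interior (cell v c)) \<subseteq> \<Omega> \<and> \<Omega> \<subseteq> (\<Union>c. cell v c)"

lemma triangulates_mesh_on: "triangulates v \<Omega> \<Longrightarrow> mesh_on v \<Omega>"
  by (auto simp: triangulates_def mesh_on_def)

lemma cell_rotate_mesh: "cell (rotate_mesh \<phi> v) c = (*v) (rot \<phi>) ` cell v c"
proof -
  have "range (rotate_mesh \<phi> v c) = (*v) (rot \<phi>) ` range (v c)"
    by (auto simp: rotate_mesh_def)
  then show ?thesis by (simp add: cell_def convex_hull_linear_image[OF linear_rot])
qed

lemma edge_rotate_mesh: "edge (rotate_mesh \<phi> v) c i = (*v) (rot \<phi>) ` edge v c i"
  by (simp add: edge_def rotate_mesh_def closed_segment_linear_image[OF linear_rot])

lemma infdist_rot: "infdist (rot \<phi> *v x) ((*v) (rot \<phi>) ` A) = infdist x A"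
  by (simp add: infdist_def image_image)

lemma edge_height_rotate_mesh [simp]: "edge_height (rotate_mesh \<phi> v) c i = edge_height v c i"
  by (simp add: edge_height_def cell_rotate_mesh edge_rotate_mesh image_image infdist_rot)

lemma affine_dependent_rot:
  assumes "affine_dependent ((*v) (rot \<phi>) ` A)"
  shows "affine_dependent A"
proof -
  obtain x where x: "x \<in> A" "rot \<phi> *v x \<in> affine hull ((*v) (rot \<phi>) ` A - {rot \<phi> *v x})"
    using assms by (auto simp: affine_dependent_def)
  have "(*v) (rot \<phi>) ` A - {rot \<phi> *v x} = (*v) (rot \<phi>) ` (A - {x})"
    by auto
  then have "rot \<phi> *v x \<in> (*v) (rot \<phi>) ` (affine hull (A - {x}))"
    using x affine_hull_linear_image[of "(*v) (rot \<phi>)"] matrix_vector_mul_bounded_linear by metis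
  then show ?thesis
    using x by (auto simp: affine_dependent_def)
qed

lemma mesh_on_rotate:
  assumes "mesh_on v \<Omega>"
  shows "mesh_on (rotate_mesh \<phi> v) ((*v) (rot \<phi>) ` \<Omega>)"
proof -
  have "range (rotate_mesh \<phi> v c) = (*v) (rot \<phi>) ` range (v c)" for c
    by (auto simp: rotate_mesh_def)
  moreover have "\<not> affine_dependent ((*v) (rot \<phi>) ` range (v c))" for c
    using assms affine_dependent_rot unfolding mesh_on_def by blast
  moreover have "inj (rotate_mesh \<phi> v c)" for c
    using assms by (auto simp: mesh_on_def rotate_mesh_def inj_def)
  moreover have "(*v) (rot \<phi>) ` (\<Union>c. interior (cell v c)) \<subseteq> (*v) (rot \<phi>) ` \<Omega>"
    "(*v) (rot \<phi>) ` \<Omega> \<subseteq> (*v) (rot \<phi>) ` (\<Union>c. cell v c)"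
    using assms unfolding mesh_on_def by (blast intro: image_mono)+
  ultimately show ?thesis
    unfolding mesh_on_def cell_rotate_mesh interior_rot image_UN by simp
qed

lemma mesh_on_cell:
  assumes "mesh_on v \<Omega>"
  shows "compact (cell v c)" "interior (cell v c) \<noteq> {}" "cell v c \<in> sets lebesgue"
    "negligible (cell v c - interior (cell v c))"
proof -
  show comp: "compact (cell v c)"
    by (simp add: cell_def finite_imp_compact_convex_hull)
  then show "cell v c \<in> sets lebesgue" by (simp add: fmeasurableD lmeasurable_compact)
  have "card (range (v c)) = Suc (DIM(real^2))"
    using assms by (simp add: mesh_on_def card_image)
  then show "interior (cell v c) \<noteq> {}"
    using assms interior_convex_hull_eq_empty[of "range (v c)"] by (simp add: mesh_on_def cell_def)
  have "cell v c - interior (cell v c) \<subseteq> frontier (cell v c)"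
    using comp by (auto simp: frontier_def compact_imp_closed)
  then show "negligible (cell v c - interior (cell v c))"
    using negligible_convex_frontier negligible_subset by (metis cell_def convex_convex_hull)
qed

lemma mesh_on_domain_sets:
  assumes "mesh_on v \<Omega>"
  shows "\<Omega> \<in> sets lebesgue"
proof -
  define U where "U = (\<Union>c. interior (cell v c))"
  have "negligible (\<Union>c. cell v c - interior (cell v c))"
    using mesh_on_cell(4)[OF assms] by (intro negligible_Union) auto
  moreover have "\<Omega> - U \<subseteq> (\<Union>c. cell v c - interior (cell v c))"
    using assms unfolding mesh_on_def U_def by blast
  ultimately have "\<Omega> - U \<in> sets lebesgue"
    using negligible_subset negligible_imp_sets by blast
  moreover have "open U" unfolding U_def by blast
  then have "U \<in> sets lebesgue" by (intro sets_completionI_sets) simp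
  moreover have "U \<union> (\<Omega> - U) = \<Omega>"
    using assms by (auto simp: mesh_on_def U_def)
  ultimately show ?thesis using sets.Un[of U lebesgue "\<Omega> - U"] by (simp only:)
qed

lemma three_vertices:
  fixes i :: 3
  shows "i + 1 \<noteq> i" "i + 2 \<noteq> i" "i + 1 \<noteq> i + 2" "{i + 1, i + 2, i} = UNIV"
proof -
  show ne: "i + 1 \<noteq> i" "i + 2 \<noteq> i" "i + 1 \<noteq> i + 2" by simp_all
  then show "{i + 1, i + 2, i} = UNIV"
    by (intro card_subset_eq) simp_all
qed

text \<open>In the plane the normals of \<open>e\<close> form a line, which contains two unit
  vectors; the sign condition selects one of them.\<close>

lemma unit_normal_ex1:
  fixes e f :: "real^2"
  assumes "e $ 1 * f $ 2 - e $ 2 * f $ 1 \<noteq> 0"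
  shows "\<exists>!n. norm n = 1 \<and> n \<bullet> e = 0 \<and> n \<bullet> f < 0"
proof -
  \<comment> \<open>\<open>e\<close> turned by a right angle\<close>
  define m :: "real^2" where "m = vector [- e $ 2, e $ 1]"
  define s where "s = - sgn (m \<bullet> f) / norm m"
  have mf: "m \<bullet> f \<noteq> 0" using assms by (simp add: m_def inner_vec_def sum_2)
  then have m: "m \<noteq> 0" by auto
  have me: "m \<bullet> e = 0" by (simp add: m_def inner_vec_def sum_2)
  have s: "\<bar>s\<bar> * norm m = 1" "s * (m \<bullet> f) < 0"
  proof -
    show "\<bar>s\<bar> * norm m = 1" using m mf by (simp add: s_def abs_mult abs_sgn_eq)
    have "s * (m \<bullet> f) = - \<bar>m \<bullet> f\<bar> / norm m" by (simp add: s_def abs_sgn mult.commute)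
    then show "s * (m \<bullet> f) < 0" using m mf by (simp add: divide_neg_pos)
  qed
  show ?thesis
  proof (rule ex1I[of _ "s *\<^sub>R m"])
    show "norm (s *\<^sub>R m) = 1 \<and> s *\<^sub>R m \<bullet> e = 0 \<and> s *\<^sub>R m \<bullet> f < 0"
      using s me by simp
    fix n assume n: "norm n = 1 \<and> n \<bullet> e = 0 \<and> n \<bullet> f < 0"
    define t where "t = (n \<bullet> m) / (m \<bullet> m)"
    have mm: "m \<bullet> m = (e $ 1)\<^sup>2 + (e $ 2)\<^sup>2" by (simp add: m_def inner_vec_def sum_2 power2_eq_square)
    have ne: "n $ 1 * e $ 1 + n $ 2 * e $ 2 = 0" using n by (simp add: inner_vec_def sum_2)
    have "n $ 1 * (m \<bullet> m) = (n \<bullet> m) * m $ 1" "n $ 2 * (m \<bullet> m) = (n \<bullet> m) * m $ 2"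
      using ne by (simp_all add: m_def inner_vec_def sum_2) algebra+
    then have nt: "n = t *\<^sub>R m"
      using m by (simp add: vec2_eq_iff t_def eq_divide_eq)
    then have "\<bar>t\<bar> * norm m = \<bar>s\<bar> * norm m" "t * (m \<bullet> f) < 0" using n s by auto
    then have "\<bar>t\<bar> = \<bar>s\<bar>" "t * (m \<bullet> f) < 0" using m by auto
    moreover have "t \<noteq> - s" using \<open>t * (m \<bullet> f) < 0\<close> s(2) by auto
    ultimately have "t = s" by (metis abs_eq_iff)
    then show "n = s *\<^sub>R m" using nt by simp
  qed
qed

lemma outward_normal_ex1:
  assumes "mesh_on v \<Omega>"
  shows "\<exists>!n. norm n = 1 \<and> n \<bullet> (v c (i + 2) - v c (i + 1)) = 0 \<and> n \<bullet> (v c i - v c (i + 1)) < 0"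
proof (rule unit_normal_ex1)
  let ?e = "v c (i + 2) - v c (i + 1)" and ?f = "v c i - v c (i + 1)"
  have inj: "inj (v c)" and aff: "\<not> affine_dependent (range (v c))"
    using assms by (auto simp: mesh_on_def)
  have "range (v c) = {v c (i + 2), v c (i + 1), v c i}"
    unfolding three_vertices(4)[of i, symmetric] by (simp add: insert_commute)
  moreover have "v c (i + 2) \<noteq> v c (i + 1)" "v c (i + 2) \<noteq> v c i" "v c (i + 1) \<noteq> v c i"
    using inj three_vertices[of i] by (metis injD)+
  ultimately have "\<not> collinear {v c (i + 2), v c (i + 1), v c i}"
    using aff by (simp add: collinear_3_eq_affine_dependent)
  then have "\<not> collinear {0, ?e, ?f}"
    using collinear_3[of "v c (i + 2)" "v c (i + 1)" "v c i"] by simp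
  then have e: "?e \<noteq> 0" and nc: "\<And>k. ?f \<noteq> k *\<^sub>R ?e"
    by (auto simp: collinear_lemma)
  show "?e $ 1 * ?f $ 2 - ?e $ 2 * ?f $ 1 \<noteq> 0"
  proof
    assume 0: "?e $ 1 * ?f $ 2 - ?e $ 2 * ?f $ 1 = 0"
    have "(?e \<bullet> ?e) *\<^sub>R ?f = (?e \<bullet> ?f) *\<^sub>R ?e"
    proof -
      have "(a * a + b * b) * x = (a * x + b * y) * a" "(a * a + b * b) * y = (a * x + b * y) * b"
        if "a * y - b * x = 0" for a b x y :: real
        using that by algebra+
      from this[OF 0] show ?thesis by (simp add: vec2_eq_iff inner_vec_def sum_2)
    qed
    then have "?f = ((?e \<bullet> ?f) / (?e \<bullet> ?e)) *\<^sub>R ?e"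
      using e by (simp add: eq_vector_fraction_iff)
    then show False using nc by blast
  qed
qed

lemma outward_normal_props:
  assumes "mesh_on v \<Omega>"
  shows "norm (outward_normal v c i) = 1"
    "outward_normal v c i \<bullet> (v c (i + 2) - v c (i + 1)) = 0"
    "outward_normal v c i \<bullet> (v c i - v c (i + 1)) < 0"
  using theI'[OF outward_normal_ex1[OF assms, of c i]] by (simp_all add: outward_normal_def)

lemma outward_normal_rotate_mesh:
  assumes "mesh_on v \<Omega>"
  shows "outward_normal (rotate_mesh \<phi> v) c i = rot \<phi> *v outward_normal v c i"
  unfolding outward_normal_def[of "rotate_mesh \<phi> v"]
  using outward_normal_props[OF assms, of c i]
  by (intro the1_equality outward_normal_ex1[OF mesh_on_rotate[OF assms]])
    (simp add: rotate_mesh_def flip: matrix_vector_mult_diff_distrib)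

lemma neighbour_rotate_mesh: "neighbour (rotate_mesh \<phi> v) = neighbour v"
  by (simp add: fun_eq_iff neighbour_def edge_rotate_mesh inj_image_eq_iff[OF inj_rot])

lemma exterior_fun_rotate:
  assumes "vector_pairs V"
  shows "exterior_fun (rotate_mesh \<phi> v) (rotate_bdata V \<phi> B) (\<lambda>c. rotate_field V \<phi> (u c)) c i =
    rotate_field V \<phi> (exterior_fun v B u c i)"
  using assms by (simp add: exterior_fun_def neighbour_rotate_mesh rotate_bdata_rotate_field)

section \<open>Rotation invariance of the wave speeds\<close>

lemma states_comp_rot_iff:
  assumes V: "vector_pairs (vecs S)" and ri: "rotation_invariant_system S"
  shows "comp_rot (vecs S) \<phi> *v u \<in> states S \<longleftrightarrow> u \<in> states S"
proof -
  have "comp_rot (vecs S) \<phi> *v u \<in> states S" if "u \<in> states S" for \<phi> u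
    using ri that by (simp add: rotation_invariant_system_def Let_def)
  then show ?thesis by (metis V comp_rot_minus_cancel)
qed

lemma flux_comp_rot:
  assumes V: "vector_pairs (vecs S)" and ri: "rotation_invariant_system S" and u: "u \<in> states S"
  shows "flux1 S (comp_rot (vecs S) \<phi> *v u) = comp_rot (vecs S) \<phi> *v (cos \<phi> *\<^sub>R flux1 S u + sin \<phi> *\<^sub>R flux2 S u)"
    and "flux2 S (comp_rot (vecs S) \<phi> *v u) = comp_rot (vecs S) \<phi> *v ((- sin \<phi>) *\<^sub>R flux1 S u + cos \<phi> *\<^sub>R flux2 S u)"
proof -
  have "comp_rot (vecs S) (- \<phi>) *v flux1 S (comp_rot (vecs S) \<phi> *v u) = cos \<phi> *\<^sub>R flux1 S u + sin \<phi> *\<^sub>R flux2 S u"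
    "comp_rot (vecs S) (- \<phi>) *v flux2 S (comp_rot (vecs S) \<phi> *v u) = (- sin \<phi>) *\<^sub>R flux1 S u + cos \<phi> *\<^sub>R flux2 S u"
    using ri u by (simp_all only: rotation_invariant_system_def Let_def matrix_inv_comp_rot[OF V])
  then show "flux1 S (comp_rot (vecs S) \<phi> *v u) = comp_rot (vecs S) \<phi> *v (cos \<phi> *\<^sub>R flux1 S u + sin \<phi> *\<^sub>R flux2 S u)"
    "flux2 S (comp_rot (vecs S) \<phi> *v u) = comp_rot (vecs S) \<phi> *v ((- sin \<phi>) *\<^sub>R flux1 S u + cos \<phi> *\<^sub>R flux2 S u)"
    using comp_rot_minus_cancel'[OF V] by metis+
qed

lemma rot_lincomb:
  fixes a b :: "'a::real_vector"
  shows "(cos \<phi> * x + sin \<phi> * y) *\<^sub>R (cos \<phi> *\<^sub>R a + sin \<phi> *\<^sub>R b)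
    + (- sin \<phi> * x + cos \<phi> * y) *\<^sub>R ((- sin \<phi>) *\<^sub>R a + cos \<phi> *\<^sub>R b) = x *\<^sub>R a + y *\<^sub>R b"
proof -
  let ?c = "cos \<phi>" and ?s = "sin \<phi>"
  have "(?c * x + ?s * y) *\<^sub>R (?c *\<^sub>R a + ?s *\<^sub>R b) + (- ?s * x + ?c * y) *\<^sub>R ((- ?s) *\<^sub>R a + ?c *\<^sub>R b)
    = ((?c * x + ?s * y) * ?c + (- ?s * x + ?c * y) * (- ?s)) *\<^sub>R a
      + ((?c * x + ?s * y) * ?s + (- ?s * x + ?c * y) * ?c) *\<^sub>R b"
    by (simp only: scaleR_add_right scaleR_add_left scaleR_scaleR ac_simps)
  also have "(?c * x + ?s * y) * ?c + (- ?s * x + ?c * y) * (- ?s) = x"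
    using sin_cos_squared_add[of \<phi>] by algebra
  also have "(?c * x + ?s * y) * ?s + (- ?s * x + ?c * y) * ?c = y"
    using sin_cos_squared_add[of \<phi>] by algebra
  finally show ?thesis .
qed

lemma has_derivative_comp_rot:
  fixes T :: "real^'d^'d::finite" and f g :: "real^'d \<Rightarrow> real^'d"
  assumes "open A" "u \<in> A" and eq: "\<And>w. w \<in> A \<Longrightarrow> f (T *v w) = T *v g w"
    and f: "(f has_derivative f') (at (T *v u))" and g: "(g has_derivative g') (at u)"
  shows "f' (T *v h) = T *v g' h"
proof -
  have "((\<lambda>w. f (T *v w)) has_derivative (\<lambda>h. f' (T *v h))) (at u)"
    using diff_chain_at[OF bounded_linear_imp_has_derivative[OF matrix_vector_mul_bounded_linear] f] by (simp add: o_def)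
  then have "((\<lambda>w. T *v g w) has_derivative (\<lambda>h. f' (T *v h))) (at u)"
    by (rule has_derivative_transform_within_open[OF _ assms(1,2) eq])
  moreover have "((\<lambda>w. T *v g w) has_derivative (\<lambda>h. T *v g' h)) (at u)"
    by (rule bounded_linear.has_derivative[OF matrix_vector_mul_bounded_linear g])
  ultimately have "(\<lambda>h. f' (T *v h)) = (\<lambda>h. T *v g' h)" by (rule has_derivative_unique)
  then show ?thesis by (rule fun_cong)
qed

text \<open>Differentiating the invariance relations of the fluxes gives the Jacobians at the
  rotated state. The rotation of the normal undoes the mixing of the two fluxes, by
  \<open>rot_lincomb\<close>, so that only a conjugation remains.\<close>

lemma normal_jacobian_comp_rot:
  assumes hyp: "hyperbolic S" and V: "vector_pairs (vecs S)" and ri: "rotation_invariant_system S" and u: "u \<in> states S"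
  shows "normal_jacobian S (comp_rot (vecs S) \<phi> *v u) (rot \<phi> *v n) ** comp_rot (vecs S) \<phi> =
    comp_rot (vecs S) \<phi> ** normal_jacobian S u n"
proof -
  let ?T = "comp_rot (vecs S) \<phi>"
  let ?J1 = "jacobian (flux1 S) (at u)" and ?J2 = "jacobian (flux2 S) (at u)"
  let ?J1' = "jacobian (flux1 S) (at (?T *v u))" and ?J2' = "jacobian (flux2 S) (at (?T *v u))"
  have "open (states S)" using hyp by (simp add: hyperbolic_def)
  have d: "(flux1 S has_derivative (\<lambda>h. jacobian (flux1 S) (at w) *v h)) (at w)"
    "(flux2 S has_derivative (\<lambda>h. jacobian (flux2 S) (at w) *v h)) (at w)" if "w \<in> states S" for w
    using hyp that unfolding hyperbolic_def by (simp_all flip: jacobian_works)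
  have Tu: "?T *v u \<in> states S" using u by (simp add: states_comp_rot_iff[OF V ri])
  have 1: "?J1' *v (?T *v h) = ?T *v (cos \<phi> *\<^sub>R (?J1 *v h) + sin \<phi> *\<^sub>R (?J2 *v h))" for h
    by (rule has_derivative_comp_rot[where f = "flux1 S" and T = ?T, OF \<open>open (states S)\<close> u flux_comp_rot(1)[OF V ri]])
      (assumption, rule d[OF Tu], intro has_derivative_add has_derivative_scaleR_right d[OF u])
  have 2: "?J2' *v (?T *v h) = ?T *v ((- sin \<phi>) *\<^sub>R (?J1 *v h) + cos \<phi> *\<^sub>R (?J2 *v h))" for h
    by (rule has_derivative_comp_rot[where f = "flux2 S" and T = ?T, OF \<open>open (states S)\<close> u flux_comp_rot(2)[OF V ri]])
      (assumption, rule d[OF Tu], intro has_derivative_add has_derivative_scaleR_right d[OF u])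
  have "(normal_jacobian S (?T *v u) (rot \<phi> *v n) ** ?T) *v h = (?T ** normal_jacobian S u n) *v h" for h
  proof -
    have "(normal_jacobian S (?T *v u) (rot \<phi> *v n) ** ?T) *v h =
      (cos \<phi> * n $ 1 + sin \<phi> * n $ 2) *\<^sub>R (?J1' *v (?T *v h)) + (- sin \<phi> * n $ 1 + cos \<phi> * n $ 2) *\<^sub>R (?J2' *v (?T *v h))"
      by (simp add: normal_jacobian_def matrix_vector_mult_add_rdistrib scaleR_matrix_vector_assoc
          flip: matrix_vector_mul_assoc)
    also have "\<dots> = ?T *v (n $ 1 *\<^sub>R (?J1 *v h) + n $ 2 *\<^sub>R (?J2 *v h))"
    proof -
      have comb: "a *\<^sub>R (?T *v x) + b *\<^sub>R (?T *v y) = ?T *v (a *\<^sub>R x + b *\<^sub>R y)" for a b x y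
        by (simp add: matrix_vector_right_distrib matrix_vector_mult_scaleR)
      show ?thesis unfolding 1 2 comb rot_lincomb ..
    qed
    also have "\<dots> = (?T ** normal_jacobian S u n) *v h"
      by (simp add: normal_jacobian_def matrix_vector_mult_add_rdistrib scaleR_matrix_vector_assoc
          flip: matrix_vector_mul_assoc)
    finally show ?thesis .
  qed
  then show ?thesis by (simp add: matrix_eq)
qed

lemma map_matrix_mult:
  "map_matrix complex_of_real (A ** B) = map_matrix complex_of_real A ** map_matrix complex_of_real B"
  by (simp add: vec_eq_iff matrix_matrix_mult_def)

lemma map_matrix_mat_1: "map_matrix complex_of_real (mat 1) = mat 1"
  by (simp add: vec_eq_iff mat_def)

text \<open>Eigenvectors \<open>z\<close> correspond to eigenvectors \<open>T z\<close> with the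
  same eigenvalue.\<close>

lemma spectral_radius_similar:
  fixes A A' T T' :: "real^'n^'n"
  assumes sim: "A' ** T = T ** A" and inv: "T' ** T = mat 1" "T ** T' = mat 1"
  shows "spectral_radius A' = spectral_radius A"
proof -
  let ?c = "map_matrix complex_of_real"
  have *: "\<exists>z. z \<noteq> 0 \<and> ?c A' *v z = l *s z"
    if sim: "A' ** T = T ** A" and inv: "T' ** T = mat 1" and z: "z \<noteq> 0" "?c A *v z = l *s z"
    for A A' T T' :: "real^'n^'n" and z l
  proof (intro exI conjI)
    have "?c T' *v (?c T *v z) = z"
      using arg_cong[OF inv, of ?c] by (simp add: map_matrix_mult map_matrix_mat_1 matrix_vector_mul_assoc)
    then show "?c T *v z \<noteq> 0" using z(1) by auto
    have "?c A' *v (?c T *v z) = ?c T *v (?c A *v z)"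
      using arg_cong[OF sim, of ?c] by (simp add: map_matrix_mult matrix_vector_mul_assoc)
    then show "?c A' *v (?c T *v z) = l *s (?c T *v z)"
      by (simp add: z(2) vec.scale)
  qed
  have "A ** T' = T' ** A'"
  proof -
    have "T' ** (A' ** T) ** T' = T' ** (T ** A) ** T'" using sim by simp
    then show ?thesis
      by (metis inv matrix_mul_assoc matrix_mul_lid matrix_mul_rid)
  qed
  then have "{l. \<exists>z. z \<noteq> 0 \<and> ?c A' *v z = l *s z} = {l. \<exists>z. z \<noteq> 0 \<and> ?c A *v z = l *s z}"
    using *[OF sim inv(1)] *[OF _ inv(2)] by blast
  then show ?thesis by (simp add: spectral_radius_def)
qed

lemma wave_speed_comp_rot:
  assumes "hyperbolic S" and V: "vector_pairs (vecs S)" and ri: "rotation_invariant_system S"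
  shows "wave_speed S (comp_rot (vecs S) \<phi> *v u) (rot \<phi> *v n) = wave_speed S u n"
proof -
  have "comp_rot (vecs S) (- \<phi>) ** comp_rot (vecs S) \<phi> = mat 1" "comp_rot (vecs S) \<phi> ** comp_rot (vecs S) (- \<phi>) = mat 1"
    using comp_rot_minus_cancel[OF V] comp_rot_minus_cancel'[OF V]
    by (simp_all add: matrix_eq flip: matrix_vector_mul_assoc)
  then show ?thesis
    using spectral_radius_similar[OF normal_jacobian_comp_rot[OF assms]] states_comp_rot_iff[OF V ri]
    by (simp add: wave_speed_def)
qed

section \<open>Rotation invariance of the damping coefficients\<close>

lemma broken_rotate:
  assumes "\<And>c x. w' c (rot \<phi> *v x) = f (w c x)" and "f 0 = 0"
  shows "broken (rotate_mesh \<phi> v) w' (rot \<phi> *v x) = f (broken v w x)"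
proof -
  have "rot \<phi> *v x \<in> interior (cell (rotate_mesh \<phi> v) c) \<longleftrightarrow> x \<in> interior (cell v c)" for c
    by (simp add: cell_rotate_mesh interior_rot rot_image_iff)
  then show ?thesis by (simp add: broken_def assms)
qed

text \<open>The map \<open>f\<close> is pulled out of the integral without an integrability
  hypothesis; its linear left inverse \<open>g\<close> makes the integrals on both sides exist or
  fail together.\<close>

lemma domain_mean_rotate:
  fixes f :: "'a::{banach, second_countable_topology} \<Rightarrow> 'b::{banach, second_countable_topology}"
  assumes \<Omega>: "\<Omega> \<in> sets lebesgue" and w: "\<And>c x. w' c (rot \<phi> *v x) = f (w c x)"
    and f: "bounded_linear f" and g: "bounded_linear g" "\<And>x. g (f x) = x"
  shows "domain_mean ((*v) (rot \<phi>) ` \<Omega>) (rotate_mesh \<phi> v) w' = f (domain_mean \<Omega> v w)"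
proof -
  have "f 0 = 0" using f by (simp add: linear_simps)
  then have "(LINT x|lebesgue_on ((*v) (rot \<phi>) ` \<Omega>). broken (rotate_mesh \<phi> v) w' x) =
      (LINT x|lebesgue_on \<Omega>. f (broken v w x))"
    by (simp add: integral_rot[OF \<Omega>] broken_rotate[of w' \<phi> f w, OF w])
  also have "\<dots> = f (LINT x|lebesgue_on \<Omega>. broken v w x)"
    by (rule integral_bounded_linear'[OF f g(1)]) (use g in auto)
  finally show ?thesis
    using f by (simp add: domain_mean_def measure_rot_image[OF \<Omega>] linear_simps)
qed

lemma linf_norm_rotate:
  fixes w w' :: "'c \<Rightarrow> real^2 \<Rightarrow> 'a::real_normed_vector"
  assumes \<Omega>: "\<Omega> \<in> sets lebesgue" and w: "\<And>c x. norm (w' c (rot \<phi> *v x)) = norm (w c x)"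
  shows "linf_norm ((*v) (rot \<phi>) ` \<Omega>) (rotate_mesh \<phi> v) w' = linf_norm \<Omega> v w"
proof -
  have n: "norm (broken v w x) = broken v (\<lambda>c x. norm (w c x)) x" for v :: "'c mesh" and w :: "'c \<Rightarrow> real^2 \<Rightarrow> 'a" and x
    by (simp add: broken_def)
  show ?thesis
    unfolding linf_norm_def n esssup_rot[OF \<Omega>] using w
    by (subst broken_rotate[where f = "\<lambda>x. x" and w = "\<lambda>c x. norm (w c x)"]) auto
qed

lemma delta_rotate:
  fixes f g :: "'a::{banach, second_countable_topology} \<Rightarrow> 'a"
  assumes \<Omega>: "\<Omega> \<in> sets lebesgue" and w: "\<And>c x. w' c (rot \<phi> *v x) = f (w c x)"
    and f: "bounded_linear f" "\<And>x. norm (f x) = norm x" and g: "bounded_linear g" "\<And>x. g (f x) = x"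
    and s: "smooth j wi" "smooth j we"
  shows "delta k ((*v) (rot \<phi>) ` \<Omega>) (rotate_mesh \<phi> v) c i j w'
      (\<lambda>x. wi (rot (- \<phi>) *v x)) (\<lambda>x. we (rot (- \<phi>) *v x)) = delta k \<Omega> v c i j w wi we"
proof -
  note mean = domain_mean_rotate[of \<Omega> w' \<phi> f w g v, OF \<Omega> w f(1) g]
  have "f x = f y \<longleftrightarrow> x = y" for x y using g(2) by metis
  then have const: "(\<forall>c'. \<forall>x\<in>cell (rotate_mesh \<phi> v) c'. w' c' x = f (domain_mean \<Omega> v w)) \<longleftrightarrow>
      (\<forall>c'. \<forall>x\<in>cell v c'. w c' x = domain_mean \<Omega> v w)"
    by (simp add: cell_rotate_mesh w)
  have "norm (f x - f y) = norm (x - y)" for x y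
    using f(2)[of "x - y"] linear_diff[OF bounded_linear.linear[OF f(1)], of x y] by simp
  then have linf: "linf_norm ((*v) (rot \<phi>) ` \<Omega>) (rotate_mesh \<phi> v) (\<lambda>c' x. w' c' x - f (domain_mean \<Omega> v w)) =
      linf_norm \<Omega> v (\<lambda>c' x. w c' x - domain_mean \<Omega> v w)"
    by (intro linf_norm_rotate[OF \<Omega>]) (simp add: w)
  show ?thesis
    unfolding delta_def mean const linf jump_size_rotate[OF s] edge_height_rotate_mesh ..
qed

text \<open>The normal and tangential components of a rotated vector with respect to the rotated
  normal are the old ones. Both are combinations of the two components with constant coefficients,
  so that \<open>delta_rotate\<close> applies to them.\<close>

lemma delta_vec_rotate:
  fixes m :: "'c::finite \<Rightarrow> real^2 \<Rightarrow> real^2"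
  assumes v: "mesh_on v \<Omega>"
    and m: "smooth j (\<lambda>x. m c x $ 1)" "smooth j (\<lambda>x. m c x $ 2)"
    and me: "smooth j (\<lambda>x. me x $ 1)" "smooth j (\<lambda>x. me x $ 2)"
  shows "delta_vec k ((*v) (rot \<phi>) ` \<Omega>) (rotate_mesh \<phi> v) c i j
      (\<lambda>c x. rot \<phi> *v m c (rot (- \<phi>) *v x)) (\<lambda>x. rot \<phi> *v me (rot (- \<phi>) *v x)) =
    delta_vec k \<Omega> v c i j m me"
proof -
  define n where "n = outward_normal v c i"
  let ?m' = "\<lambda>c x. rot \<phi> *v m c (rot (- \<phi>) *v x)"
  have n': "outward_normal (rotate_mesh \<phi> v) c i = rot \<phi> *v n"
    using outward_normal_rotate_mesh[OF v] by (simp add: n_def)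
  have nc: "(rot \<phi> *v y) \<bullet> (rot \<phi> *v n) = n $ 1 * y $ 1 + n $ 2 * y $ 2" "y \<bullet> n = n $ 1 * y $ 1 + n $ 2 * y $ 2" for y
    by (simp_all add: inner_rot) (simp_all add: inner_vec_def sum_2)
  have tc: "- (rot \<phi> *v y) $ 1 * (rot \<phi> *v n) $ 2 + (rot \<phi> *v y) $ 2 * (rot \<phi> *v n) $ 1 = - n $ 2 * y $ 1 + n $ 1 * y $ 2"
      "- y $ 1 * n $ 2 + y $ 2 * n $ 1 = - n $ 2 * y $ 1 + n $ 1 * y $ 2" for y
  proof -
    have "- (c * a + s * b) * (- s * d + c * e) + (- s * a + c * b) * (c * d + s * e) = - e * a + d * b"
      if "s\<^sup>2 + c\<^sup>2 = 1" for a b c d e s :: real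
      using that by algebra
    from this[OF sin_cos_squared_add] show
      "- (rot \<phi> *v y) $ 1 * (rot \<phi> *v n) $ 2 + (rot \<phi> *v y) $ 2 * (rot \<phi> *v n) $ 1 = - n $ 2 * y $ 1 + n $ 1 * y $ 2"
      unfolding rot_mult_nth .
  qed simp
  have *: "delta k ((*v) (rot \<phi>) ` \<Omega>) (rotate_mesh \<phi> v) c i j ?m'
      (\<lambda>x. a * m c (rot (- \<phi>) *v x) $ 1 + b * m c (rot (- \<phi>) *v x) $ 2)
      (\<lambda>x. a * me (rot (- \<phi>) *v x) $ 1 + b * me (rot (- \<phi>) *v x) $ 2) =
    delta k \<Omega> v c i j m (\<lambda>x. a * m c x $ 1 + b * m c x $ 2) (\<lambda>x. a * me x $ 1 + b * me x $ 2)" for a b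
    using smooth_lincomb[OF m, of a b] smooth_lincomb[OF me, of a b]
    by (intro delta_rotate[where f = "(*v) (rot \<phi>)" and g = "(*v) (rot (- \<phi>))"] mesh_on_domain_sets[OF v])
      (simp_all add: matrix_vector_mul_bounded_linear)
  show ?thesis
    unfolding delta_vec_def Let_def n' n_def[symmetric] nc tc * ..
qed

lemma delta_comp_rotate:
  fixes v :: "'c::finite mesh"
  assumes V: "vector_pairs (vecs S)" and v: "mesh_on v \<Omega>"
    and u: "\<And>r. smooth j (\<lambda>x. u c x $ r)" and ue: "\<And>r. smooth j (\<lambda>x. exterior_fun v B u c i x $ r)"
  shows "delta_comp S k ((*v) (rot \<phi>) ` \<Omega>) (rotate_mesh \<phi> v) (rotate_bdata (vecs S) \<phi> B)
      (\<lambda>c. rotate_field (vecs S) \<phi> (u c)) c i j = delta_comp S k \<Omega> v B u c i j" (is "?L = ?R")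
proof -
  have "?L $ r = ?R $ r" for r
  proof (cases "is_scalar (vecs S) r")
    case True
    have "rotate_field (vecs S) \<phi> w x $ r = w (rot (- \<phi>) *v x) $ r" for w x
      using True by (simp add: rotate_field_def comp_rot_mult_scalar)
    then show ?thesis
      using True delta_rotate[OF mesh_on_domain_sets[OF v], where f = "\<lambda>x. x" and g = "\<lambda>x. x" and w = "\<lambda>c x. u c x $ r"
          and w' = "\<lambda>c x. u c (rot (- \<phi>) *v x) $ r", OF _ _ _ _ _ u ue]
      by (simp add: delta_comp_def exterior_fun_rotate[OF V])
  next
    case False
    define p where "p = pair_of (vecs S) r"
    have "p \<in> vecs S"
      using V
      by (cases "vecs S" r rule: vector_pairs_cases) (use False pair_of_eq[OF V] in \<open>auto simp: p_def\<close>)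
    then have "vec_part p (rotate_field (vecs S) \<phi> w) = (\<lambda>x. rot \<phi> *v vec_part p w (rot (- \<phi>) *v x))" for w
      unfolding rotate_field_def using vec_part_comp_rot[OF V, of p \<phi> "\<lambda>x. w (rot (- \<phi>) *v x)"]
      by (simp add: fun_eq_iff vec_part_def)
    moreover have "smooth j (\<lambda>x. vec_part p (u c) x $ l)" "smooth j (\<lambda>x. vec_part p (exterior_fun v B u c i) x $ l)" for l
      using exhaust_2[of l] u ue by (auto simp: vec_part_def)
    ultimately show ?thesis
      using False delta_vec_rotate[OF v, where m = "\<lambda>c. vec_part p (u c)" and me = "vec_part p (exterior_fun v B u c i)"]
      by (simp add: delta_comp_def exterior_fun_rotate[OF V] flip: p_def)
  qed
  then show ?thesis by (simp add: vec_eq_iff)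
qed

lemma delta_comp_pair:
  assumes "vector_pairs (vecs S)" "(i, j) \<in> vecs S"
  shows "delta_comp S k \<Omega> v B u c e l $ i = delta_comp S k \<Omega> v B u c e l $ j"
proof -
  have "\<not> is_scalar (vecs S) i" "\<not> is_scalar (vecs S) j"
    using assms(2) by (force simp: is_scalar_def)+
  then show ?thesis
    using pair_of_eq[OF assms] by (simp add: delta_comp_def)
qed

lemma beta_eq_Max_image:
  "beta S v B u c i = Max ((\<lambda>(w, l). wave_speed S (w (v c l)) (outward_normal v c i)) `
      ({u c, exterior_fun v B u c i} \<times> {i + 1, i + 2}))"
  unfolding beta_def by (rule arg_cong[where f = Max]) auto

lemma beta_rotate:
  assumes hyp: "hyperbolic S" and V: "vector_pairs (vecs S)" and ri: "rotation_invariant_system S" and v: "mesh_on v \<Omega>"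
  shows "beta S (rotate_mesh \<phi> v) (rotate_bdata (vecs S) \<phi> B) (\<lambda>c. rotate_field (vecs S) \<phi> (u c)) c i = beta S v B u c i"
proof -
  have rm: "rotate_mesh \<phi> v c l = rot \<phi> *v v c l" for l
    by (simp add: rotate_mesh_def)
  have "wave_speed S (rotate_field (vecs S) \<phi> w (rotate_mesh \<phi> v c l)) (outward_normal (rotate_mesh \<phi> v) c i) =
      wave_speed S (w (v c l)) (outward_normal v c i)" for w l
    by (simp add: outward_normal_rotate_mesh[OF v] rm wave_speed_comp_rot[OF hyp V ri])
  then show ?thesis by (simp add: beta_eq_Max_image exterior_fun_rotate[OF V])
qed

lemma dg_space_smooth:
  "u \<in> dg_space k \<Longrightarrow> smooth j (\<lambda>x. u c x $ r)"
  by (auto simp: dg_space_def intro!: smooth_real_polynomial_function poly2_real_polynomial_function)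

lemma exterior_fun_smooth:
  assumes "u \<in> dg_space k" "smooth_bdata k B"
  shows "smooth k (\<lambda>x. exterior_fun v B u c i x $ r)"
proof (cases "\<exists>c'. neighbour v c i c'")
  case True
  then show ?thesis using dg_space_smooth[OF assms(1)] by (simp add: exterior_fun_def)
next
  case False
  moreover have "smooth k (B u c i)"
    using assms by (simp add: smooth_bdata_def)
  ultimately show ?thesis
    using smooth_bounded_linear[OF bounded_linear_vec_nth, of k "B u c i" r] by (simp add: exterior_fun_def)
qed

lemma sigma_rotate:
  assumes hyp: "hyperbolic S" and V: "vector_pairs (vecs S)" and ri: "rotation_invariant_system S" and v: "mesh_on v \<Omega>"
    and u: "u \<in> dg_space k" and B: "smooth_bdata k B" and j: "j \<le> k"
  shows "sigma S k ((*v) (rot \<phi>) ` \<Omega>) (rotate_mesh \<phi> v) (rotate_bdata (vecs S) \<phi> B)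
      (\<lambda>c. rotate_field (vecs S) \<phi> (u c)) c j = sigma S k \<Omega> v B u c j"
  unfolding sigma_def beta_rotate[OF hyp V ri v] edge_height_rotate_mesh
  using delta_comp_rotate[OF V v dg_space_smooth[OF u] smooth_mono[OF exterior_fun_smooth[OF u B] j]] by simp

section \<open>Rotation invariance of the damping procedure\<close>

text \<open>This is the reason for using one and the same damping coefficient for both components of
  a vector quantity.\<close>

lemma comp_rot_mult_componentwise:
  assumes V: "vector_pairs V" and a: "\<And>i j. (i, j) \<in> V \<Longrightarrow> a $ i = a $ j"
  shows "comp_rot V \<phi> *v (a * w) = a * (comp_rot V \<phi> *v w)"
proof -
  have "(comp_rot V \<phi> *v (a * w)) $ i = (a * (comp_rot V \<phi> *v w)) $ i" for i
  proof (cases V i rule: vector_pairs_cases)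
    case scalar
    then show ?thesis by (simp add: comp_rot_mult_scalar)
  next
    case (first j)
    show ?thesis using a[OF first] by (simp add: comp_rot_mult_fst[OF V first] algebra_simps)
  next
    case (second j)
    show ?thesis using a[OF second] by (simp add: comp_rot_mult_snd[OF V second] algebra_simps)
  qed
  then show ?thesis by (simp add: vec_eq_iff)
qed

lemma dg_space_poly_integrable:
  "u \<in> dg_space k \<Longrightarrow> compact K \<Longrightarrow> poly_integrable K (\<lambda>x. u c x $ i)"
  by (auto simp: dg_space_def intro: poly_integrable_poly2)

lemma rioe_rotate:
  assumes hyp: "hyperbolic S" and V: "vector_pairs (vecs S)" and ri: "rotation_invariant_system S" and v: "mesh_on v \<Omega>"
    and u: "u \<in> dg_space k" and B: "smooth_bdata k B"
  shows "rioe S k ((*v) (rot \<phi>) ` \<Omega>) (rotate_mesh \<phi> v) (rotate_bdata (vecs S) \<phi> B) dt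
      (\<lambda>c. rotate_field (vecs S) \<phi> (u c)) c = rotate_field (vecs S) \<phi> (rioe S k \<Omega> v B dt u c)"
proof
  fix x
  let ?T = "comp_rot (vecs S) \<phi>" and ?y = "rot (- \<phi>) *v x"
  define E where "E m = (\<chi> r. exp (- dt * (\<Sum>j\<le>m. sigma S k \<Omega> v B u c j) $ r))" for m
  have E: "E m $ i = E m $ j" if "(i, j) \<in> vecs S" for m i j
    by (simp add: E_def sigma_def delta_comp_pair[OF V that])
  have E': "(\<chi> r. exp (- dt * (\<Sum>j\<le>m. sigma S k ((*v) (rot \<phi>) ` \<Omega>) (rotate_mesh \<phi> v) (rotate_bdata (vecs S) \<phi> B)
      (\<lambda>c. rotate_field (vecs S) \<phi> (u c)) c j) $ r)) = E m" if "m \<in> {1..k}" for m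
  proof -
    have "(\<Sum>j\<le>m. sigma S k ((*v) (rot \<phi>) ` \<Omega>) (rotate_mesh \<phi> v) (rotate_bdata (vecs S) \<phi> B)
        (\<lambda>c. rotate_field (vecs S) \<phi> (u c)) c j) = (\<Sum>j\<le>m. sigma S k \<Omega> v B u c j)"
      using that by (intro sum.cong sigma_rotate[OF hyp V ri v u B]) auto
    then show ?thesis by (simp only: E_def)
  qed
  define p where "p m = l2_proj_vec m (cell v c) (u c) ?y" for m
  have p: "l2_proj_vec m (cell (rotate_mesh \<phi> v) c) (rotate_field (vecs S) \<phi> (u c)) x = ?T *v p m" for m
    unfolding cell_rotate_mesh
    using l2_proj_vec_rotate_field[OF V mesh_on_cell(1,2)[OF v] dg_space_poly_integrable[OF u mesh_on_cell(1)[OF v]]]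
    by (simp add: rotate_field_def p_def)
  have "rioe S k ((*v) (rot \<phi>) ` \<Omega>) (rotate_mesh \<phi> v) (rotate_bdata (vecs S) \<phi> B) dt
      (\<lambda>c. rotate_field (vecs S) \<phi> (u c)) c x = ?T *v p 0 + (\<Sum>m = 1..k. E m * (?T *v p m - ?T *v p (m - 1)))"
    unfolding rioe_def p
    by (intro arg_cong2[where f = "(+)"] arg_cong2[where f = "(*)"] refl sum.cong E')
  also have "\<dots> = ?T *v (p 0 + (\<Sum>m = 1..k. E m * (p m - p (m - 1))))"
    by (simp add: matrix_vector_right_distrib linear_sum[OF matrix_vector_mul_linear] comp_rot_mult_componentwise[OF V E]
        flip: matrix_vector_mult_diff_distrib)
  also have "\<dots> = rotate_field (vecs S) \<phi> (rioe S k \<Omega> v B dt u c) x"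
    by (simp add: rotate_field_def rioe_def E_def p_def)
  finally show "rioe S k ((*v) (rot \<phi>) ` \<Omega>) (rotate_mesh \<phi> v) (rotate_bdata (vecs S) \<phi> B) dt
      (\<lambda>c. rotate_field (vecs S) \<phi> (u c)) c x = rotate_field (vecs S) \<phi> (rioe S k \<Omega> v B dt u c) x" .
qed

lemma rioe_dg_space:
  assumes v: "mesh_on v \<Omega>" and u: "u \<in> dg_space k"
  shows "rioe S k \<Omega> v B dt u \<in> dg_space k"
proof -
  have p: "(\<lambda>x. l2_proj_vec m (cell v c) (u c) x $ i) \<in> poly2 k" if "m \<le> k" for m c i
    using that poly2_mono l2_proj_vec_component[OF mesh_on_cell(1,2)[OF v] dg_space_poly_integrable[OF u mesh_on_cell(1)[OF v]]]
    by blast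
  show ?thesis
    unfolding dg_space_def rioe_def
    by (auto intro!: p poly2_add poly2_sum poly2_cmult poly2_diff)
qed

lemma rotate_field_dg_space:
  assumes V: "vector_pairs V" and u: "u \<in> dg_space k"
  shows "(\<lambda>c. rotate_field V \<phi> (u c)) \<in> dg_space k"
proof -
  have p: "(\<lambda>x. u c (rot (- \<phi>) *v x) $ i) \<in> poly2 k" for c i
    using u poly2_rot[of "\<lambda>x. u c x $ i" k "- \<phi>"] by (simp add: dg_space_def)
  have "(\<lambda>x. rotate_field V \<phi> (u c) x $ i) \<in> poly2 k" for c i
    by (rule rotate_field_component[OF V, of i \<phi>]) (use p in \<open>simp_all add: poly2_add poly2_cmult\<close>)
  then show ?thesis by (simp add: dg_space_def)
qed

text \<open>Cells have interior points, so the polynomials are determined by their values on the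
  cells.\<close>

lemma rotation_related_imp_eq:
  assumes V: "vector_pairs V" and v: "mesh_on v \<Omega>" and u: "u \<in> dg_space k" "u' \<in> dg_space k"
    and rel: "rotation_related V \<phi> v u u'"
  shows "u' = (\<lambda>c. rotate_field V \<phi> (u c))"
proof -
  have "(\<lambda>x. u' c x $ i) = (\<lambda>x. rotate_field V \<phi> (u c) x $ i)" for c i
  proof (rule poly2_eqI)
    show "(\<lambda>x. u' c x $ i) \<in> poly2 k" "(\<lambda>x. rotate_field V \<phi> (u c) x $ i) \<in> poly2 k"
      using u(2) rotate_field_dg_space[OF V u(1)] by (simp_all add: dg_space_def)
    show "interior (cell (rotate_mesh \<phi> v) c) \<noteq> {}"
      using mesh_on_cell(2)[OF mesh_on_rotate[OF v]] .
    show "u' c x $ i = rotate_field V \<phi> (u c) x $ i" if "x \<in> cell (rotate_mesh \<phi> v) c" for x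
      using rel that by (auto simp: rotation_related_def cell_rotate_mesh)
  qed
  then show ?thesis by (simp add: fun_eq_iff vec_eq_iff)
qed

lemma rotation_related_rotate_field: "rotation_related V \<phi> v u (\<lambda>c. rotate_field V \<phi> (u c))"
  by (simp add: rotation_related_def)

section \<open>Rotation invariance of the semi-discrete scheme\<close>

lemma cell_point_rotate_mesh [simp]: "cell_point (rotate_mesh \<phi> v) c b = rot \<phi> *v cell_point v c b"
  by (simp add: cell_point_def rotate_mesh_def linear_sum[OF linear_rot] matrix_vector_mult_scaleR)

lemma cell_integral_rotate_mesh:
  assumes "mesh_on v \<Omega>"
  shows "cell_integral Q (rotate_mesh \<phi> v) c g = cell_integral Q v c (\<lambda>x. g (rot \<phi> *v x))"
  using mesh_on_cell(3)[OF assms]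
  by (cases Q) (simp_all add: cell_rotate_mesh integral_rot measure_rot_image)

lemma cell_integrable_rotate_mesh:
  assumes "mesh_on v \<Omega>"
  shows "cell_integrable Q (rotate_mesh \<phi> v) c g \<longleftrightarrow> cell_integrable Q v c (\<lambda>x. g (rot \<phi> *v x))"
  using mesh_on_cell(3)[OF assms]
  by (cases Q) (simp_all add: cell_rotate_mesh integrable_rot)

lemma edge_integrable_rotate_mesh:
  "edge_integrable Q (rotate_mesh \<phi> v) c i g \<longleftrightarrow> edge_integrable Q v c i (\<lambda>x. g (rot \<phi> *v x))"
  by (cases Q) simp_all

lemma cell_nodes_rotate_mesh: "cell_nodes Q (rotate_mesh \<phi> v) c = (*v) (rot \<phi>) ` cell_nodes Q v c"
  by (cases Q) (force simp: cell_rotate_mesh)+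

lemma edge_nodes_rotate_mesh: "edge_nodes Q (rotate_mesh \<phi> v) c i = (*v) (rot \<phi>) ` edge_nodes Q v c i"
  by (cases Q) (force simp: edge_rotate_mesh)+

lemma edge_point_in_edge: "0 \<le> s \<Longrightarrow> s \<le> 1 \<Longrightarrow> edge_point v c i s \<in> edge v c i"
  by (auto simp: edge_point_def edge_def closed_segment_def)

lemma cell_integral_cong:
  "(\<And>x. x \<in> cell_nodes Q v c \<Longrightarrow> f x = g x) \<Longrightarrow> cell_integral Q v c f = cell_integral Q v c g"
proof (cases Q)
  case (Nodes qs)
  assume "\<And>x. x \<in> cell_nodes Q v c \<Longrightarrow> f x = g x"
  then have "map (\<lambda>(b, w). w *\<^sub>R f (cell_point v c b)) qs = map (\<lambda>(b, w). w *\<^sub>R g (cell_point v c b)) qs"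
    using Nodes by (intro map_cong) force+
  then show ?thesis using Nodes by (simp only: cell_integral.simps)
qed (auto intro!: Bochner_Integration.integral_cong)

lemma cell_integrable_cong:
  "(\<And>x. x \<in> cell_nodes Q v c \<Longrightarrow> f x = g x) \<Longrightarrow> cell_integrable Q v c f = cell_integrable Q v c g"
  by (cases Q) (auto intro!: Bochner_Integration.integrable_cong)

lemma edge_integral_cong:
  "(\<And>x. x \<in> edge_nodes Q v c i \<Longrightarrow> f x = g x) \<Longrightarrow> edge_integral Q v c i f = edge_integral Q v c i g"
proof (cases Q)
  case Exact
  assume "\<And>x. x \<in> edge_nodes Q v c i \<Longrightarrow> f x = g x"
  then have "(LINT s|lebesgue_on {0..1}. f (edge_point v c i s)) = (LINT s|lebesgue_on {0..1}. g (edge_point v c i s))"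
    using Exact by (intro Bochner_Integration.integral_cong) (auto simp: edge_point_in_edge)
  then show ?thesis using Exact by simp
next
  case (Nodes qs)
  assume "\<And>x. x \<in> edge_nodes Q v c i \<Longrightarrow> f x = g x"
  then have "map (\<lambda>(s, w). w *\<^sub>R f (edge_point v c i s)) qs = map (\<lambda>(s, w). w *\<^sub>R g (edge_point v c i s)) qs"
    using Nodes by (intro map_cong) force+
  then show ?thesis using Nodes by (simp only: edge_integral.simps)
qed

lemma edge_integrable_cong:
  "(\<And>x. x \<in> edge_nodes Q v c i \<Longrightarrow> f x = g x) \<Longrightarrow> edge_integrable Q v c i f = edge_integrable Q v c i g"
  by (cases Q) (auto intro!: Bochner_Integration.integrable_cong simp: edge_point_in_edge)

lemma sum_list_bounded_linear:
  assumes "bounded_linear f"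
  shows "(\<Sum>(x, w)\<leftarrow>qs. w *\<^sub>R f (h x)) = f (\<Sum>(x, w)\<leftarrow>qs. w *\<^sub>R h x)"
  using assms by (induction qs) (auto simp: linear_simps)

lemma cell_integral_linear_iso:
  assumes f: "bounded_linear f" and g: "bounded_linear g" "\<And>x. g (f x) = x"
  shows "cell_integral Q v c (\<lambda>x. f (h x)) = f (cell_integral Q v c h)"
proof (cases Q)
  case Exact
  have "(LINT x|lebesgue_on (cell v c). f (h x)) = f (LINT x|lebesgue_on (cell v c). h x)"
    by (rule integral_bounded_linear'[OF f g(1)]) (use g in auto)
  then show ?thesis using Exact by simp
qed (simp add: sum_list_bounded_linear[OF f] linear_simps[OF f])

lemma edge_integral_linear_iso:
  assumes f: "bounded_linear f" and g: "bounded_linear g" "\<And>x. g (f x) = x"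
  shows "edge_integral Q v c i (\<lambda>x. f (h x)) = f (edge_integral Q v c i h)"
proof (cases Q)
  case Exact
  have "(LINT s|lebesgue_on {0..1}. f (h (edge_point v c i s))) = f (LINT s|lebesgue_on {0..1}. h (edge_point v c i s))"
    by (rule integral_bounded_linear'[OF f g(1)]) (use g in auto)
  then show ?thesis using Exact f by (simp add: linear_simps)
qed (simp add: sum_list_bounded_linear[OF f] linear_simps[OF f])

lemma cell_integrable_bounded_linear:
  "bounded_linear f \<Longrightarrow> cell_integrable Q v c h \<Longrightarrow> cell_integrable Q v c (\<lambda>x. f (h x))"
  by (cases Q) (auto intro: integrable_bounded_linear)

lemma edge_integrable_bounded_linear:
  "bounded_linear f \<Longrightarrow> edge_integrable Q v c i h \<Longrightarrow> edge_integrable Q v c i (\<lambda>x. f (h x))"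
  by (cases Q) (auto intro: integrable_bounded_linear)

lemma cell_integrable_add:
  "cell_integrable Q v c f \<Longrightarrow> cell_integrable Q v c g \<Longrightarrow> cell_integrable Q v c (\<lambda>x. f x + g x)"
  by (cases Q) auto

lemma cell_integral_add:
  assumes "cell_integrable Q v c f" "cell_integrable Q v c g"
  shows "cell_integral Q v c (\<lambda>x. f x + g x) = cell_integral Q v c f + cell_integral Q v c g"
proof (cases Q)
  case (Nodes qs)
  have "(\<Sum>(b, w)\<leftarrow>qs. w *\<^sub>R (f (cell_point v c b) + g (cell_point v c b))) =
    (\<Sum>(b, w)\<leftarrow>qs. w *\<^sub>R f (cell_point v c b)) + (\<Sum>(b, w)\<leftarrow>qs. w *\<^sub>R g (cell_point v c b))"
    by (induction qs) (auto simp: algebra_simps)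
  then show ?thesis using Nodes by (simp add: algebra_simps)
qed (use assms in simp)

lemma cell_integral_nth:
  fixes f :: "real^2 \<Rightarrow> real^'d::finite"
  assumes "cell_integrable Q v c f"
  shows "cell_integral Q v c f $ i = cell_integral Q v c (\<lambda>x. f x $ i)"
proof (cases Q)
  case Exact
  then show ?thesis
    using assms by (simp add: integral_bounded_linear[OF bounded_linear_vec_nth])
next
  case (Nodes qs)
  have "(\<Sum>(b, w)\<leftarrow>qs. w *\<^sub>R (f (cell_point v c b) $ i)) = (\<Sum>(b, w)\<leftarrow>qs. w *\<^sub>R f (cell_point v c b)) $ i"
    by (rule sum_list_bounded_linear[OF bounded_linear_vec_nth])
  then show ?thesis using Nodes by simp
qed

lemma edge_integral_nth:
  fixes f :: "real^2 \<Rightarrow> real^'d::finite"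
  assumes "edge_integrable Q v c i f"
  shows "edge_integral Q v c i f $ l = edge_integral Q v c i (\<lambda>x. f x $ l)"
proof (cases Q)
  case Exact
  then show ?thesis
    using assms by (simp add: integral_bounded_linear[OF bounded_linear_vec_nth])
next
  case (Nodes qs)
  have "(\<Sum>(s, w)\<leftarrow>qs. w *\<^sub>R (f (edge_point v c i s) $ l)) = (\<Sum>(s, w)\<leftarrow>qs. w *\<^sub>R f (edge_point v c i s)) $ l"
    by (rule sum_list_bounded_linear[OF bounded_linear_vec_nth])
  then show ?thesis using Nodes by simp
qed

lemma cell_integrable_mult:
  fixes f q :: "real^2 \<Rightarrow> real^'d::finite"
  assumes v: "mesh_on v \<Omega>" and f: "cell_integrable Q v c f" and q: "\<And>l. continuous_on UNIV (\<lambda>x. q x $ l)"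
  shows "cell_integrable Q v c (\<lambda>x. f x * q x)"
proof (cases Q)
  case Exact
  have "integrable (lebesgue_on (cell v c)) (\<lambda>x. f x $ l)" for l
    using f Exact integrable_bounded_linear[OF bounded_linear_vec_nth] by simp
  then have "integrable (lebesgue_on (cell v c)) (\<lambda>x. q x $ l *\<^sub>R f x $ l)" for l
    using mesh_on_cell(1)[OF v] q by (rule integrable_continuous_scaleR)
  then show ?thesis
    using Exact by (simp add: integrable_iff_component[OF mesh_on_cell(3)[OF v]] mult.commute)
qed simp

lemma edge_integrable_mult:
  fixes f q :: "real^2 \<Rightarrow> real^'d::finite"
  assumes f: "edge_integrable Q v c i f" and q: "\<And>l. continuous_on UNIV (\<lambda>x. q x $ l)"
  shows "edge_integrable Q v c i (\<lambda>x. f x * q x)"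
proof (cases Q)
  case Exact
  have "continuous_on UNIV (\<lambda>s. q (edge_point v c i s) $ l)" for l
    by (rule continuous_on_compose2[OF q]) (auto simp: edge_point_def intro!: continuous_intros)
  moreover have "integrable (lebesgue_on {0..1}) (\<lambda>s. f (edge_point v c i s) $ l)" for l
    using f Exact integrable_bounded_linear[OF bounded_linear_vec_nth] by simp
  ultimately have "integrable (lebesgue_on {0..1}) (\<lambda>s. q (edge_point v c i s) $ l *\<^sub>R f (edge_point v c i s) $ l)" for l
    by (intro integrable_continuous_scaleR) auto
  then show ?thesis
    using Exact by (simp add: integrable_iff_component mult.commute)
qed simp

lemma cell_integrable_dg_space:
  fixes v :: "'c::finite mesh" and r :: "'c \<Rightarrow> real^2 \<Rightarrow> real^'d::finite"
  assumes v: "mesh_on v \<Omega>" and r: "r \<in> dg_space k"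
  shows "cell_integrable Q v c (r c)"
proof (cases Q)
  case Exact
  have "integrable (lebesgue_on (cell v c)) (\<lambda>x. r c x $ l)" for l
    using r mesh_on_cell(1)[OF v] by (intro integrable_compact_continuous) (auto simp: dg_space_def intro: poly2_continuous_on)
  then show ?thesis using Exact by (simp add: integrable_iff_component[OF mesh_on_cell(3)[OF v]])
qed simp

text \<open>Since vectors are multiplied componentwise, the vector-valued test functions of the scheme amount
  to scalar ones, and a scalar test function commutes with the mixing of components by a rotation.\<close>

definition weak_derivative :: "('d::finite) system \<Rightarrow> ('c, 'd) oedg_method \<Rightarrow> 'c mesh \<Rightarrow> ('c, 'd) bdata \<Rightarrow>
    ('c \<Rightarrow> real^2 \<Rightarrow> real^'d) \<Rightarrow> ('c \<Rightarrow> real^2 \<Rightarrow> real^'d) \<Rightarrow> (real^2 \<Rightarrow> real) \<Rightarrow> 'c \<Rightarrow> bool" where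
  "weak_derivative S M v B u r p c \<longleftrightarrow>
     cell_integral (mass_rule M) v c (\<lambda>x. p x *\<^sub>R r c x) =
     cell_integral (volume_rule M) v c (\<lambda>x. partial 1 p x *\<^sub>R flux1 S (u c x) + partial 2 p x *\<^sub>R flux2 S (u c x))
     - (\<Sum>i\<in>UNIV. edge_integral (edge_rule M) v c i
          (\<lambda>x. p x *\<^sub>R numflux M (u c x) (exterior_fun v B u c i x) (outward_normal v c i)))"

definition dg_admissible :: "('d::finite) system \<Rightarrow> ('c, 'd) oedg_method \<Rightarrow> 'c mesh \<Rightarrow> ('c, 'd) bdata \<Rightarrow>
    ('c \<Rightarrow> real^2 \<Rightarrow> real^'d) \<Rightarrow> bool" where
  "dg_admissible S M v B u \<longleftrightarrow>
     (\<forall>c. (\<forall>x\<in>cell_nodes (volume_rule M) v c. u c x \<in> states S) \<and>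
        cell_integrable (volume_rule M) v c (\<lambda>x. flux1 S (u c x)) \<and>
        cell_integrable (volume_rule M) v c (\<lambda>x. flux2 S (u c x))) \<and>
     (\<forall>c i. (\<forall>x\<in>edge_nodes (edge_rule M) v c i.
          u c x \<in> states S \<and> exterior_fun v B u c i x \<in> states S) \<and>
        edge_integrable (edge_rule M) v c i
          (\<lambda>x. numflux M (u c x) (exterior_fun v B u c i x) (outward_normal v c i)))"

lemma partial_nth:
  fixes q :: "real^2 \<Rightarrow> real^'d::finite"
  assumes "\<And>l. (\<lambda>x. q x $ l) \<in> poly2 k"
  shows "partial a q x $ l = partial a (\<lambda>x. q x $ l) x"
proof -
  have "real_polynomial_function (\<lambda>x. inner (q x) b)" if "b \<in> Basis" for b :: "real^'d"
    using that poly2_real_polynomial_function[OF assms] by (auto simp: Basis_vec_def inner_axis)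
  then have "q differentiable (at x)"
    by (intro differentiable_at_polynomial_function) (simp add: polynomial_function_iff_Basis_inner)
  then show ?thesis
    using partial_bounded_linear[OF bounded_linear_vec_nth, of q x a l] by simp
qed

lemma partial_poly2_continuous_on:
  "p \<in> poly2 k \<Longrightarrow> continuous_on A (partial a p)"
  by (intro continuous_at_imp_continuous_on ballI continuous_real_polymonial_function
      real_polynomial_function_partial poly2_real_polynomial_function)

text \<open>The \<open>l\<close>-th component of the scheme involves only the \<open>l\<close>-th
  component of the test function. The integrability conditions enter here: without them a component
  of a vector-valued integral need not be the integral of the component.\<close>

lemma scheme_components:
  fixes S :: "('d::finite) system" and M :: "('c::finite, 'd) oedg_method"
  assumes v: "mesh_on v \<Omega>" and adm: "dg_admissible S M v B u" and r: "r \<in> dg_space k"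
    and q: "\<And>l. (\<lambda>x. q x $ l) \<in> poly2 k"
  shows "cell_integral (mass_rule M) v c (\<lambda>x. r c x * q x) $ l =
      cell_integral (mass_rule M) v c (\<lambda>x. r c x $ l * q x $ l)" (is ?mass)
    and "(cell_integral (volume_rule M) v c (\<lambda>x. flux1 S (u c x) * partial 1 q x + flux2 S (u c x) * partial 2 q x)
        - (\<Sum>i\<in>UNIV. edge_integral (edge_rule M) v c i
             (\<lambda>x. numflux M (u c x) (exterior_fun v B u c i x) (outward_normal v c i) * q x))) $ l =
      cell_integral (volume_rule M) v c (\<lambda>x. flux1 S (u c x) $ l * partial 1 (\<lambda>x. q x $ l) x
          + flux2 S (u c x) $ l * partial 2 (\<lambda>x. q x $ l) x)
        - (\<Sum>i\<in>UNIV. edge_integral (edge_rule M) v c i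
             (\<lambda>x. numflux M (u c x) (exterior_fun v B u c i x) (outward_normal v c i) $ l * q x $ l))" (is ?flux)
proof -
  have cq: "continuous_on UNIV (\<lambda>x. q x $ l)" for l using q by (rule poly2_continuous_on)
  have cp: "continuous_on UNIV (\<lambda>x. partial a q x $ l)" for a l
    using partial_nth[OF q] partial_poly2_continuous_on[OF q] by simp
  have "cell_integrable (mass_rule M) v c (\<lambda>x. r c x * q x)"
    using v cell_integrable_dg_space[OF v r] cq by (rule cell_integrable_mult)
  then show ?mass by (simp add: cell_integral_nth)
  have "cell_integrable (volume_rule M) v c (\<lambda>x. flux1 S (u c x) * partial 1 q x)"
    "cell_integrable (volume_rule M) v c (\<lambda>x. flux2 S (u c x) * partial 2 q x)"
    using adm unfolding dg_admissible_def by (intro cell_integrable_mult[OF v _ cp]; simp)+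
  note vol = cell_integral_nth[OF cell_integrable_add[OF this], of l]
  have "edge_integrable (edge_rule M) v c i
      (\<lambda>x. numflux M (u c x) (exterior_fun v B u c i x) (outward_normal v c i) * q x)" for i
    using adm unfolding dg_admissible_def by (intro edge_integrable_mult[OF _ cq]) simp
  then show ?flux
    using vol by (simp add: partial_nth[OF q] edge_integral_nth)
qed

lemma dg_derivative_iff_weak:
  fixes S :: "('d::finite) system" and M :: "('c::finite, 'd) oedg_method"
  assumes v: "mesh_on v \<Omega>"
  shows "dg_derivative S M v B u r \<longleftrightarrow> r \<in> dg_space (deg M) \<and> dg_admissible S M v B u \<and>
    (\<forall>p\<in>poly2 (deg M). \<forall>c. weak_derivative S M v B u r p c)"
proof -
  define V where "V q c \<longleftrightarrow> cell_integral (mass_rule M) v c (\<lambda>x. r c x * q x) =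
        cell_integral (volume_rule M) v c (\<lambda>x. flux1 S (u c x) * partial 1 q x + flux2 S (u c x) * partial 2 q x)
        - (\<Sum>i\<in>UNIV. edge_integral (edge_rule M) v c i
             (\<lambda>x. numflux M (u c x) (exterior_fun v B u c i x) (outward_normal v c i) * q x))" for q c
  have const: "V (\<lambda>x. \<chi> l. p x) c \<longleftrightarrow> weak_derivative S M v B u r p c" if p: "p \<in> poly2 (deg M)" for p c
  proof -
    have "w * (\<chi> l. t) = t *\<^sub>R w" for w :: "real^'d" and t
      by (simp add: vec_eq_iff)
    moreover have "partial a (\<lambda>x. \<chi> l. p x) x = (\<chi> l::'d. partial a p x)" for a x
      using partial_nth[of "\<lambda>x. \<chi> l::'d. p x" "deg M"] p by (simp add: vec_eq_iff)
    ultimately show ?thesis by (simp add: V_def weak_derivative_def)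
  qed
  have "(\<forall>q\<in>dg_space (deg M). \<forall>c. V (q c) c) \<longleftrightarrow> (\<forall>p\<in>poly2 (deg M). \<forall>c. V (\<lambda>x. \<chi> l. p x) c)"
    if r: "r \<in> dg_space (deg M)" and adm: "dg_admissible S M v B u"
  proof (intro iffI ballI allI)
    fix p c assume *: "\<forall>q\<in>dg_space (deg M). \<forall>c. V (q c) c" and "p \<in> poly2 (deg M)"
    then have "(\<lambda>c x. \<chi> l. p x) \<in> dg_space (deg M)" by (simp add: dg_space_def)
    with * show "V (\<lambda>x. \<chi> l. p x) c" by force
  next
    fix q :: "'c \<Rightarrow> real^2 \<Rightarrow> real^'d" and c
    assume *: "\<forall>p\<in>poly2 (deg M). \<forall>c. V (\<lambda>x. \<chi> l. p x) c" and "q \<in> dg_space (deg M)"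
    then have q: "(\<lambda>x. q c x $ l) \<in> poly2 (deg M)" for l by (simp add: dg_space_def)
    note comp = scheme_components[OF v adm r]
    show "V (q c) c"
      unfolding V_def vec_eq_iff
    proof
      fix l
      have "V (\<lambda>x. \<chi> l'. q c x $ l) c" using bspec[OF * q[of l]] by simp
      then show "cell_integral (mass_rule M) v c (\<lambda>x. r c x * q c x) $ l =
        (cell_integral (volume_rule M) v c (\<lambda>x. flux1 S (u c x) * partial 1 (q c) x + flux2 S (u c x) * partial 2 (q c) x)
        - (\<Sum>i\<in>UNIV. edge_integral (edge_rule M) v c i
             (\<lambda>x. numflux M (u c x) (exterior_fun v B u c i x) (outward_normal v c i) * q c x))) $ l"
        using comp[of "q c", OF q] comp[of "\<lambda>x. \<chi> l'. q c x $ l"] q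
        unfolding V_def vec_eq_iff by simp
    qed
  qed
  moreover have "dg_derivative S M v B u r \<longleftrightarrow> r \<in> dg_space (deg M) \<and> dg_admissible S M v B u \<and>
      (\<forall>q\<in>dg_space (deg M). \<forall>c. V (q c) c)"
    by (simp only: dg_derivative_def dg_admissible_def V_def conj_assoc)
  ultimately show ?thesis using const by blast
qed

lemma dg_admissible_rotate:
  fixes S :: "('d::finite) system" and M :: "('c::finite, 'd) oedg_method"
  assumes V: "vector_pairs (vecs S)" and ri: "rotation_invariant_system S"
    and F: "rotation_invariant_flux S (numflux M)" and v: "mesh_on v \<Omega>" and adm: "dg_admissible S M v B u"
  shows "dg_admissible S M (rotate_mesh \<phi> v) (rotate_bdata (vecs S) \<phi> B) (\<lambda>c. rotate_field (vecs S) \<phi> (u c))"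
    and "x \<in> edge_nodes (edge_rule M) v c i \<Longrightarrow>
      numflux M (comp_rot (vecs S) \<phi> *v u c x) (comp_rot (vecs S) \<phi> *v exterior_fun v B u c i x) (rot \<phi> *v outward_normal v c i) =
      comp_rot (vecs S) \<phi> *v numflux M (u c x) (exterior_fun v B u c i x) (outward_normal v c i)"
proof -
  let ?T = "comp_rot (vecs S) \<phi>"
  have T: "bounded_linear ((*v) ?T)" by (rule matrix_vector_mul_bounded_linear)
  have scale: "bounded_linear (\<lambda>w::real^'d. a *\<^sub>R w)" for a by (rule bounded_linear_scaleR_right)
  show flux: "numflux M (?T *v u c x) (?T *v exterior_fun v B u c i x) (rot \<phi> *v outward_normal v c i) =
      ?T *v numflux M (u c x) (exterior_fun v B u c i x) (outward_normal v c i)"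
    if "x \<in> edge_nodes (edge_rule M) v c i" for x c i
    using F adm that outward_normal_props(1)[OF v]
    by (simp add: rotation_invariant_flux_def dg_admissible_def Let_def)
  have "cell_integrable (volume_rule M) v c (\<lambda>x. ?T *v (a *\<^sub>R flux1 S (u c x) + b *\<^sub>R flux2 S (u c x)))" for a b c
    using adm unfolding dg_admissible_def
    by (intro cell_integrable_bounded_linear[OF T] cell_integrable_add cell_integrable_bounded_linear[OF scale]) auto
  moreover have "cell_integrable (volume_rule M) v c (\<lambda>x. flux1 S (?T *v u c x)) \<longleftrightarrow>
      cell_integrable (volume_rule M) v c (\<lambda>x. ?T *v (cos \<phi> *\<^sub>R flux1 S (u c x) + sin \<phi> *\<^sub>R flux2 S (u c x)))"
    "cell_integrable (volume_rule M) v c (\<lambda>x. flux2 S (?T *v u c x)) \<longleftrightarrow>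
      cell_integrable (volume_rule M) v c (\<lambda>x. ?T *v ((- sin \<phi>) *\<^sub>R flux1 S (u c x) + cos \<phi> *\<^sub>R flux2 S (u c x)))" for c
    using adm by (intro cell_integrable_cong flux_comp_rot[OF V ri]; simp add: dg_admissible_def)+
  ultimately have "cell_integrable (volume_rule M) v c (\<lambda>x. flux1 S (?T *v u c x))"
    "cell_integrable (volume_rule M) v c (\<lambda>x. flux2 S (?T *v u c x))" for c
    by blast+
  moreover have "edge_integrable (edge_rule M) v c i (\<lambda>x. numflux M (?T *v u c x) (?T *v exterior_fun v B u c i x) (rot \<phi> *v outward_normal v c i))" for c i
  proof -
    have "edge_integrable (edge_rule M) v c i (\<lambda>x. ?T *v numflux M (u c x) (exterior_fun v B u c i x) (outward_normal v c i))"
      using adm unfolding dg_admissible_def by (intro edge_integrable_bounded_linear[OF T]) simp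
    then show ?thesis by (simp add: flux cong: edge_integrable_cong)
  qed
  ultimately show "dg_admissible S M (rotate_mesh \<phi> v) (rotate_bdata (vecs S) \<phi> B) (\<lambda>c. rotate_field (vecs S) \<phi> (u c))"
    using adm unfolding dg_admissible_def
    by (simp add: cell_nodes_rotate_mesh edge_nodes_rotate_mesh cell_integrable_rotate_mesh[OF v] edge_integrable_rotate_mesh
        exterior_fun_rotate[OF V] outward_normal_rotate_mesh[OF v] states_comp_rot_iff[OF V ri])
qed

text \<open>A test function \<open>p\<close> on the rotated mesh is compared with \<open>p \<circ> rot \<phi>\<close> on the given one: the
  rotation of the gradient of \<open>p\<close> cancels against the rotation of the pair of fluxes.\<close>

lemma weak_derivative_rotate:
  fixes S :: "('d::finite) system" and M :: "('c::finite, 'd) oedg_method"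
  assumes V: "vector_pairs (vecs S)" and ri: "rotation_invariant_system S"
    and F: "rotation_invariant_flux S (numflux M)" and v: "mesh_on v \<Omega>" and adm: "dg_admissible S M v B u"
    and p: "p \<in> poly2 k" and weak: "weak_derivative S M v B u r (\<lambda>x. p (rot \<phi> *v x)) c"
  shows "weak_derivative S M (rotate_mesh \<phi> v) (rotate_bdata (vecs S) \<phi> B)
    (\<lambda>c. rotate_field (vecs S) \<phi> (u c)) (\<lambda>c. rotate_field (vecs S) \<phi> (r c)) p c"
proof -
  let ?T = "comp_rot (vecs S) \<phi>" and ?p = "\<lambda>x. p (rot \<phi> *v x)"
  note bl = matrix_vector_mul_bounded_linear[of ?T] matrix_vector_mul_bounded_linear[of "comp_rot (vecs S) (- \<phi>)"]
    comp_rot_minus_cancel[OF V]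
  have "cell_integral (mass_rule M) (rotate_mesh \<phi> v) c (\<lambda>x. p x *\<^sub>R rotate_field (vecs S) \<phi> (r c) x) =
      cell_integral (mass_rule M) v c (\<lambda>x. ?T *v (?p x *\<^sub>R r c x))"
    by (simp add: cell_integral_rotate_mesh[OF v] matrix_vector_mult_scaleR)
  also have "\<dots> = ?T *v cell_integral (mass_rule M) v c (\<lambda>x. ?p x *\<^sub>R r c x)"
    by (rule cell_integral_linear_iso[OF bl])
  finally have mass: "cell_integral (mass_rule M) (rotate_mesh \<phi> v) c (\<lambda>x. p x *\<^sub>R rotate_field (vecs S) \<phi> (r c) x) =
      ?T *v cell_integral (mass_rule M) v c (\<lambda>x. ?p x *\<^sub>R r c x)" .
  have d: "p differentiable (at x)" for x
    using p by (intro real_polynomial_function_partial(1) poly2_real_polynomial_function)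
  have vol_pt: "partial 1 p (rot \<phi> *v x) *\<^sub>R flux1 S (?T *v u c x) + partial 2 p (rot \<phi> *v x) *\<^sub>R flux2 S (?T *v u c x) =
      ?T *v (partial 1 ?p x *\<^sub>R flux1 S (u c x) + partial 2 ?p x *\<^sub>R flux2 S (u c x))"
    if "x \<in> cell_nodes (volume_rule M) v c" for x
  proof -
    have "u c x \<in> states S" using adm that by (simp add: dg_admissible_def)
    show ?thesis
      unfolding flux_comp_rot[OF V ri \<open>u c x \<in> states S\<close>] partial_rot[OF d]
      by (simp add: vec_eq_iff matrix_vector_right_distrib matrix_vector_mult_scaleR algebra_simps)
  qed
  have "cell_integral (volume_rule M) (rotate_mesh \<phi> v) c (\<lambda>x. partial 1 p x *\<^sub>R flux1 S (rotate_field (vecs S) \<phi> (u c) x)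
        + partial 2 p x *\<^sub>R flux2 S (rotate_field (vecs S) \<phi> (u c) x)) =
      cell_integral (volume_rule M) v c (\<lambda>x. ?T *v (partial 1 ?p x *\<^sub>R flux1 S (u c x) + partial 2 ?p x *\<^sub>R flux2 S (u c x)))"
    unfolding cell_integral_rotate_mesh[OF v] rotate_field_rot by (rule cell_integral_cong) (rule vol_pt)
  also have "\<dots> = ?T *v cell_integral (volume_rule M) v c (\<lambda>x. partial 1 ?p x *\<^sub>R flux1 S (u c x) + partial 2 ?p x *\<^sub>R flux2 S (u c x))"
    by (rule cell_integral_linear_iso[OF bl])
  finally have vol: "cell_integral (volume_rule M) (rotate_mesh \<phi> v) c (\<lambda>x. partial 1 p x *\<^sub>R flux1 S (rotate_field (vecs S) \<phi> (u c) x)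
        + partial 2 p x *\<^sub>R flux2 S (rotate_field (vecs S) \<phi> (u c) x)) =
      ?T *v cell_integral (volume_rule M) v c (\<lambda>x. partial 1 ?p x *\<^sub>R flux1 S (u c x) + partial 2 ?p x *\<^sub>R flux2 S (u c x))" .
  have edge: "edge_integral (edge_rule M) (rotate_mesh \<phi> v) c i (\<lambda>x. p x *\<^sub>R numflux M (rotate_field (vecs S) \<phi> (u c) x)
        (rotate_field (vecs S) \<phi> (exterior_fun v B u c i) x) (rot \<phi> *v outward_normal v c i)) =
      ?T *v edge_integral (edge_rule M) v c i (\<lambda>x. ?p x *\<^sub>R numflux M (u c x) (exterior_fun v B u c i x) (outward_normal v c i))" for i
  proof -
    have "edge_integral (edge_rule M) (rotate_mesh \<phi> v) c i (\<lambda>x. p x *\<^sub>R numflux M (rotate_field (vecs S) \<phi> (u c) x)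
        (rotate_field (vecs S) \<phi> (exterior_fun v B u c i) x) (rot \<phi> *v outward_normal v c i)) =
      edge_integral (edge_rule M) v c i (\<lambda>x. ?T *v (?p x *\<^sub>R numflux M (u c x) (exterior_fun v B u c i x) (outward_normal v c i)))"
      unfolding edge_integral_rotate_mesh rotate_field_rot
      by (rule edge_integral_cong) (simp add: dg_admissible_rotate(2)[OF V ri F v adm] matrix_vector_mult_scaleR)
    then show ?thesis using edge_integral_linear_iso[OF bl] by metis
  qed
  show ?thesis
    using weak unfolding weak_derivative_def exterior_fun_rotate[OF V] outward_normal_rotate_mesh[OF v] mass vol edge
    by (simp add: matrix_vector_mult_diff_distrib linear_sum[OF matrix_vector_mul_linear])
qed

lemma dg_derivative_rotate:
  fixes S :: "('d::finite) system" and M :: "('c::finite, 'd) oedg_method"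
  assumes V: "vector_pairs (vecs S)" and ri: "rotation_invariant_system S"
    and F: "rotation_invariant_flux S (numflux M)" and v: "mesh_on v \<Omega>"
    and d: "dg_derivative S M v B u r"
  shows "dg_derivative S M (rotate_mesh \<phi> v) (rotate_bdata (vecs S) \<phi> B)
    (\<lambda>c. rotate_field (vecs S) \<phi> (u c)) (\<lambda>c. rotate_field (vecs S) \<phi> (r c))"
proof -
  have r: "r \<in> dg_space (deg M)" and adm: "dg_admissible S M v B u"
    and weak: "\<And>p c. p \<in> poly2 (deg M) \<Longrightarrow> weak_derivative S M v B u r p c"
    using d unfolding dg_derivative_iff_weak[OF v] by auto
  show ?thesis
    unfolding dg_derivative_iff_weak[OF mesh_on_rotate[OF v]]
  proof (intro conjI ballI allI)
    show "(\<lambda>c. rotate_field (vecs S) \<phi> (r c)) \<in> dg_space (deg M)"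
      by (rule rotate_field_dg_space[OF V r])
    show "dg_admissible S M (rotate_mesh \<phi> v) (rotate_bdata (vecs S) \<phi> B) (\<lambda>c. rotate_field (vecs S) \<phi> (u c))"
      by (rule dg_admissible_rotate(1)[OF V ri F v adm])
    fix p c assume p: "p \<in> poly2 (deg M)"
    show "weak_derivative S M (rotate_mesh \<phi> v) (rotate_bdata (vecs S) \<phi> B)
        (\<lambda>c. rotate_field (vecs S) \<phi> (u c)) (\<lambda>c. rotate_field (vecs S) \<phi> (r c)) p c"
      using p weak[OF poly2_rot[OF p]] by (rule weak_derivative_rotate[OF V ri F v adm])
  qed
qed

text \<open>The difference of two time derivatives is orthogonal, for the positive definite mass form, to
  itself.\<close>

lemma dg_derivative_unique:
  fixes S :: "('d::finite) system" and M :: "('c::finite, 'd) oedg_method"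
  assumes ok: "oedg_method_ok M v" and v: "mesh_on v \<Omega>"
    and d: "dg_derivative S M v B u r" "dg_derivative S M v B u r'"
  shows "r = r'"
proof -
  have r: "r \<in> dg_space (deg M)" "r' \<in> dg_space (deg M)"
    and eq: "\<And>p c. p \<in> poly2 (deg M) \<Longrightarrow>
      cell_integral (mass_rule M) v c (\<lambda>x. p x *\<^sub>R r c x) = cell_integral (mass_rule M) v c (\<lambda>x. p x *\<^sub>R r' c x)"
    using d unfolding dg_derivative_iff_weak[OF v] weak_derivative_def by simp_all
  have "r c x $ i = r' c x $ i" for c x i
  proof -
    define p where "p x = r c x $ i - r' c x $ i" for x
    have p: "p \<in> poly2 (deg M)"
      using r unfolding p_def dg_space_def by (intro poly2_diff) simp_all
    have int: "cell_integrable (mass_rule M) v c (\<lambda>x. p x *\<^sub>R s c x)" if "s \<in> dg_space (deg M)" for s :: "'c \<Rightarrow> real^2 \<Rightarrow> real^'d"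
    proof -
      have "cell_integrable (mass_rule M) v c (\<lambda>x. s c x * (\<chi> l. p x))"
        using poly2_continuous_on[OF p] by (intro cell_integrable_mult[OF v cell_integrable_dg_space[OF v that]]) simp
      moreover have "(\<lambda>x. s c x * (\<chi> l. p x)) = (\<lambda>x. p x *\<^sub>R s c x)" by (simp add: fun_eq_iff vec_eq_iff)
      ultimately show ?thesis by simp
    qed
    have "cell_integral (mass_rule M) v c (\<lambda>x. p x * r c x $ i) = cell_integral (mass_rule M) v c (\<lambda>x. p x * r' c x $ i)"
      using arg_cong[OF eq[OF p], of "\<lambda>z. z $ i" c] cell_integral_nth[OF int[OF r(1)], of i] cell_integral_nth[OF int[OF r(2)], of i]
      by simp
    also have "cell_integral (mass_rule M) v c (\<lambda>x. p x * r c x $ i) =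
        cell_integral (mass_rule M) v c (\<lambda>x. (p x)\<^sup>2 + p x * r' c x $ i)"
      by (simp add: p_def power2_eq_square algebra_simps)
    also have "\<dots> = cell_integral (mass_rule M) v c (\<lambda>x. (p x)\<^sup>2) + cell_integral (mass_rule M) v c (\<lambda>x. p x * r' c x $ i)"
    proof (rule cell_integral_add)
      have i: "cell_integrable (mass_rule M) v c (\<lambda>x. p x * s c x $ i)" if "s \<in> dg_space (deg M)" for s :: "'c \<Rightarrow> real^2 \<Rightarrow> real^'d"
        using cell_integrable_bounded_linear[OF bounded_linear_vec_nth int[OF that], of i] by simp
      show "cell_integrable (mass_rule M) v c (\<lambda>x. p x * r' c x $ i)" using i r(2) by blast
      have "(\<lambda>c x. r c x - r' c x) \<in> dg_space (deg M)"
        using r by (auto simp: dg_space_def intro: poly2_diff)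
      from i[OF this] show "cell_integrable (mass_rule M) v c (\<lambda>x. (p x)\<^sup>2)"
        by (simp add: p_def power2_eq_square)
    qed
    finally have "cell_integral (mass_rule M) v c (\<lambda>x. (p x)\<^sup>2) = 0" by simp
    then have "p = (\<lambda>_. 0)"
      using ok p unfolding oedg_method_ok_def by (metis less_irrefl)
    then show ?thesis by (simp add: p_def fun_eq_iff)
  qed
  then show ?thesis by (simp add: fun_eq_iff vec_eq_iff)
qed

section \<open>Rotation invariance of the fully discrete method\<close>

text \<open>A mesh leaves out of the domain only a null set of each cell, on which the initial data are
  unspecified.\<close>

lemma integrable_negligible_diff:
  fixes f :: "'a::euclidean_space \<Rightarrow> 'b::euclidean_space"
  assumes A: "A \<in> sets lebesgue" and K: "K \<in> sets lebesgue" and "A \<subseteq> K" "negligible (K - A)"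
  shows "integrable (lebesgue_on K) f \<longleftrightarrow> integrable (lebesgue_on A) f"
    and "(LINT x|lebesgue_on K. f x) = (LINT x|lebesgue_on A. f x)"
proof -
  have N: "K - A \<in> null_sets lebesgue" using assms by (simp flip: negligible_iff_null_sets)
  have eq: "AE x in lebesgue. (if x \<in> K then f x else 0) = (if x \<in> A then f x else 0)"
    using AE_not_in[OF N] by eventually_elim (use \<open>A \<subseteq> K\<close> in auto)
  have meas: "(\<lambda>x. if x \<in> K then f x else 0) \<in> borel_measurable lebesgue \<longleftrightarrow>
      (\<lambda>x. if x \<in> A then f x else 0) \<in> borel_measurable lebesgue"
    using borel_measurable_AE[OF _ eq] borel_measurable_AE[OF _ AE_symmetric[OF eq]] by blast
  show "integrable (lebesgue_on K) f \<longleftrightarrow> integrable (lebesgue_on A) f"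
    unfolding Lebesgue_Measure.integrable_restrict_UNIV[OF A, symmetric] Lebesgue_Measure.integrable_restrict_UNIV[OF K, symmetric]
    using integrable_cong_AE[OF _ _ eq] meas borel_measurable_integrable by blast
  show "(LINT x|lebesgue_on K. f x) = (LINT x|lebesgue_on A. f x)"
    unfolding Lebesgue_Measure.integral_restrict_UNIV[OF A, symmetric] Lebesgue_Measure.integral_restrict_UNIV[OF K, symmetric]
  proof (cases "(\<lambda>x. if x \<in> K then f x else 0) \<in> borel_measurable lebesgue")
    case True
    then show "(LINT x|lebesgue. (if x \<in> K then f x else 0)) = (LINT x|lebesgue. (if x \<in> A then f x else 0))"
      using meas by (intro integral_cong_AE eq) auto
  next
    case False
    then have "\<not> integrable lebesgue (\<lambda>x. if x \<in> K then f x else 0)" "\<not> integrable lebesgue (\<lambda>x. if x \<in> A then f x else 0)"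
      using meas borel_measurable_integrable by blast+
    then show "(LINT x|lebesgue. (if x \<in> K then f x else 0)) = (LINT x|lebesgue. (if x \<in> A then f x else 0))"
      by (simp add: not_integrable_integral_eq)
  qed
qed

lemma mesh_on_cell_domain:
  assumes v: "mesh_on v \<Omega>"
  shows "cell v c \<inter> \<Omega> \<in> sets lebesgue" "negligible (cell v c - cell v c \<inter> \<Omega>)"
proof -
  show "cell v c \<inter> \<Omega> \<in> sets lebesgue"
    using mesh_on_cell(3)[OF v] mesh_on_domain_sets[OF v] by (rule sets.Int)
  have "cell v c - cell v c \<inter> \<Omega> \<subseteq> cell v c - interior (cell v c)"
    using v unfolding mesh_on_def by blast
  then show "negligible (cell v c - cell v c \<inter> \<Omega>)"
    using negligible_subset mesh_on_cell(4)[OF v] by blast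
qed

lemma mesh_on_cell_integral_cong:
  fixes f g :: "real^2 \<Rightarrow> real"
  assumes v: "mesh_on v \<Omega>" and eq: "\<And>x. x \<in> \<Omega> \<Longrightarrow> f x = g x"
  shows "integrable (lebesgue_on (cell v c)) f \<longleftrightarrow> integrable (lebesgue_on (cell v c)) g"
    and "(LINT x|lebesgue_on (cell v c). f x) = (LINT x|lebesgue_on (cell v c). g x)"
proof -
  note d = integrable_negligible_diff[OF mesh_on_cell_domain(1)[OF v] mesh_on_cell(3)[OF v] Int_lower1 mesh_on_cell_domain(2)[OF v]]
  show "integrable (lebesgue_on (cell v c)) f \<longleftrightarrow> integrable (lebesgue_on (cell v c)) g"
    unfolding d(1) using eq by (intro Bochner_Integration.integrable_cong) auto
  show "(LINT x|lebesgue_on (cell v c). f x) = (LINT x|lebesgue_on (cell v c). g x)"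
    unfolding d(2) using eq by (intro Bochner_Integration.integral_cong) auto
qed

lemma l2_proj_vec_cong:
  assumes v: "mesh_on v \<Omega>" and eq: "\<And>x. x \<in> \<Omega> \<Longrightarrow> w x = w' x"
  shows "l2_proj_vec m (cell v c) w = l2_proj_vec m (cell v c) w'"
proof -
  have "(LINT x|lebesgue_on (cell v c). w x $ i * q x) = (LINT x|lebesgue_on (cell v c). w' x $ i * q x)" for q i
    by (rule mesh_on_cell_integral_cong(2)[OF v]) (simp add: eq)
  then show ?thesis by (simp add: fun_eq_iff l2_proj_vec_def l2_proj_def)
qed

lemma poly_integrable_cong:
  assumes v: "mesh_on v \<Omega>" and eq: "\<And>x. x \<in> \<Omega> \<Longrightarrow> w x = w' x"
  shows "poly_integrable (cell v c) w \<longleftrightarrow> poly_integrable (cell v c) w'"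
proof -
  have "integrable (lebesgue_on (cell v c)) (\<lambda>x. w x * q x) \<longleftrightarrow> integrable (lebesgue_on (cell v c)) (\<lambda>x. w' x * q x)" for q
    by (rule mesh_on_cell_integral_cong(1)[OF v]) (simp add: eq)
  then show ?thesis by (simp add: poly_integrable_def)
qed

lemma square_integrable_poly_integrable:
  assumes v: "mesh_on v \<Omega>" and w: "square_integrable_on \<Omega> w"
  shows "poly_integrable (cell v c) (\<lambda>x. w x $ i)"
  unfolding poly_integrable_def
proof (intro allI ballI)
  fix m q assume q: "q \<in> poly2 m"
  let ?A = "cell v c \<inter> \<Omega>"
  note d = integrable_negligible_diff(1)[OF mesh_on_cell_domain(1)[OF v] mesh_on_cell(3)[OF v] Int_lower1 mesh_on_cell_domain(2)[OF v]]
  have \<Omega>: "\<Omega> \<in> sets lebesgue" by (rule mesh_on_domain_sets[OF v])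
  have "set_integrable lebesgue \<Omega> (\<lambda>x. (w x $ i)\<^sup>2)"
    using w \<Omega> by (simp add: square_integrable_on_def set_integrable_def integrable_restrict_space)
  then have "set_integrable lebesgue ?A (\<lambda>x. (w x $ i)\<^sup>2)"
    using mesh_on_cell_domain(1)[OF v] by (rule set_integrable_subset) simp
  then have "integrable (lebesgue_on ?A) (\<lambda>x. (w x $ i)\<^sup>2)"
    using mesh_on_cell_domain(1)[OF v] by (simp add: set_integrable_def integrable_restrict_space)
  moreover have "integrable (lebesgue_on ?A) (\<lambda>x. q x * q x)"
    using poly2_integrable[OF mesh_on_cell(1)[OF v] q q] unfolding d .
  ultimately have dom: "integrable (lebesgue_on ?A) (\<lambda>x. (w x $ i)\<^sup>2 + q x * q x)" by simp
  have "(\<lambda>x. w x $ i) \<in> borel_measurable (lebesgue_on \<Omega>)"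
    using w by (simp add: square_integrable_on_def)
  then have "(\<lambda>x. w x $ i) \<in> borel_measurable (lebesgue_on ?A)"
    by (rule measurable_restrict_mono) simp
  moreover have "q \<in> borel_measurable (lebesgue_on ?A)"
    by (rule continuous_imp_measurable_on_sets_lebesgue[OF poly2_continuous_on[OF q] mesh_on_cell_domain(1)[OF v]])
  ultimately have meas: "(\<lambda>x. w x $ i * q x) \<in> borel_measurable (lebesgue_on ?A)"
    by (rule borel_measurable_times)
  have "norm (a * b) \<le> a\<^sup>2 + b * b" for a b :: real
  proof -
    have "2 * (\<bar>a\<bar> * \<bar>b\<bar>) \<le> \<bar>a\<bar>\<^sup>2 + \<bar>b\<bar>\<^sup>2" using sum_squares_bound[of "\<bar>a\<bar>" "\<bar>b\<bar>"] by simp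
    moreover have "0 \<le> \<bar>a\<bar> * \<bar>b\<bar>" by simp
    ultimately have "\<bar>a\<bar> * \<bar>b\<bar> \<le> \<bar>a\<bar>\<^sup>2 + \<bar>b\<bar>\<^sup>2" by linarith
    then show ?thesis by (simp add: abs_mult power2_eq_square)
  qed
  then have "integrable (lebesgue_on ?A) (\<lambda>x. w x $ i * q x)"
    using measurable_bounded_by_integrable_imp_lebesgue_integrable[OF meas dom _ mesh_on_cell_domain(1)[OF v]] by blast
  then show "integrable (lebesgue_on (cell v c)) (\<lambda>x. w x $ i * q x)" unfolding d .
qed

lemma smooth_bdata_rotate:
  fixes B :: "('c, 'd::finite) bdata"
  assumes V: "vector_pairs V" and B: "smooth_bdata k B"
  shows "smooth_bdata k (rotate_bdata V \<phi> B)"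
  unfolding smooth_bdata_def
proof (intro ballI allI)
  fix u :: "'c \<Rightarrow> real^2 \<Rightarrow> real^'d" and c i assume "u \<in> dg_space k"
  then have "smooth k (B (\<lambda>c'. rotate_field V (- \<phi>) (u c')) c i)"
    using B rotate_field_dg_space[OF V] unfolding smooth_bdata_def by blast
  from smooth_bounded_linear[OF matrix_vector_mul_bounded_linear smooth_rot[OF this]]
  show "smooth k (rotate_bdata V \<phi> B u c i)"
    unfolding rotate_bdata_def rotate_field_def[abs_def] .
qed

lemma dg_space_lincomb:
  assumes "\<And>r. r \<in> I \<Longrightarrow> y r \<in> dg_space k" "\<And>r. r \<in> I \<Longrightarrow> d r \<in> dg_space k"
  shows "(\<lambda>c x. \<Sum>r\<in>I. a r *\<^sub>R (y r c x + b r *\<^sub>R d r c x)) \<in> dg_space k"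
  using assms unfolding dg_space_def by (auto intro!: poly2_sum poly2_cmult poly2_add)

lemma rotate_field_lincomb:
  "rotate_field V \<phi> (\<lambda>x. \<Sum>r\<in>I. a r *\<^sub>R (y r x + b r *\<^sub>R d r x)) =
    (\<lambda>x. \<Sum>r\<in>I. a r *\<^sub>R (rotate_field V \<phi> (y r) x + b r *\<^sub>R rotate_field V \<phi> (d r) x))"
  by (simp add: fun_eq_iff rotate_field_def linear_sum[OF matrix_vector_mul_linear]
      matrix_vector_right_distrib matrix_vector_mult_scaleR)

lemma oedg_step_dg_space:
  assumes v: "mesh_on v \<Omega>" and u: "y 0 \<in> dg_space (deg M)"
    and step: "\<And>l. l < s \<Longrightarrow> dg_derivative S M v (B (t + abscissa M l * dt)) (y l) (d l) \<and>
        y (Suc l) = rioe S (deg M) \<Omega> v (B (t + abscissa M (Suc l) * dt)) dt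
          (\<lambda>c x. \<Sum>r\<le>l. weight M l r *\<^sub>R (y r c x + (fe_step M l r * dt) *\<^sub>R d r c x))"
  shows "l \<le> s \<Longrightarrow> y l \<in> dg_space (deg M)"
proof (induction l rule: less_induct)
  case (less l)
  show ?case
  proof (cases l)
    case 0
    then show ?thesis using u by simp
  next
    case (Suc k)
    have "y r \<in> dg_space (deg M)" if "r \<in> {..k}" for r
      using that less Suc by auto
    moreover have "d r \<in> dg_space (deg M)" if "r \<in> {..k}" for r
      using that step[of r] less.prems Suc by (auto simp: dg_derivative_def)
    ultimately have "(\<lambda>c x. \<Sum>r\<le>k. weight M k r *\<^sub>R (y r c x + (fe_step M k r * dt) *\<^sub>R d r c x)) \<in> dg_space (deg M)"
      by (rule dg_space_lincomb)
    then show ?thesis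
      using step[of k] less.prems Suc rioe_dg_space[OF v] by simp
  qed
qed

lemma oedg_step_rotate:
  fixes S :: "('d::finite) system" and M :: "('c::finite, 'd) oedg_method"
  assumes hyp: "hyperbolic S" and V: "vector_pairs (vecs S)" and ri: "rotation_invariant_system S"
    and F: "rotation_invariant_flux S (numflux M)" and v: "mesh_on v \<Omega>"
    and B: "\<And>t. smooth_bdata (deg M) (B t)" and u: "u \<in> dg_space (deg M)"
    and step: "oedg_step S M \<Omega> v B t dt u u'"
  shows "u' \<in> dg_space (deg M)"
    and "oedg_step S M ((*v) (rot \<phi>) ` \<Omega>) (rotate_mesh \<phi> v) (\<lambda>t. rotate_bdata (vecs S) \<phi> (B t)) t dt
      (\<lambda>c. rotate_field (vecs S) \<phi> (u c)) (\<lambda>c. rotate_field (vecs S) \<phi> (u' c))"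
proof -
  obtain y d where y0: "y 0 = u" and u': "u' = y (stages M)"
    and st: "\<And>l. l < stages M \<Longrightarrow> dg_derivative S M v (B (t + abscissa M l * dt)) (y l) (d l) \<and>
        y (Suc l) = rioe S (deg M) \<Omega> v (B (t + abscissa M (Suc l) * dt)) dt
          (\<lambda>c x. \<Sum>r\<le>l. weight M l r *\<^sub>R (y r c x + (fe_step M l r * dt) *\<^sub>R d r c x))"
    using step unfolding oedg_step_def by auto
  have y: "y l \<in> dg_space (deg M)" if "l \<le> stages M" for l
    using oedg_step_dg_space[OF v _ st that] u y0 by blast
  then show "u' \<in> dg_space (deg M)" using u' by simp
  show "oedg_step S M ((*v) (rot \<phi>) ` \<Omega>) (rotate_mesh \<phi> v) (\<lambda>t. rotate_bdata (vecs S) \<phi> (B t)) t dt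
      (\<lambda>c. rotate_field (vecs S) \<phi> (u c)) (\<lambda>c. rotate_field (vecs S) \<phi> (u' c))"
    unfolding oedg_step_def
  proof (intro exI conjI allI impI)
    let ?y = "\<lambda>l c. rotate_field (vecs S) \<phi> (y l c)" and ?d = "\<lambda>l c. rotate_field (vecs S) \<phi> (d l c)"
    show "?y 0 = (\<lambda>c. rotate_field (vecs S) \<phi> (u c))" by (simp add: y0)
    show "(\<lambda>c. rotate_field (vecs S) \<phi> (u' c)) = ?y (stages M)" by (simp add: u')
    fix l assume l: "l < stages M"
    show "dg_derivative S M (rotate_mesh \<phi> v) (rotate_bdata (vecs S) \<phi> (B (t + abscissa M l * dt))) (?y l) (?d l)"
      using st[OF l] by (intro dg_derivative_rotate[OF V ri F v]) simp
    have "d r \<in> dg_space (deg M)" if "r \<in> {..l}" for r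
      using st[of r] l that by (auto simp: dg_derivative_def)
    then have "(\<lambda>c x. \<Sum>r\<le>l. weight M l r *\<^sub>R (y r c x + (fe_step M l r * dt) *\<^sub>R d r c x)) \<in> dg_space (deg M)"
      using y l by (intro dg_space_lincomb) auto
    note rioe = rioe_rotate[OF hyp V ri v this B]
    show "?y (Suc l) =
      rioe S (deg M) ((*v) (rot \<phi>) ` \<Omega>) (rotate_mesh \<phi> v) (rotate_bdata (vecs S) \<phi> (B (t + abscissa M (Suc l) * dt))) dt
          (\<lambda>c x. \<Sum>r\<le>l. weight M l r *\<^sub>R (?y r c x + (fe_step M l r * dt) *\<^sub>R ?d r c x))"
      unfolding conjunct2[OF st[OF l]] by (rule ext) (simp only: rioe[symmetric] rotate_field_lincomb)
  qed
qed

lemma oedg_solution_rotate: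
  fixes S :: "('d::finite) system" and M :: "('c::finite, 'd) oedg_method"
  assumes hyp: "hyperbolic S" and V: "vector_pairs (vecs S)" and ri: "rotation_invariant_system S"
    and F: "rotation_invariant_flux S (numflux M)" and v: "mesh_on v \<Omega>"
    and B: "\<And>t. smooth_bdata (deg M) (B t)"
    and u0: "\<And>c i. poly_integrable (cell v c) (\<lambda>x. u0 x $ i)"
    and u0': "\<And>x. x \<in> \<Omega> \<Longrightarrow> u0' (rot \<phi> *v x) = comp_rot (vecs S) \<phi> *v u0 x"
    and sol: "oedg_solution S M \<Omega> v B u0 N t u"
  shows "oedg_solution S M ((*v) (rot \<phi>) ` \<Omega>) (rotate_mesh \<phi> v) (\<lambda>t. rotate_bdata (vecs S) \<phi> (B t)) u0' N t
      (\<lambda>n c. rotate_field (vecs S) \<phi> (u n c))"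
proof -
  have t0: "t 0 = 0" and init: "\<And>c. u 0 c = l2_proj_vec (deg M) (cell v c) u0"
    and steps: "\<And>n. n < N \<Longrightarrow> let dt = dt_rule M n (t n) (edge_length v) (edge_height v)
                  (\<lambda>c i b. wave_speed S (u n c (cell_point v c b)) (outward_normal v c i))
             in 0 < dt \<and> t (Suc n) = t n + dt \<and> oedg_step S M \<Omega> v B (t n) dt (u n) (u (Suc n))"
    using sol unfolding oedg_solution_def by auto
  have "rotate_field (vecs S) \<phi> (u 0 c) = l2_proj_vec (deg M) (cell (rotate_mesh \<phi> v) c) u0'" for c
  proof -
    have "rotate_field (vecs S) \<phi> (u 0 c) = l2_proj_vec (deg M) (cell (rotate_mesh \<phi> v) c) (rotate_field (vecs S) \<phi> u0)"
      using l2_proj_vec_rotate_field[OF V mesh_on_cell(1,2)[OF v] u0] by (simp add: cell_rotate_mesh init)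
    also have "\<dots> = l2_proj_vec (deg M) (cell (rotate_mesh \<phi> v) c) u0'"
      by (rule l2_proj_vec_cong[OF mesh_on_rotate[OF v, of \<phi>]]) (auto simp: u0')
    finally show ?thesis .
  qed
  moreover have u: "u n \<in> dg_space (deg M)" if "n \<le> N" for n
    using that
  proof (induction n)
    case 0
    show ?case
      using l2_proj_vec_component[OF mesh_on_cell(1,2)[OF v] u0] by (simp add: dg_space_def init)
  next
    case (Suc n)
    then show ?case
      using steps[of n] oedg_step_rotate(1)[OF hyp V ri F v B] by (auto simp: Let_def)
  qed
  moreover have "edge_length (rotate_mesh \<phi> v) = edge_length v" "edge_height (rotate_mesh \<phi> v) = edge_height v"
    by (simp_all add: fun_eq_iff)
  moreover have "wave_speed S (rotate_field (vecs S) \<phi> (u n c) (cell_point (rotate_mesh \<phi> v) c b)) (outward_normal (rotate_mesh \<phi> v) c i)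
      = wave_speed S (u n c (cell_point v c b)) (outward_normal v c i)" for n c i b
    by (simp add: outward_normal_rotate_mesh[OF v] wave_speed_comp_rot[OF hyp V ri])
  ultimately show ?thesis
    using t0 steps oedg_step_rotate(2)[OF hyp V ri F v B u]
    unfolding oedg_solution_def Let_def by simp
qed

lemma oedg_step_unique:
  fixes S :: "('d::finite) system" and M :: "('c::finite, 'd) oedg_method"
  assumes ok: "oedg_method_ok M v" and v: "mesh_on v \<Omega>"
    and "oedg_step S M \<Omega> v B t dt u u'" "oedg_step S M \<Omega> v B t dt u u''"
  shows "u' = u''"
proof -
  obtain y d where y: "y 0 = u" "u' = y (stages M)"
    and st: "\<And>l. l < stages M \<Longrightarrow> dg_derivative S M v (B (t + abscissa M l * dt)) (y l) (d l) \<and>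
        y (Suc l) = rioe S (deg M) \<Omega> v (B (t + abscissa M (Suc l) * dt)) dt
          (\<lambda>c x. \<Sum>r\<le>l. weight M l r *\<^sub>R (y r c x + (fe_step M l r * dt) *\<^sub>R d r c x))"
    using assms(3) unfolding oedg_step_def by auto
  obtain z e where z: "z 0 = u" "u'' = z (stages M)"
    and st': "\<And>l. l < stages M \<Longrightarrow> dg_derivative S M v (B (t + abscissa M l * dt)) (z l) (e l) \<and>
        z (Suc l) = rioe S (deg M) \<Omega> v (B (t + abscissa M (Suc l) * dt)) dt
          (\<lambda>c x. \<Sum>r\<le>l. weight M l r *\<^sub>R (z r c x + (fe_step M l r * dt) *\<^sub>R e r c x))"
    using assms(4) unfolding oedg_step_def by auto
  have "l \<le> stages M \<Longrightarrow> y l = z l" for l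
  proof (induction l rule: less_induct)
    case (less l)
    show ?case
    proof (cases l)
      case 0
      then show ?thesis using y(1) z(1) by simp
    next
      case (Suc k)
      have yz: "y r = z r" if "r \<le> k" for r using that less Suc by simp
      have de: "d r = e r" if "r \<le> k" for r
      proof -
        have "r < stages M" using that less.prems Suc by simp
        then show ?thesis
          using dg_derivative_unique[OF ok v] st[of r] st'[of r] yz[OF that] by metis
      qed
      have "(\<lambda>c x. \<Sum>r\<le>k. weight M k r *\<^sub>R (y r c x + (fe_step M k r * dt) *\<^sub>R d r c x)) =
        (\<lambda>c x. \<Sum>r\<le>k. weight M k r *\<^sub>R (z r c x + (fe_step M k r * dt) *\<^sub>R e r c x))"
        by (intro ext sum.cong) (simp_all add: yz de)
      then show ?thesis using st[of k] st'[of k] less.prems Suc by simp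
    qed
  qed
  then show ?thesis using y(2) z(2) by simp
qed

lemma oedg_solution_unique:
  fixes S :: "('d::finite) system" and M :: "('c::finite, 'd) oedg_method"
  assumes ok: "oedg_method_ok M v" and v: "mesh_on v \<Omega>"
    and sol: "oedg_solution S M \<Omega> v B u0 N t u" "oedg_solution S M \<Omega> v B u0 N t' u'"
  shows "n \<le> N \<Longrightarrow> t' n = t n \<and> u' n = u n"
proof (induction n)
  case 0
  then show ?case using sol by (auto simp: oedg_solution_def fun_eq_iff)
next
  case (Suc n)
  define dt where "dt = dt_rule M n (t n) (edge_length v) (edge_height v)
      (\<lambda>c i b. wave_speed S (u n c (cell_point v c b)) (outward_normal v c i))"
  have IH: "t' n = t n" "u' n = u n" and "n < N" using Suc by simp_all
  have "t (Suc n) = t n + dt \<and> oedg_step S M \<Omega> v B (t n) dt (u n) (u (Suc n))"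
    using sol(1) \<open>n < N\<close> unfolding oedg_solution_def Let_def dt_def by blast
  moreover have "t' (Suc n) = t' n + dt \<and> oedg_step S M \<Omega> v B (t' n) dt (u' n) (u' (Suc n))"
    using sol(2) \<open>n < N\<close> unfolding oedg_solution_def Let_def dt_def IH[symmetric] by blast
  ultimately show ?case using oedg_step_unique[OF ok v] unfolding IH by metis
qed

text \<open>The converse is the forward implication for the angle \<open>- \<phi>\<close> and the
  rotated mesh; the initial data there inherit the integrability of their moments from
  \<open>u0\<close>.\<close>

lemma oedg_solution_rotate_iff:
  fixes S :: "('d::finite) system" and M :: "('c::finite, 'd) oedg_method"
  assumes hyp: "hyperbolic S" and V: "vector_pairs (vecs S)" and ri: "rotation_invariant_system S"
    and F: "rotation_invariant_flux S (numflux M)" and v: "mesh_on v \<Omega>"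
    and B: "\<And>t. smooth_bdata (deg M) (B t)"
    and u0: "square_integrable_on \<Omega> u0"
    and u0': "\<And>x. x \<in> \<Omega> \<Longrightarrow> u0' (rot \<phi> *v x) = comp_rot (vecs S) \<phi> *v u0 x"
  shows "oedg_solution S M \<Omega> v B u0 N t u \<longleftrightarrow>
    oedg_solution S M ((*v) (rot \<phi>) ` \<Omega>) (rotate_mesh \<phi> v) (\<lambda>t. rotate_bdata (vecs S) \<phi> (B t)) u0' N t
      (\<lambda>n c. rotate_field (vecs S) \<phi> (u n c))" (is "?sol \<longleftrightarrow> ?rsol")
proof
  have u0i: "poly_integrable (cell v c) (\<lambda>x. u0 x $ i)" for c i
    by (rule square_integrable_poly_integrable[OF v u0])
  show ?rsol if ?sol
    by (rule oedg_solution_rotate[OF hyp V ri F v B u0i _ that]) (rule u0')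
  assume r: ?rsol
  have pint: "poly_integrable (cell (rotate_mesh \<phi> v) c) (\<lambda>x. u0' x $ i)" for c i
  proof -
    have "poly_integrable (cell (rotate_mesh \<phi> v) c) (\<lambda>x. rotate_field (vecs S) \<phi> u0 x $ i)"
      unfolding cell_rotate_mesh by (rule poly_integrable_rotate_field[OF V mesh_on_cell(1)[OF v] u0i])
    moreover have "rotate_field (vecs S) \<phi> u0 x $ i = u0' x $ i" if "x \<in> (*v) (rot \<phi>) ` \<Omega>" for x
      using that u0' by auto
    ultimately show ?thesis
      using poly_integrable_cong[where w = "\<lambda>x. rotate_field (vecs S) \<phi> u0 x $ i" and w' = "\<lambda>x. u0' x $ i",
          OF mesh_on_rotate[OF v, of \<phi>]] by simp
  qed
  have u0_back: "u0 (rot (- \<phi>) *v x) = comp_rot (vecs S) (- \<phi>) *v u0' x" if "x \<in> (*v) (rot \<phi>) ` \<Omega>" for x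
    using that u0' comp_rot_minus_cancel[OF V] by auto
  have "oedg_solution S M ((*v) (rot (- \<phi>)) ` (*v) (rot \<phi>) ` \<Omega>) (rotate_mesh (- \<phi>) (rotate_mesh \<phi> v))
      (\<lambda>t. rotate_bdata (vecs S) (- \<phi>) (rotate_bdata (vecs S) \<phi> (B t))) u0 N t
      (\<lambda>n c. rotate_field (vecs S) (- \<phi>) (rotate_field (vecs S) \<phi> (u n c)))"
    by (rule oedg_solution_rotate[OF hyp V ri F mesh_on_rotate[OF v] smooth_bdata_rotate[OF V B] pint _ r]) (rule u0_back)
  then show ?sol
    by (simp only: rot_image_cancel rotate_mesh_minus_cancel rotate_bdata_minus_cancel[OF V]
        rotate_field_minus_cancel[OF V])
qed

theorem theorem3p4:
  fixes S :: "('d::finite) system" and \<Omega> :: "(real^2) set" and v :: "('c::finite) mesh"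
  assumes "CARD('d) \<ge> 2"
    and "vector_pairs (vecs S)"
    and "hyperbolic S"
    and "rotation_invariant_system S"
    and "triangulates v \<Omega>"
  shows "(\<forall>k B dt \<phi> u u'.
            1 \<le> k \<and> 0 < dt \<and> smooth_bdata k B \<and>
            u \<in> dg_space k \<and> u' \<in> dg_space k \<and> rotation_related (vecs S) \<phi> v u u' \<longrightarrow>
            rotation_related (vecs S) \<phi> v (rioe S k \<Omega> v B dt u)
              (rioe S k ((*v) (rot \<phi>) ` \<Omega>) (rotate_mesh \<phi> v) (rotate_bdata (vecs S) \<phi> B) dt u'))
       \<and> (\<forall>(M :: ('c, 'd) oedg_method) B \<phi> u0 u0'.
            oedg_method_ok M v \<and> rotation_invariant_flux S (numflux M) \<and>
            (\<forall>t. smooth_bdata (deg M) (B t)) \<and> square_integrable_on \<Omega> u0 \<and>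
            (\<forall>x\<in>\<Omega>. u0' (rot \<phi> *v x) = comp_rot (vecs S) \<phi> *v u0 x) \<longrightarrow>
            (let rotated_solution = oedg_solution S M ((*v) (rot \<phi>) ` \<Omega>) (rotate_mesh \<phi> v)
                   (\<lambda>t. rotate_bdata (vecs S) \<phi> (B t)) u0'
             in (\<forall>N t u. oedg_solution S M \<Omega> v B u0 N t u \<longleftrightarrow>
                    rotated_solution N t (\<lambda>n c. rotate_field (vecs S) \<phi> (u n c))) \<and>
                (\<forall>N t u t' u'. oedg_solution S M \<Omega> v B u0 N t u \<and> rotated_solution N t' u' \<longrightarrow>
                    (\<forall>n\<le>N. t' n = t n \<and> rotation_related (vecs S) \<phi> v (u n) (u' n)))))"
proof -
  have V: "vector_pairs (vecs S)" and hyp: "hyperbolic S" and ri: "rotation_invariant_system S"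
    by fact+
  have v: "mesh_on v \<Omega>" using assms(5) by (rule triangulates_mesh_on)
  have procedure: "rotation_related (vecs S) \<phi> v (rioe S k \<Omega> v B dt u)
        (rioe S k ((*v) (rot \<phi>) ` \<Omega>) (rotate_mesh \<phi> v) (rotate_bdata (vecs S) \<phi> B) dt u')"
    if B: "smooth_bdata k B" and u: "u \<in> dg_space k" "u' \<in> dg_space k"
      and rel: "rotation_related (vecs S) \<phi> v u u'" for k B dt \<phi> u u'
    unfolding rotation_related_imp_eq[OF V v u rel]
    by (simp add: rotation_related_def rioe_rotate[OF hyp V ri v u(1) B])
  have equiv: "oedg_solution S M \<Omega> v B u0 N t u \<longleftrightarrow>
      oedg_solution S M ((*v) (rot \<phi>) ` \<Omega>) (rotate_mesh \<phi> v) (\<lambda>t. rotate_bdata (vecs S) \<phi> (B t)) u0' N t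
        (\<lambda>n c. rotate_field (vecs S) \<phi> (u n c))"
    if "rotation_invariant_flux S (numflux M)" "\<forall>t. smooth_bdata (deg M) (B t)" "square_integrable_on \<Omega> u0"
      "\<forall>x\<in>\<Omega>. u0' (rot \<phi> *v x) = comp_rot (vecs S) \<phi> *v u0 x"
    for M :: "('c, 'd) oedg_method" and B \<phi> u0 u0' N t u
    using that by (intro oedg_solution_rotate_iff[OF hyp V ri _ v]) auto
  have unique: "t' n = t n \<and> rotation_related (vecs S) \<phi> v (u n) (u' n)"
    if ok: "oedg_method_ok M v" and inv: "rotation_invariant_flux S (numflux M)" "\<forall>t. smooth_bdata (deg M) (B t)"
        "square_integrable_on \<Omega> u0" "\<forall>x\<in>\<Omega>. u0' (rot \<phi> *v x) = comp_rot (vecs S) \<phi> *v u0 x"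
      and sol: "oedg_solution S M \<Omega> v B u0 N t u"
      and sol': "oedg_solution S M ((*v) (rot \<phi>) ` \<Omega>) (rotate_mesh \<phi> v) (\<lambda>t. rotate_bdata (vecs S) \<phi> (B t)) u0' N t' u'"
      and n: "n \<le> N"
    for M :: "('c, 'd) oedg_method" and B \<phi> u0 u0' N t u t' u' n
  proof -
    have "oedg_solution S M \<Omega> v B u0 N t' (\<lambda>n c. rotate_field (vecs S) (- \<phi>) (u' n c))"
      using sol' equiv[OF inv, of N t' "\<lambda>n c. rotate_field (vecs S) (- \<phi>) (u' n c)"] V by simp
    from oedg_solution_unique[OF ok v sol this n]
    have "t' n = t n" and un: "(\<lambda>c. rotate_field (vecs S) (- \<phi>) (u' n c)) = u n" by simp_all
    moreover have "u' n = (\<lambda>c. rotate_field (vecs S) \<phi> (u n c))"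
      using V by (simp flip: un)
    ultimately show ?thesis by (simp add: rotation_related_rotate_field)
  qed
  show ?thesis
    unfolding Let_def
    by (intro conjI allI impI; elim conjE)
      (rule procedure equiv unique[THEN conjunct1] unique[THEN conjunct2]; assumption)+
qed

end
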